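(* Let $F=F_1\oplus\dotsb\oplus F_n$ be a direct sum of symmetric Frobenius $\Bbbk$-algebras, regarded as a Frobenius algebra with trace $\mathrm{tr}(f_1,\dotsc,f_n)=\sum_i \mathrm{tr}_i(f_i)$, and let $k\in\mathbb{Z}$. Then the Frobenius Heisenberg category $\mathcal{H}\mathit{eis}_{F,k}$ and the category $\mathcal{H}\mathit{eis}_{F,k}'$ given by the colored presentation (both defined in the context) are isomorphic.
   Context: **Setting.** $\Bbbk$ is a commutative ring. A (symmetric) Frobenius algebra is a $\Bbbk$-algebra, free of finite rank, with a $\Bbbk$-linear trace map $\mathrm{tr}$ satisfying $\mathrm{tr}(ab)=\mathrm{tr}(ba)$ and such that every basis $B$ has a left dual basis $\{b^\vee: b\in B\}$, i.e. $\mathrm{tr}(a^\vee b)=\delta_{a,b}$ for $a,b\in B$. Let $F_1,\dotsc,F_n$ be such algebras with traces $\mathrm{tr}_i$, $F=\bigoplus_i F_i$ with $\mathrm{tr}=\sum_i\mathrm{tr}_i$. View $F_i\subseteq F$, put $e_i=1_{F_i}$, fix bases $B_i$ of $F_i$ and the basis $B=B_1\cup\dotsb\cup B_n$ of $F$ (so $b^\vee\in F_i$ for $b\in B_i$). No gradings or super structures are used. Fix $k\in\mathbb{Z}$. In strict monoidal categories, tensor product of objects is juxtaposition, $\mathbb{1}$ is the unit object, $1_\pm=\mathrm{id}_{Q_\pm}$, and $gf$ means $g\circ f$. **The category $\mathcal{H}\mathit{eis}_{F,k}$.** It is the strict $\Bbbk$-linear monoidal category with objects generated by $Q_+,Q_-$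 and morphisms generated by $x:Q_+\to Q_+$, $s:Q_+Q_+\to Q_+Q_+$, $c:\mathbb{1}\to Q_-Q_+$, $d:Q_+Q_-\to\mathbb{1}$, $\beta_f:Q_+\to Q_+$ ($f\in F$). Put $$t=(1_-\otimes 1_+\otimes d)(1_-\otimes s\otimes 1_-)(c\otimes 1_+\otimes 1_-):Q_+Q_-\to Q_-Q_+.$$ Relations: - $f\mapsto\beta_f$ is a (unital) algebra homomorphism $F\to\mathrm{End}(Q_+)$; $(s\otimes 1_+)(1_+\otimes s)(s\otimes 1_+)=(1_+\otimes s)(s\otimes 1_+)(1_+\otimes s)$; $s^2=\mathrm{id}$; $x\beta_f=\beta_f x$; $s(\beta_f\otimes 1_+)=(1_+\otimes\beta_f)s$; $(x\otimes 1_+)s-s(1_+\otimes x)=\sum_{b\in B}\beta_{b^\vee}\otimes\beta_b$. - $(d\otimes 1_+)(1_+\otimes c)=1_+$ and $(1_-\otimes d)(c\otimes 1_-)=1_-$. - Inversion relation: in the additive envelope the following matrix is an isomorphism (i.e. an inverse is formally adjoined): if $k\ge 0$, the column with entries $t$ and $d(x^r\beta_{b^\vee}\otimes 1_-)$, $0\le r\le k-1$, $b\in B$, as a morphism $Q_+Q_-\to Q_-Q_+\oplus\mathbb{1}^{\oplus k\dim F}$; if $k<0$, the row with entries $t$ and $(1_-\otimes x^r\beta_{b^\vee})c$, $0\le r\le -k-1$, $b\in B$, as a morphism $Q_+Q_-\oplus\mathbb{1}^{\oplus(-k\dim F)}\to Q_-Q_+$. **The category $\mathcal{H}\mathit{eis}'_{F,k}$.**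 It is the strict $\Bbbk$-linear monoidal category with objects generated by $Q_+,Q_-$ and morphisms generated by $s_{i,j}:Q_+Q_+\to Q_+Q_+$, $c_i:\mathbb{1}\to Q_-Q_+$, $d_i:Q_+Q_-\to\mathbb{1}$, $x_i:Q_+\to Q_+$, $\beta_{(f,i)}:Q_+\to Q_+$, for $i,j=1,\dotsc,n$ and $f\in F_i$. The upward strand of color $i$ is $1_+^{(i)}:=\beta_{(e_i,i)}$ and the downward strand of color $i$ is $1_-^{(i)}:=(1_-\otimes d_i)(c_i\otimes 1_-)$; $x_i^0:=1_+^{(i)}$. Put $$t_{i,j}=(1_-\otimes 1_+\otimes d_j)(1_-\otimes s_{j,i}\otimes 1_-)(c_j\otimes 1_+\otimes 1_-):Q_+Q_-\to Q_-Q_+.$$ Color conventions (part of the relations): $\beta_{(f,i)}\beta_{(g,j)}=0$ for $i\ne j$; $\sum_i 1_+^{(i)}=1_+$; $1_-^{(i)}1_-^{(j)}=\delta_{i,j}1_-^{(i)}$; $\sum_i1_-^{(i)}=1_-$; $s_{i,j}=(1_+^{(j)}\otimes 1_+^{(i)})s_{i,j}(1_+^{(i)}\otimes 1_+^{(j)})$; $x_i=1_+^{(i)}x_i1_+^{(i)}$; $c_i=(1_-^{(i)}\otimes 1_+^{(i)})c_i$; $d_i=d_i(1_+^{(i)}\otimes 1_-^{(i)})$. Further relations, for all $i,j,l\in\{1,\dotsc,n\}$ and $f,g\in F_i$: - $f\mapsto\beta_{(f,i)}$ is $\Bbbk$-linear and $\beta_{(f,i)}\beta_{(g,i)}=\beta_{(fg,i)}$;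 $(s_{j,l}\otimes 1_+^{(i)})(1_+^{(j)}\otimes s_{i,l})(s_{i,j}\otimes 1_+^{(l)})=(1_+^{(l)}\otimes s_{i,j})(s_{i,l}\otimes 1_+^{(j)})(1_+^{(i)}\otimes s_{j,l})$; $s_{j,i}s_{i,j}=1_+^{(i)}\otimes 1_+^{(j)}$; $x_i\beta_{(f,i)}=\beta_{(f,i)}x_i$; $s_{i,j}(\beta_{(f,i)}\otimes 1_+^{(j)})=(1_+^{(j)}\otimes\beta_{(f,i)})s_{i,j}$; $(x_j\otimes 1_+^{(i)})s_{i,j}-s_{i,j}(1_+^{(i)}\otimes x_j)=\delta_{i,j}\sum_{b\in B_i}\beta_{(b^\vee,i)}\otimes\beta_{(b,i)}$. - $(d_i\otimes 1_+)(1_+\otimes c_i)=1_+^{(i)}$ and $(1_-\otimes d_i)(c_i\otimes 1_-)=1_-^{(i)}$. - Inversion relation (in the additive Karoubi envelope, where $(X,e)$ denotes the image of an idempotent $e$ on $X$): for $i\ne j$, $t_{i,j}:(Q_+Q_-,1_+^{(i)}\otimes1_-^{(j)})\to(Q_-Q_+,1_-^{(j)}\otimes 1_+^{(i)})$ is invertible. For each $i$: if $k\ge0$, the column with entries $t_{i,i}$ and $d_i(x_i^r\beta_{(b^\vee,i)}\otimes 1_-)$, $0\le r\le k-1$, $b\in B_i$, is an isomorphism $(Q_+Q_-,1_+^{(i)}\otimes 1_-^{(i)})\to(Q_-Q_+,1_-^{(i)}\otimes 1_+^{(i)})\oplus\mathbb{1}^{\oplus k\dim F_i}$; if $k<0$,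 the row with entries $t_{i,i}$ and $(1_-\otimes x_i^r\beta_{(b^\vee,i)})c_i$, $0\le r\le -k-1$, $b\in B_i$, is an isomorphism $(Q_+Q_-,1_+^{(i)}\otimes 1_-^{(i)})\oplus\mathbb{1}^{\oplus(-k\dim F_i)}\to(Q_-Q_+,1_-^{(i)}\otimes 1_+^{(i)})$. *)

theory Defs
  imports "HOL-Algebra.Module"
begin

section \<open>Symmetric Frobenius algebras\<close>

locale k_algebra = module R A + A?: ring A for R (structure) and A (structure) +
  assumes smult_mult_left: "\<lbrakk>c \<in> carrier R; a \<in> carrier A; b \<in> carrier A\<rbrakk>
      \<Longrightarrow> (c \<odot>\<^bsub>A\<^esub> a) \<otimes>\<^bsub>A\<^esub> b = c \<odot>\<^bsub>A\<^esub> (a \<otimes>\<^bsub>A\<^esub> b)"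
    and smult_mult_right: "\<lbrakk>c \<in> carrier R; a \<in> carrier A; b \<in> carrier A\<rbrakk>
      \<Longrightarrow> a \<otimes>\<^bsub>A\<^esub> (c \<odot>\<^bsub>A\<^esub> b) = c \<odot>\<^bsub>A\<^esub> (a \<otimes>\<^bsub>A\<^esub> b)"

definition is_basis :: "('k, 'r) ring_scheme \<Rightarrow> ('k, 'a, 'm) module_scheme \<Rightarrow> 'a set \<Rightarrow> bool" where
  "is_basis R A B \<longleftrightarrow> finite B \<and> B \<subseteq> carrier A \<and>
     (\<forall>a\<in>carrier A. \<exists>!c. c \<in> B \<rightarrow>\<^sub>E carrier R \<and> a = (\<Oplus>\<^bsub>A\<^esub>b\<in>B. c b \<odot>\<^bsub>A\<^esub> b))"

definition is_left_dual_basis ::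
  "('k, 'r) ring_scheme \<Rightarrow> ('k, 'a, 'm) module_scheme \<Rightarrow> ('a \<Rightarrow> 'k) \<Rightarrow> 'a set \<Rightarrow> ('a \<Rightarrow> 'a) \<Rightarrow> bool" where
  "is_left_dual_basis R A tr B dual \<longleftrightarrow> is_basis R A (dual ` B) \<and>
     (\<forall>a\<in>B. \<forall>b\<in>B. tr (dual a \<otimes>\<^bsub>A\<^esub> b) = (if a = b then \<one>\<^bsub>R\<^esub> else \<zero>\<^bsub>R\<^esub>))"

locale frobenius_algebra = k_algebra R A
  for R :: "('k, 'r) ring_scheme" (structure) and A :: "('k, 'a, 'm) module_scheme" (structure) +
  fixes tr :: "'a \<Rightarrow> 'k"
  assumes tr_closed: "a \<in> carrier A \<Longrightarrow> tr a \<in> carrier R"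
    and tr_add: "\<lbrakk>a \<in> carrier A; b \<in> carrier A\<rbrakk> \<Longrightarrow> tr (a \<oplus>\<^bsub>A\<^esub> b) = tr a \<oplus>\<^bsub>R\<^esub> tr b"
    and tr_smult: "\<lbrakk>c \<in> carrier R; a \<in> carrier A\<rbrakk> \<Longrightarrow> tr (c \<odot>\<^bsub>A\<^esub> a) = c \<otimes>\<^bsub>R\<^esub> tr a"
    and tr_sym: "\<lbrakk>a \<in> carrier A; b \<in> carrier A\<rbrakk> \<Longrightarrow> tr (a \<otimes>\<^bsub>A\<^esub> b) = tr (b \<otimes>\<^bsub>A\<^esub> a)"
    and free: "\<exists>B. is_basis R A B"
    and dual_basis: "is_basis R A B \<Longrightarrow> \<exists>dual. is_left_dual_basis R A tr B dual"

text \<open>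
  In a Frobenius algebra the element \<open>frob_dual R A tr B b\<close> (written $b^\vee$ on paper) is the
  element of the left dual basis attached to \<open>b\<close>; it is unique because the dual basis spans.
\<close>

definition frob_dual ::
  "('k, 'r) ring_scheme \<Rightarrow> ('k, 'a, 'm) module_scheme \<Rightarrow> ('a \<Rightarrow> 'k) \<Rightarrow> 'a set \<Rightarrow> 'a \<Rightarrow> 'a" where
  "frob_dual R A tr B b =
     (THE a. a \<in> carrier A \<and> (\<forall>b'\<in>B. tr (a \<otimes>\<^bsub>A\<^esub> b') = (if b = b' then \<one>\<^bsub>R\<^esub> else \<zero>\<^bsub>R\<^esub>)))"

lemma (in frobenius_algebra) frob_dual_eq:
  assumes B: "is_basis R A B" and D: "is_left_dual_basis R A tr B dual" and b: "b \<in> B"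
  shows "frob_dual R A tr B b = dual b"
proof -
  let ?D = "dual ` B"
  have finB: "finite B" and BA: "B \<subseteq> carrier A" using B by (auto simp: is_basis_def)
  have DA: "?D \<subseteq> carrier A" and finD: "finite ?D"
    using D by (auto simp: is_left_dual_basis_def is_basis_def)
  have trD: "tr (dual a \<otimes>\<^bsub>A\<^esub> b) = (if a = b then \<one>\<^bsub>R\<^esub> else \<zero>\<^bsub>R\<^esub>)" if "a \<in> B" "b \<in> B" for a b
    using D that by (auto simp: is_left_dual_basis_def)
  have tr_zero: "tr \<zero>\<^bsub>A\<^esub> = \<zero>\<^bsub>R\<^esub>"
    using tr_add[of "\<zero>\<^bsub>A\<^esub>" "\<zero>\<^bsub>A\<^esub>"] tr_closed[of "\<zero>\<^bsub>A\<^esub>"] R.add.l_cancel_one'[of "tr \<zero>\<^bsub>A\<^esub>" "tr \<zero>\<^bsub>A\<^esub>"]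
    by simp
  have tr_sum: "tr ((\<Oplus>\<^bsub>A\<^esub>d\<in>S. c d \<odot>\<^bsub>A\<^esub> d) \<otimes>\<^bsub>A\<^esub> y) = (\<Oplus>\<^bsub>R\<^esub>d\<in>S. c d \<otimes>\<^bsub>R\<^esub> tr (d \<otimes>\<^bsub>A\<^esub> y))"
    if "finite S" "S \<subseteq> carrier A" "c \<in> S \<rightarrow> carrier R" "y \<in> carrier A" for S c y
    using that
  proof (induction S rule: finite_induct)
    case empty then show ?case by (simp add: tr_zero)
  next
    case (insert d S)
    have 1: "(\<lambda>d. c d \<odot>\<^bsub>A\<^esub> d) \<in> S \<rightarrow> carrier A" using insert by auto
    have 2: "(\<lambda>d. c d \<otimes>\<^bsub>R\<^esub> tr (d \<otimes>\<^bsub>A\<^esub> y)) \<in> S \<rightarrow> carrier R" using insert by (auto intro: tr_closed)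
    have 3: "d \<in> carrier A" "c d \<in> carrier R" "y \<in> carrier A" using insert by auto
    show ?case using insert 1 2 3
      by (simp add: A.l_distr tr_add smult_mult_left tr_smult tr_closed M.finsum_closed)
  qed
  have uniq: "x = y"
    if x: "x \<in> carrier A" and y: "y \<in> carrier A"
      and xy: "\<And>b'. b' \<in> B \<Longrightarrow> tr (x \<otimes>\<^bsub>A\<^esub> b') = tr (y \<otimes>\<^bsub>A\<^esub> b')" for x y
  proof -
    have coord: "c (dual b') = tr (z \<otimes>\<^bsub>A\<^esub> b')"
      if z: "z = (\<Oplus>\<^bsub>A\<^esub>d\<in>?D. c d \<odot>\<^bsub>A\<^esub> d)" and c: "c \<in> ?D \<rightarrow>\<^sub>E carrier R" and b': "b' \<in> B" for z c b'
    proof -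
      have cc: "c \<in> ?D \<rightarrow> carrier R" using c by (auto simp: PiE_def)
      have "tr (z \<otimes>\<^bsub>A\<^esub> b') = (\<Oplus>\<^bsub>R\<^esub>d\<in>?D. c d \<otimes>\<^bsub>R\<^esub> tr (d \<otimes>\<^bsub>A\<^esub> b'))"
        unfolding z using tr_sum[OF finD DA cc] b' BA by auto
      also have "\<dots> = (\<Oplus>\<^bsub>R\<^esub>d\<in>?D. if dual b' = d then c d else \<zero>\<^bsub>R\<^esub>)"
      proof (rule R.add.finprod_cong')
        fix d assume "d \<in> ?D"
        then obtain a where a: "a \<in> B" "d = dual a" by auto
        have cd: "c d \<in> carrier R" using cc a by auto
        show "c d \<otimes>\<^bsub>R\<^esub> tr (d \<otimes>\<^bsub>A\<^esub> b') = (if dual b' = d then c d else \<zero>\<^bsub>R\<^esub>)"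
        proof (cases "dual b' = d")
          case True
          have "tr (d \<otimes>\<^bsub>A\<^esub> b') = \<one>\<^bsub>R\<^esub>" using trD[OF b' b'] True by simp
          then show ?thesis using True cd by simp
        next
          case False
          then have "a \<noteq> b'" using a by auto
          then have "tr (d \<otimes>\<^bsub>A\<^esub> b') = \<zero>\<^bsub>R\<^esub>" using trD[OF a(1) b'] a by simp
          then show ?thesis using False cd by simp
        qed
      qed (use cc in auto)
      also have "\<dots> = c (dual b')"
        using R.add.finprod_singleton[of "dual b'" ?D c] finD b' cc by auto
      finally show ?thesis by simp
    qed
    have repr: "\<exists>c. c \<in> ?D \<rightarrow>\<^sub>E carrier R \<and> z = (\<Oplus>\<^bsub>A\<^esub>d\<in>?D. c d \<odot>\<^bsub>A\<^esub> d)"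
      if "z \<in> carrier A" for z
    proof (rule ex1_implies_ex)
      have "is_basis R A ?D" using D by (simp only: is_left_dual_basis_def)
      then show "\<exists>!c. c \<in> ?D \<rightarrow>\<^sub>E carrier R \<and> z = (\<Oplus>\<^bsub>A\<^esub>d\<in>?D. c d \<odot>\<^bsub>A\<^esub> d)"
        using that by (simp only: is_basis_def)
    qed
    obtain c where c: "c \<in> ?D \<rightarrow>\<^sub>E carrier R" "x = (\<Oplus>\<^bsub>A\<^esub>d\<in>?D. c d \<odot>\<^bsub>A\<^esub> d)"
      using repr[OF x] by (elim exE conjE)
    obtain e where e: "e \<in> ?D \<rightarrow>\<^sub>E carrier R" "y = (\<Oplus>\<^bsub>A\<^esub>d\<in>?D. e d \<odot>\<^bsub>A\<^esub> d)"
      using repr[OF y] by (elim exE conjE)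
    have "c = e"
    proof (rule PiE_ext[OF c(1) e(1)])
      fix d assume "d \<in> ?D"
      then show "c d = e d" using coord[OF c(2) c(1)] coord[OF e(2) e(1)] xy by auto
    qed
    then show ?thesis using c e by simp
  qed
  show ?thesis unfolding frob_dual_def
    by (rule the_equality) (use trD b DA uniq in auto)
qed

definition direct_sum ::
  "nat \<Rightarrow> (nat \<Rightarrow> ('k, 'a, 'm) module_scheme) \<Rightarrow> ('k, nat \<Rightarrow> 'a) module" where
  "direct_sum n F =
     \<lparr>carrier = (\<Pi>\<^sub>E i\<in>{1..n}. carrier (F i)),
      monoid.mult = (\<lambda>f g. \<lambda>i\<in>{1..n}. f i \<otimes>\<^bsub>F i\<^esub> g i),
      one = (\<lambda>i\<in>{1..n}. \<one>\<^bsub>F i\<^esub>),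
      zero = (\<lambda>i\<in>{1..n}. \<zero>\<^bsub>F i\<^esub>),
      add = (\<lambda>f g. \<lambda>i\<in>{1..n}. f i \<oplus>\<^bsub>F i\<^esub> g i),
      smult = (\<lambda>c f. \<lambda>i\<in>{1..n}. c \<odot>\<^bsub>F i\<^esub> f i)\<rparr>"

definition sum_trace ::
  "('k, 'r) ring_scheme \<Rightarrow> nat \<Rightarrow> (nat \<Rightarrow> 'a \<Rightarrow> 'k) \<Rightarrow> (nat \<Rightarrow> 'a) \<Rightarrow> 'k" where
  "sum_trace R n tr f = (\<Oplus>\<^bsub>R\<^esub>i\<in>{1..n}. tr i (f i))"

definition summand_incl ::
  "nat \<Rightarrow> (nat \<Rightarrow> ('k, 'a, 'm) module_scheme) \<Rightarrow> nat \<Rightarrow> 'a \<Rightarrow> nat \<Rightarrow> 'a" where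
  "summand_incl n F i a = (\<lambda>j\<in>{1..n}. if j = i then a else \<zero>\<^bsub>F j\<^esub>)"

definition sum_basis ::
  "nat \<Rightarrow> (nat \<Rightarrow> ('k, 'a, 'm) module_scheme) \<Rightarrow> (nat \<Rightarrow> 'a set) \<Rightarrow> (nat \<Rightarrow> 'a) set" where
  "sum_basis n F B = (\<Union>i\<in>{1..n}. summand_incl n F i ` B i)"


section \<open>Strict linear monoidal categories\<close>

record ('k, 'o, 'm) lin_mon_cat =
  Obj :: "'o set"
  Hom :: "'o \<Rightarrow> 'o \<Rightarrow> 'm set"
  Ident :: "'o \<Rightarrow> 'm"
  Comp :: "'m \<Rightarrow> 'm \<Rightarrow> 'm"
  Unit :: "'o"
  TensO :: "'o \<Rightarrow> 'o \<Rightarrow> 'o"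
  Tens :: "'m \<Rightarrow> 'm \<Rightarrow> 'm"
  HZero :: "'o \<Rightarrow> 'o \<Rightarrow> 'm"
  HPlus :: "'m \<Rightarrow> 'm \<Rightarrow> 'm"
  HScale :: "'k \<Rightarrow> 'm \<Rightarrow> 'm"

text \<open>The ring multiplication and unit slots of \<open>hom_module\<close> are irrelevant for \<^const>\<open>module\<close>.\<close>

definition hom_module :: "('k, 'o, 'm) lin_mon_cat \<Rightarrow> 'o \<Rightarrow> 'o \<Rightarrow> ('k, 'm) module" where
  "hom_module C X Y =
     \<lparr>carrier = Hom C X Y, monoid.mult = undefined, one = undefined,
      zero = HZero C X Y, add = HPlus C, smult = HScale C\<rparr>"

locale strict_lin_mon_cat =
  fixes R :: "('k, 'r) ring_scheme" and C :: "('k, 'o, 'm) lin_mon_cat"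
  assumes hom_disjoint: "\<lbrakk>X \<in> Obj C; Y \<in> Obj C; X' \<in> Obj C; Y' \<in> Obj C; f \<in> Hom C X Y; f \<in> Hom C X' Y'\<rbrakk>
      \<Longrightarrow> X = X' \<and> Y = Y'"
    and id_hom: "X \<in> Obj C \<Longrightarrow> Ident C X \<in> Hom C X X"
    and comp_hom: "\<lbrakk>X \<in> Obj C; Y \<in> Obj C; Z \<in> Obj C; g \<in> Hom C Y Z; f \<in> Hom C X Y\<rbrakk>
      \<Longrightarrow> Comp C g f \<in> Hom C X Z"
    and id_comp: "\<lbrakk>X \<in> Obj C; Y \<in> Obj C; f \<in> Hom C X Y\<rbrakk> \<Longrightarrow> Comp C (Ident C Y) f = f"
    and comp_id: "\<lbrakk>X \<in> Obj C; Y \<in> Obj C; f \<in> Hom C X Y\<rbrakk> \<Longrightarrow> Comp C f (Ident C X) = f"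
    and comp_assoc: "\<lbrakk>W \<in> Obj C; X \<in> Obj C; Y \<in> Obj C; Z \<in> Obj C;
        h \<in> Hom C Y Z; g \<in> Hom C X Y; f \<in> Hom C W X\<rbrakk>
      \<Longrightarrow> Comp C (Comp C h g) f = Comp C h (Comp C g f)"
    and hom_mod: "\<lbrakk>X \<in> Obj C; Y \<in> Obj C\<rbrakk> \<Longrightarrow> module R (hom_module C X Y)"
    and comp_plus_left: "\<lbrakk>X \<in> Obj C; Y \<in> Obj C; Z \<in> Obj C; g \<in> Hom C Y Z; g' \<in> Hom C Y Z; f \<in> Hom C X Y\<rbrakk>
      \<Longrightarrow> Comp C (HPlus C g g') f = HPlus C (Comp C g f) (Comp C g' f)"
    and comp_plus_right: "\<lbrakk>X \<in> Obj C; Y \<in> Obj C; Z \<in> Obj C; g \<in> Hom C Y Z; f \<in> Hom C X Y; f' \<in> Hom C X Y\<rbrakk>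
      \<Longrightarrow> Comp C g (HPlus C f f') = HPlus C (Comp C g f) (Comp C g f')"
    and comp_scale_left: "\<lbrakk>X \<in> Obj C; Y \<in> Obj C; Z \<in> Obj C; c \<in> carrier R; g \<in> Hom C Y Z; f \<in> Hom C X Y\<rbrakk>
      \<Longrightarrow> Comp C (HScale C c g) f = HScale C c (Comp C g f)"
    and comp_scale_right: "\<lbrakk>X \<in> Obj C; Y \<in> Obj C; Z \<in> Obj C; c \<in> carrier R; g \<in> Hom C Y Z; f \<in> Hom C X Y\<rbrakk>
      \<Longrightarrow> Comp C g (HScale C c f) = HScale C c (Comp C g f)"
    and unit_obj: "Unit C \<in> Obj C"
    and tensO_obj: "\<lbrakk>X \<in> Obj C; Y \<in> Obj C\<rbrakk> \<Longrightarrow> TensO C X Y \<in> Obj C"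
    and tensO_unit_left: "X \<in> Obj C \<Longrightarrow> TensO C (Unit C) X = X"
    and tensO_unit_right: "X \<in> Obj C \<Longrightarrow> TensO C X (Unit C) = X"
    and tensO_assoc: "\<lbrakk>X \<in> Obj C; Y \<in> Obj C; Z \<in> Obj C\<rbrakk>
      \<Longrightarrow> TensO C (TensO C X Y) Z = TensO C X (TensO C Y Z)"
    and tens_hom: "\<lbrakk>X \<in> Obj C; Y \<in> Obj C; X' \<in> Obj C; Y' \<in> Obj C; f \<in> Hom C X Y; g \<in> Hom C X' Y'\<rbrakk>
      \<Longrightarrow> Tens C f g \<in> Hom C (TensO C X X') (TensO C Y Y')"
    and tens_id: "\<lbrakk>X \<in> Obj C; Y \<in> Obj C\<rbrakk> \<Longrightarrow> Tens C (Ident C X) (Ident C Y) = Ident C (TensO C X Y)"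
    and interchange: "\<lbrakk>X \<in> Obj C; Y \<in> Obj C; Z \<in> Obj C; X' \<in> Obj C; Y' \<in> Obj C; Z' \<in> Obj C;
        g \<in> Hom C Y Z; f \<in> Hom C X Y; g' \<in> Hom C Y' Z'; f' \<in> Hom C X' Y'\<rbrakk>
      \<Longrightarrow> Tens C (Comp C g f) (Comp C g' f') = Comp C (Tens C g g') (Tens C f f')"
    and tens_unit_left: "\<lbrakk>X \<in> Obj C; Y \<in> Obj C; f \<in> Hom C X Y\<rbrakk> \<Longrightarrow> Tens C (Ident C (Unit C)) f = f"
    and tens_unit_right: "\<lbrakk>X \<in> Obj C; Y \<in> Obj C; f \<in> Hom C X Y\<rbrakk> \<Longrightarrow> Tens C f (Ident C (Unit C)) = f"
    and tens_assoc: "\<lbrakk>X \<in> Obj C; Y \<in> Obj C; X' \<in> Obj C; Y' \<in> Obj C; X'' \<in> Obj C; Y'' \<in> Obj C;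
        f \<in> Hom C X Y; g \<in> Hom C X' Y'; h \<in> Hom C X'' Y''\<rbrakk>
      \<Longrightarrow> Tens C (Tens C f g) h = Tens C f (Tens C g h)"
    and tens_plus_left: "\<lbrakk>X \<in> Obj C; Y \<in> Obj C; X' \<in> Obj C; Y' \<in> Obj C;
        f \<in> Hom C X Y; f' \<in> Hom C X Y; g \<in> Hom C X' Y'\<rbrakk>
      \<Longrightarrow> Tens C (HPlus C f f') g = HPlus C (Tens C f g) (Tens C f' g)"
    and tens_plus_right: "\<lbrakk>X \<in> Obj C; Y \<in> Obj C; X' \<in> Obj C; Y' \<in> Obj C;
        f \<in> Hom C X Y; g \<in> Hom C X' Y'; g' \<in> Hom C X' Y'\<rbrakk>
      \<Longrightarrow> Tens C f (HPlus C g g') = HPlus C (Tens C f g) (Tens C f g')"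
    and tens_scale_left: "\<lbrakk>X \<in> Obj C; Y \<in> Obj C; X' \<in> Obj C; Y' \<in> Obj C;
        c \<in> carrier R; f \<in> Hom C X Y; g \<in> Hom C X' Y'\<rbrakk>
      \<Longrightarrow> Tens C (HScale C c f) g = HScale C c (Tens C f g)"
    and tens_scale_right: "\<lbrakk>X \<in> Obj C; Y \<in> Obj C; X' \<in> Obj C; Y' \<in> Obj C;
        c \<in> carrier R; f \<in> Hom C X Y; g \<in> Hom C X' Y'\<rbrakk>
      \<Longrightarrow> Tens C f (HScale C c g) = HScale C c (Tens C f g)"

text \<open>
  Strict \<open>R\<close>-linear monoidal functors.  Since distinct hom-sets are disjoint, the action on all
  morphisms is a single function.
\<close>

locale strict_lin_mon_functor =
  C: strict_lin_mon_cat R C + D: strict_lin_mon_cat R D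
  for R :: "('k, 'r) ring_scheme" and C :: "('k, 'o, 'm) lin_mon_cat" and D :: "('k, 'p, 'q) lin_mon_cat" +
  fixes Fo :: "'o \<Rightarrow> 'p" and Fm :: "'m \<Rightarrow> 'q"
  assumes Fo_obj: "X \<in> Obj C \<Longrightarrow> Fo X \<in> Obj D"
    and Fm_hom: "\<lbrakk>X \<in> Obj C; Y \<in> Obj C; f \<in> Hom C X Y\<rbrakk> \<Longrightarrow> Fm f \<in> Hom D (Fo X) (Fo Y)"
    and Fm_id: "X \<in> Obj C \<Longrightarrow> Fm (Ident C X) = Ident D (Fo X)"
    and Fm_comp: "\<lbrakk>X \<in> Obj C; Y \<in> Obj C; Z \<in> Obj C; g \<in> Hom C Y Z; f \<in> Hom C X Y\<rbrakk>
      \<Longrightarrow> Fm (Comp C g f) = Comp D (Fm g) (Fm f)"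
    and Fo_unit: "Fo (Unit C) = Unit D"
    and Fo_tens: "\<lbrakk>X \<in> Obj C; Y \<in> Obj C\<rbrakk> \<Longrightarrow> Fo (TensO C X Y) = TensO D (Fo X) (Fo Y)"
    and Fm_tens: "\<lbrakk>X \<in> Obj C; Y \<in> Obj C; X' \<in> Obj C; Y' \<in> Obj C; f \<in> Hom C X Y; g \<in> Hom C X' Y'\<rbrakk>
      \<Longrightarrow> Fm (Tens C f g) = Tens D (Fm f) (Fm g)"
    and Fm_plus: "\<lbrakk>X \<in> Obj C; Y \<in> Obj C; f \<in> Hom C X Y; g \<in> Hom C X Y\<rbrakk>
      \<Longrightarrow> Fm (HPlus C f g) = HPlus D (Fm f) (Fm g)"
    and Fm_scale: "\<lbrakk>X \<in> Obj C; Y \<in> Obj C; c \<in> carrier R; f \<in> Hom C X Y\<rbrakk>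
      \<Longrightarrow> Fm (HScale C c f) = HScale D c (Fm f)"

definition lin_mon_cat_isomorphic ::
  "('k, 'r) ring_scheme \<Rightarrow> ('k, 'o, 'm) lin_mon_cat \<Rightarrow> ('k, 'p, 'q) lin_mon_cat \<Rightarrow> bool" where
  "lin_mon_cat_isomorphic R C D \<longleftrightarrow>
     (\<exists>Fo Fm. strict_lin_mon_functor R C D Fo Fm \<and> bij_betw Fo (Obj C) (Obj D) \<and>
        (\<forall>X\<in>Obj C. \<forall>Y\<in>Obj C. bij_betw Fm (Hom C X Y) (Hom D (Fo X) (Fo Y))))"


section \<open>Presentations by generators and relations\<close>

text \<open>
  The objects of the presented category are the words over the type \<open>'o\<close> of generating objects.
  Morphism terms carry enough annotation to have at most one type \<open>X \<rightarrow> Y\<close>.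
\<close>

datatype ('k, 'o, 'g) mterm =
    Gen 'g
  | Idt "'o list"
  | Cmp "('k, 'o, 'g) mterm" "('k, 'o, 'g) mterm" (infixr "\<bullet>" 65)
  | Ten "('k, 'o, 'g) mterm" "('k, 'o, 'g) mterm" (infixr "\<boxtimes>" 75)
  | Zer "'o list" "'o list"
  | Add "('k, 'o, 'g) mterm" "('k, 'o, 'g) mterm"
  | Scl 'k "('k, 'o, 'g) mterm"

record ('k, 'o, 'g) presentation =
  gens :: "'g set"
  source :: "'g \<Rightarrow> 'o list"
  target :: "'g \<Rightarrow> 'o list"
  rels :: "(('k, 'o, 'g) mterm \<times> ('k, 'o, 'g) mterm) set"

inductive typed ::
  "('k, 'r) ring_scheme \<Rightarrow> ('k, 'o, 'g) presentation \<Rightarrow> 'o list \<Rightarrow> 'o list \<Rightarrow> ('k, 'o, 'g) mterm \<Rightarrow> bool"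
  for R P where
  gen: "g \<in> gens P \<Longrightarrow> typed R P (source P g) (target P g) (Gen g)"
| idt: "typed R P X X (Idt X)"
| cmp: "typed R P Y Z g \<Longrightarrow> typed R P X Y f \<Longrightarrow> typed R P X Z (g \<bullet> f)"
| ten: "typed R P X Y f \<Longrightarrow> typed R P X' Y' g \<Longrightarrow> typed R P (X @ X') (Y @ Y') (f \<boxtimes> g)"
| zer: "typed R P X Y (Zer X Y)"
| add: "typed R P X Y f \<Longrightarrow> typed R P X Y g \<Longrightarrow> typed R P X Y (Add f g)"
| scl: "c \<in> carrier R \<Longrightarrow> typed R P X Y f \<Longrightarrow> typed R P X Y (Scl c f)"

text \<open>
  \<open>eqv R P X Y\<close> is the smallest congruence on terms of type \<open>X \<rightarrow> Y\<close> that contains the relations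
  of \<open>P\<close> and the axioms of a strict \<open>R\<close>-linear monoidal category.
\<close>

inductive eqv ::
  "('k, 'r) ring_scheme \<Rightarrow> ('k, 'o, 'g) presentation \<Rightarrow> 'o list \<Rightarrow> 'o list \<Rightarrow>
     ('k, 'o, 'g) mterm \<Rightarrow> ('k, 'o, 'g) mterm \<Rightarrow> bool"
  for R P where
  rel: "(f, g) \<in> rels P \<Longrightarrow> typed R P X Y f \<Longrightarrow> typed R P X Y g \<Longrightarrow> eqv R P X Y f g"
| refl: "typed R P X Y f \<Longrightarrow> eqv R P X Y f f"
| sym: "eqv R P X Y f g \<Longrightarrow> eqv R P X Y g f"
| trans: "eqv R P X Y f g \<Longrightarrow> eqv R P X Y g h \<Longrightarrow> eqv R P X Y f h"
| cong_cmp: "eqv R P Y Z g g' \<Longrightarrow> eqv R P X Y f f' \<Longrightarrow> eqv R P X Z (g \<bullet> f) (g' \<bullet> f')"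
| cong_ten: "eqv R P X Y f f' \<Longrightarrow> eqv R P X' Y' g g' \<Longrightarrow> eqv R P (X @ X') (Y @ Y') (f \<boxtimes> g) (f' \<boxtimes> g')"
| cong_add: "eqv R P X Y f f' \<Longrightarrow> eqv R P X Y g g' \<Longrightarrow> eqv R P X Y (Add f g) (Add f' g')"
| cong_scl: "c \<in> carrier R \<Longrightarrow> eqv R P X Y f f' \<Longrightarrow> eqv R P X Y (Scl c f) (Scl c f')"
| id_cmp: "typed R P X Y f \<Longrightarrow> eqv R P X Y (Idt Y \<bullet> f) f"
| cmp_id: "typed R P X Y f \<Longrightarrow> eqv R P X Y (f \<bullet> Idt X) f"
| cmp_assoc: "typed R P Y Z h \<Longrightarrow> typed R P X Y g \<Longrightarrow> typed R P W X f
    \<Longrightarrow> eqv R P W Z ((h \<bullet> g) \<bullet> f) (h \<bullet> g \<bullet> f)"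
| ten_id: "eqv R P (X @ Y) (X @ Y) (Idt X \<boxtimes> Idt Y) (Idt (X @ Y))"
| ten_cmp: "typed R P Y Z g \<Longrightarrow> typed R P X Y f \<Longrightarrow> typed R P Y' Z' g' \<Longrightarrow> typed R P X' Y' f'
    \<Longrightarrow> eqv R P (X @ X') (Z @ Z') ((g \<bullet> f) \<boxtimes> (g' \<bullet> f')) ((g \<boxtimes> g') \<bullet> (f \<boxtimes> f'))"
| unit_ten: "typed R P X Y f \<Longrightarrow> eqv R P X Y (Idt [] \<boxtimes> f) f"
| ten_unit: "typed R P X Y f \<Longrightarrow> eqv R P X Y (f \<boxtimes> Idt []) f"
| ten_assoc: "typed R P X Y f \<Longrightarrow> typed R P X' Y' g \<Longrightarrow> typed R P X'' Y'' h
    \<Longrightarrow> eqv R P (X @ X' @ X'') (Y @ Y' @ Y'') ((f \<boxtimes> g) \<boxtimes> h) (f \<boxtimes> g \<boxtimes> h)"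
| add_assoc: "typed R P X Y f \<Longrightarrow> typed R P X Y g \<Longrightarrow> typed R P X Y h
    \<Longrightarrow> eqv R P X Y (Add (Add f g) h) (Add f (Add g h))"
| add_comm: "typed R P X Y f \<Longrightarrow> typed R P X Y g \<Longrightarrow> eqv R P X Y (Add f g) (Add g f)"
| add_zer: "typed R P X Y f \<Longrightarrow> eqv R P X Y (Add (Zer X Y) f) f"
| add_neg: "typed R P X Y f \<Longrightarrow> eqv R P X Y (Add (Scl (\<ominus>\<^bsub>R\<^esub> \<one>\<^bsub>R\<^esub>) f) f) (Zer X Y)"
| scl_one: "typed R P X Y f \<Longrightarrow> eqv R P X Y (Scl \<one>\<^bsub>R\<^esub> f) f"
| scl_mult: "a \<in> carrier R \<Longrightarrow> b \<in> carrier R \<Longrightarrow> typed R P X Y f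
    \<Longrightarrow> eqv R P X Y (Scl (a \<otimes>\<^bsub>R\<^esub> b) f) (Scl a (Scl b f))"
| scl_add_left: "a \<in> carrier R \<Longrightarrow> b \<in> carrier R \<Longrightarrow> typed R P X Y f
    \<Longrightarrow> eqv R P X Y (Scl (a \<oplus>\<^bsub>R\<^esub> b) f) (Add (Scl a f) (Scl b f))"
| scl_add_right: "a \<in> carrier R \<Longrightarrow> typed R P X Y f \<Longrightarrow> typed R P X Y g
    \<Longrightarrow> eqv R P X Y (Scl a (Add f g)) (Add (Scl a f) (Scl a g))"
| cmp_add_left: "typed R P Y Z g \<Longrightarrow> typed R P Y Z g' \<Longrightarrow> typed R P X Y f
    \<Longrightarrow> eqv R P X Z (Add g g' \<bullet> f) (Add (g \<bullet> f) (g' \<bullet> f))"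
| cmp_add_right: "typed R P Y Z g \<Longrightarrow> typed R P X Y f \<Longrightarrow> typed R P X Y f'
    \<Longrightarrow> eqv R P X Z (g \<bullet> Add f f') (Add (g \<bullet> f) (g \<bullet> f'))"
| cmp_scl_left: "a \<in> carrier R \<Longrightarrow> typed R P Y Z g \<Longrightarrow> typed R P X Y f
    \<Longrightarrow> eqv R P X Z (Scl a g \<bullet> f) (Scl a (g \<bullet> f))"
| cmp_scl_right: "a \<in> carrier R \<Longrightarrow> typed R P Y Z g \<Longrightarrow> typed R P X Y f
    \<Longrightarrow> eqv R P X Z (g \<bullet> Scl a f) (Scl a (g \<bullet> f))"
| ten_add_left: "typed R P X Y f \<Longrightarrow> typed R P X Y f' \<Longrightarrow> typed R P X' Y' g
    \<Longrightarrow> eqv R P (X @ X') (Y @ Y') (Add f f' \<boxtimes> g) (Add (f \<boxtimes> g) (f' \<boxtimes> g))"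
| ten_add_right: "typed R P X Y f \<Longrightarrow> typed R P X' Y' g \<Longrightarrow> typed R P X' Y' g'
    \<Longrightarrow> eqv R P (X @ X') (Y @ Y') (f \<boxtimes> Add g g') (Add (f \<boxtimes> g) (f \<boxtimes> g'))"
| ten_scl_left: "a \<in> carrier R \<Longrightarrow> typed R P X Y f \<Longrightarrow> typed R P X' Y' g
    \<Longrightarrow> eqv R P (X @ X') (Y @ Y') (Scl a f \<boxtimes> g) (Scl a (f \<boxtimes> g))"
| ten_scl_right: "a \<in> carrier R \<Longrightarrow> typed R P X Y f \<Longrightarrow> typed R P X' Y' g
    \<Longrightarrow> eqv R P (X @ X') (Y @ Y') (f \<boxtimes> Scl a g) (Scl a (f \<boxtimes> g))"

definition presented_cat ::
  "('k, 'r) ring_scheme \<Rightarrow> ('k, 'o, 'g) presentation \<Rightarrow> ('k, 'o list, ('k, 'o, 'g) mterm set) lin_mon_cat" where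
  "presented_cat R P =
     \<lparr>Obj = UNIV,
      Hom = (\<lambda>X Y. {f. typed R P X Y f} // {(f, g). eqv R P X Y f g}),
      Ident = (\<lambda>X. {h. eqv R P X X (Idt X) h}),
      Comp = (\<lambda>v u. {h. \<exists>g\<in>v. \<exists>f\<in>u. \<exists>X Y. eqv R P X Y (g \<bullet> f) h}),
      Unit = [],
      TensO = (@),
      Tens = (\<lambda>u v. {h. \<exists>f\<in>u. \<exists>g\<in>v. \<exists>X Y. eqv R P X Y (f \<boxtimes> g) h}),
      HZero = (\<lambda>X Y. {h. eqv R P X Y (Zer X Y) h}),
      HPlus = (\<lambda>u v. {h. \<exists>f\<in>u. \<exists>g\<in>v. \<exists>X Y. eqv R P X Y (Add f g) h}),
      HScale = (\<lambda>c u. {h. \<exists>f\<in>u. \<exists>X Y. eqv R P X Y (Scl c f) h})\<rparr>"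

inductive_cases typed_GenE: "typed R P X Y (Gen g)"
inductive_cases typed_IdtE: "typed R P X Y (Idt Z)"
inductive_cases typed_CmpE: "typed R P X Y (g \<bullet> f)"
inductive_cases typed_TenE: "typed R P X Y (f \<boxtimes> g)"
inductive_cases typed_ZerE: "typed R P X Y (Zer Z W)"
inductive_cases typed_AddE: "typed R P X Y (Add f g)"
inductive_cases typed_SclE: "typed R P X Y (Scl c f)"

lemma typed_unique: "typed R P X Y f \<Longrightarrow> typed R P X' Y' f \<Longrightarrow> X = X' \<and> Y = Y'"
proof (induction arbitrary: X' Y' rule: typed.induct)
  case (gen g) from gen.prems show ?case by (rule typed_GenE) simp
next
  case (idt X) from idt.prems show ?case by (rule typed_IdtE) simp
next
  case (cmp Y Z g X f)
  from cmp.prems obtain W where W: "typed R P W Y' g" "typed R P X' W f" by (rule typed_CmpE)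
  from cmp.IH(1)[OF W(1)] cmp.IH(2)[OF W(2)] show ?case by blast
next
  case (ten X Y f A B g)
  from ten.prems show ?case
  proof (rule typed_TenE)
    fix X1 Y1 X2 Y2
    assume eq: "X' = X1 @ X2" "Y' = Y1 @ Y2" and ty: "typed R P X1 Y1 f" "typed R P X2 Y2 g"
    from ten.IH(1)[OF ty(1)] ten.IH(2)[OF ty(2)] eq show ?case by blast
  qed
next
  case (zer X Y) from zer.prems show ?case by (rule typed_ZerE) simp
next
  case (add X Y f g) from add.prems have "typed R P X' Y' f" by (rule typed_AddE)
  then show ?case by (rule add.IH(1))
next
  case (scl c X Y f) from scl.prems have "typed R P X' Y' f" by (rule typed_SclE)
  then show ?case by (rule scl.IH)
qed

lemma eqv_typed:
  assumes "cring R" and "eqv R P X Y f g" shows "typed R P X Y f \<and> typed R P X Y g"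
proof -
  interpret cring R by fact
  have m1: "\<ominus>\<^bsub>R\<^esub> \<one>\<^bsub>R\<^esub> \<in> carrier R" by simp
  show ?thesis using assms(2)
  proof (induction rule: eqv.induct)
    case (ten_id X Y) then show ?case by (auto intro: typed.intros)
  next
    case (unit_ten X Y f) then show ?case using typed.ten[OF typed.idt[of R P "[]"]] by fastforce
  next
    case (ten_unit X Y f) then show ?case using typed.ten[OF _ typed.idt[of R P "[]"]] by fastforce
  next
    case (ten_assoc X Y f X' Y' g X'' Y'' h)
    then show ?case using typed.ten[OF typed.ten, of R P X Y f X' Y' g X'' Y'' h]
      by (auto intro: typed.intros)
  qed (use m1 in \<open>auto intro: typed.intros\<close>)
qed

text \<open>The quotient construction does yield a strict \<open>R\<close>-linear monoidal category.\<close>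

locale presented =
  fixes R :: "('k, 'r) ring_scheme" and P :: "('k, 'o, 'g) presentation"
  assumes cring: "cring R"
begin

abbreviation "\<C> \<equiv> presented_cat R P"

definition cls :: "'o list \<Rightarrow> 'o list \<Rightarrow> ('k, 'o, 'g) mterm \<Rightarrow> ('k, 'o, 'g) mterm set" where
  "cls X Y f = {g. eqv R P X Y f g}"

lemma eqv_ty: "eqv R P X Y f g \<Longrightarrow> typed R P X Y f" "eqv R P X Y f g \<Longrightarrow> typed R P X Y g"
  using eqv_typed[OF cring] by blast+

lemma cls_eqI: "eqv R P X Y f g \<Longrightarrow> cls X Y f = cls X Y g"
  unfolding cls_def by (rule Collect_cong, rule iffI) (erule eqv.trans[OF eqv.sym], assumption, erule eqv.trans)

lemma cls_eq_iff: "typed R P X Y f \<Longrightarrow> cls X Y f = cls X Y g \<longleftrightarrow> eqv R P X Y f g"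
proof
  assume f: "typed R P X Y f" and eq: "cls X Y f = cls X Y g"
  have "f \<in> cls X Y f" using f by (simp add: cls_def eqv.refl)
  then have "eqv R P X Y g f" using eq cls_def by blast
  then show "eqv R P X Y f g" by (rule eqv.sym)
qed (rule cls_eqI)

lemma Hom_iff: "u \<in> Hom \<C> X Y \<longleftrightarrow> (\<exists>f. typed R P X Y f \<and> u = cls X Y f)"
  by (auto simp: presented_cat_def quotient_def cls_def)

lemma Ident_cls: "Ident \<C> X = cls X X (Idt X)"
  by (simp add: presented_cat_def cls_def)

lemma HZero_cls: "HZero \<C> X Y = cls X Y (Zer X Y)"
  by (simp add: presented_cat_def cls_def)

lemma Comp_cls:
  assumes "typed R P Y Z g" "typed R P X Y f"
  shows "Comp \<C> (cls Y Z g) (cls X Y f) = cls X Z (g \<bullet> f)"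
proof -
  have 1: "eqv R P X Z (g \<bullet> f) h"
    if "eqv R P Y Z g g'" "eqv R P X Y f f'" "eqv R P X' Z' (g' \<bullet> f') h" for g' f' X' Z' h
  proof -
    have e: "eqv R P X Z (g \<bullet> f) (g' \<bullet> f')" using that by (intro eqv.cong_cmp)
    then have "X' = X \<and> Z' = Z"
      using typed_unique[OF eqv_ty(1)[OF that(3)] eqv_ty(2)[OF e]] by simp
    then show ?thesis using eqv.trans[OF e] that(3) by simp
  qed
  show ?thesis using eqv.refl[OF assms(1)] eqv.refl[OF assms(2)]
    by (auto simp: presented_cat_def cls_def dest: 1)
qed

lemma Tens_cls:
  assumes "typed R P X Y f" "typed R P X' Y' g"
  shows "Tens \<C> (cls X Y f) (cls X' Y' g) = cls (X @ X') (Y @ Y') (f \<boxtimes> g)"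
proof -
  have 1: "eqv R P (X @ X') (Y @ Y') (f \<boxtimes> g) h"
    if "eqv R P X Y f f'" "eqv R P X' Y' g g'" "eqv R P A B (f' \<boxtimes> g') h" for g' f' A B h
  proof -
    have e: "eqv R P (X @ X') (Y @ Y') (f \<boxtimes> g) (f' \<boxtimes> g')" using that by (intro eqv.cong_ten)
    then have "A = X @ X' \<and> B = Y @ Y'"
      using typed_unique[OF eqv_ty(1)[OF that(3)] eqv_ty(2)[OF e]] by simp
    then show ?thesis using eqv.trans[OF e] that(3) by simp
  qed
  show ?thesis using eqv.refl[OF assms(1)] eqv.refl[OF assms(2)]
    by (auto simp: presented_cat_def cls_def dest: 1)
qed

lemma HPlus_cls:
  assumes "typed R P X Y f" "typed R P X Y g"
  shows "HPlus \<C> (cls X Y f) (cls X Y g) = cls X Y (Add f g)"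
proof -
  have 1: "eqv R P X Y (Add f g) h"
    if "eqv R P X Y f f'" "eqv R P X Y g g'" "eqv R P A B (Add f' g') h" for g' f' A B h
  proof -
    have e: "eqv R P X Y (Add f g) (Add f' g')" using that by (intro eqv.cong_add)
    then have "A = X \<and> B = Y"
      using typed_unique[OF eqv_ty(1)[OF that(3)] eqv_ty(2)[OF e]] by simp
    then show ?thesis using eqv.trans[OF e] that(3) by simp
  qed
  show ?thesis using eqv.refl[OF assms(1)] eqv.refl[OF assms(2)]
    by (auto simp: presented_cat_def cls_def intro: 1)
qed

lemma HScale_cls:
  assumes "c \<in> carrier R" "typed R P X Y f"
  shows "HScale \<C> c (cls X Y f) = cls X Y (Scl c f)"
proof -
  have 1: "eqv R P X Y (Scl c f) h"
    if "eqv R P X Y f f'" "eqv R P A B (Scl c f') h" for f' A B h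
  proof -
    have e: "eqv R P X Y (Scl c f) (Scl c f')" using that assms by (intro eqv.cong_scl)
    then have "A = X \<and> B = Y"
      using typed_unique[OF eqv_ty(1)[OF that(2)] eqv_ty(2)[OF e]] by simp
    then show ?thesis using eqv.trans[OF e] that(2) by simp
  qed
  show ?thesis using eqv.refl[OF assms(2)]
    by (auto simp: presented_cat_def cls_def dest: 1)
qed

lemma strict_simps [simp]: "Obj \<C> = UNIV" "Unit \<C> = []" "TensO \<C> = (@)"
  by (simp_all add: presented_cat_def)

lemma hom_module_presented: "module R (hom_module \<C> X Y)"
proof -
  interpret cring R by (rule cring)
  let ?M = "hom_module \<C> X Y"
  have sel: "carrier ?M = Hom \<C> X Y" "add ?M = HPlus \<C>" "zero ?M = HZero \<C> X Y" "smult ?M = HScale \<C>"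
    by (simp_all add: hom_module_def)
  note ty = typed.intros
  have neg_one: "\<ominus>\<^bsub>R\<^esub> \<one>\<^bsub>R\<^esub> \<in> carrier R" by simp
  have abelian: "abelian_group ?M"
  proof (rule abelian_groupI; unfold sel)
    show "HZero \<C> X Y \<in> Hom \<C> X Y" by (auto simp: Hom_iff HZero_cls intro: ty)
  next
    fix u v assume "u \<in> Hom \<C> X Y" "v \<in> Hom \<C> X Y"
    then obtain f g where fg: "typed R P X Y f" "u = cls X Y f" "typed R P X Y g" "v = cls X Y g"
      by (auto simp: Hom_iff)
    then show "HPlus \<C> u v \<in> Hom \<C> X Y" by (auto simp: Hom_iff HPlus_cls intro: ty)
    show "HPlus \<C> u v = HPlus \<C> v u"
      using fg cls_eqI[OF eqv.add_comm[OF fg(1) fg(3)]] by (simp add: HPlus_cls)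
  next
    fix u v w assume "u \<in> Hom \<C> X Y" "v \<in> Hom \<C> X Y" "w \<in> Hom \<C> X Y"
    then show "HPlus \<C> (HPlus \<C> u v) w = HPlus \<C> u (HPlus \<C> v w)"
      by (auto simp: Hom_iff HPlus_cls ty cls_eqI[OF eqv.add_assoc])
  next
    fix u assume "u \<in> Hom \<C> X Y"
    then obtain f where f: "typed R P X Y f" "u = cls X Y f" by (auto simp: Hom_iff)
    then show "HPlus \<C> (HZero \<C> X Y) u = u"
      by (auto simp: HPlus_cls HZero_cls ty cls_eqI[OF eqv.add_zer])
    show "\<exists>v\<in>Hom \<C> X Y. HPlus \<C> v u = HZero \<C> X Y"
    proof
      show "cls X Y (Scl (\<ominus>\<^bsub>R\<^esub> \<one>\<^bsub>R\<^esub>) f) \<in> Hom \<C> X Y"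
        unfolding Hom_iff using neg_one f(1) by (blast intro: ty)
      show "HPlus \<C> (cls X Y (Scl (\<ominus>\<^bsub>R\<^esub> \<one>\<^bsub>R\<^esub>) f)) u = HZero \<C> X Y"
        using f neg_one by (auto simp: HPlus_cls HZero_cls ty cls_eqI[OF eqv.add_neg])
    qed
  qed
  show ?thesis
  proof (rule moduleI[OF cring abelian]; unfold sel)
    fix a u assume "a \<in> carrier R" "u \<in> Hom \<C> X Y"
    then show "HScale \<C> a u \<in> Hom \<C> X Y" by (auto simp: Hom_iff HScale_cls intro: ty)
  next
    fix a b u assume "a \<in> carrier R" "b \<in> carrier R" "u \<in> Hom \<C> X Y"
    then show "HScale \<C> (a \<oplus>\<^bsub>R\<^esub> b) u = HPlus \<C> (HScale \<C> a u) (HScale \<C> b u)"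
      "HScale \<C> (a \<otimes>\<^bsub>R\<^esub> b) u = HScale \<C> a (HScale \<C> b u)"
      by (auto simp: Hom_iff HScale_cls HPlus_cls ty cls_eqI[OF eqv.scl_add_left] cls_eqI[OF eqv.scl_mult])
  next
    fix a u v assume "a \<in> carrier R" "u \<in> Hom \<C> X Y" "v \<in> Hom \<C> X Y"
    then show "HScale \<C> a (HPlus \<C> u v) = HPlus \<C> (HScale \<C> a u) (HScale \<C> a v)"
      by (auto simp: Hom_iff HScale_cls HPlus_cls ty cls_eqI[OF eqv.scl_add_right])
  next
    fix u assume "u \<in> Hom \<C> X Y"
    then show "HScale \<C> \<one>\<^bsub>R\<^esub> u = u"
      by (auto simp: Hom_iff HScale_cls cls_eqI[OF eqv.scl_one])
  qed
qed

sublocale strict_lin_mon_cat R \<C>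
proof (rule strict_lin_mon_cat.intro)
  fix X Y X' Y' u assume "u \<in> Hom \<C> X Y" "u \<in> Hom \<C> X' Y'"
  then obtain f g where f: "typed R P X Y f" "u = cls X Y f" and g: "u = cls X' Y' g"
    by (auto simp: Hom_iff)
  have "f \<in> u" using f by (simp add: cls_def eqv.refl)
  then have "typed R P X' Y' f" using g eqv_ty by (auto simp: cls_def)
  then show "X = X' \<and> Y = Y'" using f typed_unique by blast
next
  fix X Y show "module R (hom_module \<C> X Y)" by (rule hom_module_presented)
next
  fix X Y u assume "u \<in> Hom \<C> X Y"
  then obtain f where f: "typed R P X Y f" "u = cls X Y f" by (auto simp: Hom_iff)
  show "Tens \<C> (Ident \<C> (Unit \<C>)) u = u"
    using f Tens_cls[OF typed.idt[of R P "[]"] f(1)] cls_eqI[OF eqv.unit_ten[OF f(1)]]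
    by (simp add: Ident_cls)
  show "Tens \<C> u (Ident \<C> (Unit \<C>)) = u"
    using f Tens_cls[OF f(1) typed.idt[of R P "[]"]] cls_eqI[OF eqv.ten_unit[OF f(1)]]
    by (simp add: Ident_cls)
next
  fix X Y X' Y' X'' Y'' u v w
  assume "u \<in> Hom \<C> X Y" "v \<in> Hom \<C> X' Y'" "w \<in> Hom \<C> X'' Y''"
  then obtain f g h where f: "typed R P X Y f" "u = cls X Y f" and g: "typed R P X' Y' g" "v = cls X' Y' g"
    and h: "typed R P X'' Y'' h" "w = cls X'' Y'' h" by (auto simp: Hom_iff)
  show "Tens \<C> (Tens \<C> u v) w = Tens \<C> u (Tens \<C> v w)"
    using f g h Tens_cls[OF typed.ten[OF f(1) g(1)] h(1)] Tens_cls[OF f(1) typed.ten[OF g(1) h(1)]]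
      cls_eqI[OF eqv.ten_assoc[OF f(1) g(1) h(1)]]
    by (simp add: Tens_cls)
next
  fix W X Y Z w v u
  assume "w \<in> Hom \<C> Y Z" "v \<in> Hom \<C> X Y" "u \<in> Hom \<C> W X"
  then obtain h g f where h: "typed R P Y Z h" "w = cls Y Z h" and g: "typed R P X Y g" "v = cls X Y g"
    and f: "typed R P W X f" "u = cls W X f" by (auto simp: Hom_iff)
  show "Comp \<C> (Comp \<C> w v) u = Comp \<C> w (Comp \<C> v u)"
    using f g h Comp_cls[OF typed.cmp[OF h(1) g(1)] f(1)] Comp_cls[OF h(1) typed.cmp[OF g(1) f(1)]]
      cls_eqI[OF eqv.cmp_assoc[OF h(1) g(1) f(1)]]
    by (simp add: Comp_cls)
next
  fix X Y u assume "u \<in> Hom \<C> X Y"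
  then obtain f where f: "typed R P X Y f" "u = cls X Y f" by (auto simp: Hom_iff)
  show "Comp \<C> (Ident \<C> Y) u = u"
    using f Comp_cls[OF typed.idt f(1)] cls_eqI[OF eqv.id_cmp[OF f(1)]] by (simp add: Ident_cls)
  show "Comp \<C> u (Ident \<C> X) = u"
    using f Comp_cls[OF f(1) typed.idt] cls_eqI[OF eqv.cmp_id[OF f(1)]] by (simp add: Ident_cls)
next
  fix X Y Z v v' u
  assume "v \<in> Hom \<C> Y Z" "v' \<in> Hom \<C> Y Z" "u \<in> Hom \<C> X Y"
  then obtain g g' f where g: "typed R P Y Z g" "v = cls Y Z g" and g': "typed R P Y Z g'" "v' = cls Y Z g'"
    and f: "typed R P X Y f" "u = cls X Y f" by (auto simp: Hom_iff)
  show "Comp \<C> (HPlus \<C> v v') u = HPlus \<C> (Comp \<C> v u) (Comp \<C> v' u)"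
    using f g g' Comp_cls[OF typed.add[OF g(1) g'(1)] f(1)]
      HPlus_cls[OF typed.cmp[OF g(1) f(1)] typed.cmp[OF g'(1) f(1)]]
      cls_eqI[OF eqv.cmp_add_left[OF g(1) g'(1) f(1)]]
    by (simp add: Comp_cls HPlus_cls)
next
  fix X Y Z v u u'
  assume "v \<in> Hom \<C> Y Z" "u \<in> Hom \<C> X Y" "u' \<in> Hom \<C> X Y"
  then obtain g f f' where g: "typed R P Y Z g" "v = cls Y Z g" and f: "typed R P X Y f" "u = cls X Y f"
    and f': "typed R P X Y f'" "u' = cls X Y f'" by (auto simp: Hom_iff)
  show "Comp \<C> v (HPlus \<C> u u') = HPlus \<C> (Comp \<C> v u) (Comp \<C> v u')"
    using f f' g Comp_cls[OF g(1) typed.add[OF f(1) f'(1)]]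
      HPlus_cls[OF typed.cmp[OF g(1) f(1)] typed.cmp[OF g(1) f'(1)]]
      cls_eqI[OF eqv.cmp_add_right[OF g(1) f(1) f'(1)]]
    by (simp add: Comp_cls HPlus_cls)
next
  fix X Y Z c v u
  assume c: "c \<in> carrier R" and "v \<in> Hom \<C> Y Z" "u \<in> Hom \<C> X Y"
  then obtain g f where g: "typed R P Y Z g" "v = cls Y Z g" and f: "typed R P X Y f" "u = cls X Y f"
    by (auto simp: Hom_iff)
  show "Comp \<C> (HScale \<C> c v) u = HScale \<C> c (Comp \<C> v u)"
    using f g Comp_cls[OF typed.scl[OF c g(1)] f(1)] HScale_cls[OF c typed.cmp[OF g(1) f(1)]]
      cls_eqI[OF eqv.cmp_scl_left[OF c g(1) f(1)]] c
    by (simp add: Comp_cls HScale_cls)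
  show "Comp \<C> v (HScale \<C> c u) = HScale \<C> c (Comp \<C> v u)"
    using f g Comp_cls[OF g(1) typed.scl[OF c f(1)]] HScale_cls[OF c typed.cmp[OF g(1) f(1)]]
      cls_eqI[OF eqv.cmp_scl_right[OF c g(1) f(1)]] c
    by (simp add: Comp_cls HScale_cls)
next
  fix X Y show "Tens \<C> (Ident \<C> X) (Ident \<C> Y) = Ident \<C> (TensO \<C> X Y)"
    using Tens_cls[OF typed.idt[of R P X] typed.idt[of R P Y]] cls_eqI[OF eqv.ten_id[of R P X Y]]
    by (simp add: Ident_cls)
next
  fix X Y Z X' Y' Z' v u v' u'
  assume "v \<in> Hom \<C> Y Z" "u \<in> Hom \<C> X Y" "v' \<in> Hom \<C> Y' Z'" "u' \<in> Hom \<C> X' Y'"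
  then obtain g f g' f' where g: "typed R P Y Z g" "v = cls Y Z g" and f: "typed R P X Y f" "u = cls X Y f"
    and g': "typed R P Y' Z' g'" "v' = cls Y' Z' g'" and f': "typed R P X' Y' f'" "u' = cls X' Y' f'"
    by (auto simp: Hom_iff)
  show "Tens \<C> (Comp \<C> v u) (Comp \<C> v' u') = Comp \<C> (Tens \<C> v v') (Tens \<C> u u')"
    using f g f' g' Tens_cls[OF typed.cmp[OF g(1) f(1)] typed.cmp[OF g'(1) f'(1)]]
      Comp_cls[OF typed.ten[OF g(1) g'(1)] typed.ten[OF f(1) f'(1)]]
      cls_eqI[OF eqv.ten_cmp[OF g(1) f(1) g'(1) f'(1)]]
    by (simp add: Comp_cls Tens_cls)
next
  fix X Y X' Y' u u' v
  assume "u \<in> Hom \<C> X Y" "u' \<in> Hom \<C> X Y" "v \<in> Hom \<C> X' Y'"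
  then obtain f f' g where f: "typed R P X Y f" "u = cls X Y f" and f': "typed R P X Y f'" "u' = cls X Y f'"
    and g: "typed R P X' Y' g" "v = cls X' Y' g" by (auto simp: Hom_iff)
  show "Tens \<C> (HPlus \<C> u u') v = HPlus \<C> (Tens \<C> u v) (Tens \<C> u' v)"
    using f f' g Tens_cls[OF typed.add[OF f(1) f'(1)] g(1)]
      HPlus_cls[OF typed.ten[OF f(1) g(1)] typed.ten[OF f'(1) g(1)]]
      cls_eqI[OF eqv.ten_add_left[OF f(1) f'(1) g(1)]]
    by (simp add: Tens_cls HPlus_cls)
next
  fix X Y X' Y' u v v'
  assume "u \<in> Hom \<C> X Y" "v \<in> Hom \<C> X' Y'" "v' \<in> Hom \<C> X' Y'"
  then obtain f g g' where f: "typed R P X Y f" "u = cls X Y f" and g: "typed R P X' Y' g" "v = cls X' Y' g"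
    and g': "typed R P X' Y' g'" "v' = cls X' Y' g'" by (auto simp: Hom_iff)
  show "Tens \<C> u (HPlus \<C> v v') = HPlus \<C> (Tens \<C> u v) (Tens \<C> u v')"
    using f g g' Tens_cls[OF f(1) typed.add[OF g(1) g'(1)]]
      HPlus_cls[OF typed.ten[OF f(1) g(1)] typed.ten[OF f(1) g'(1)]]
      cls_eqI[OF eqv.ten_add_right[OF f(1) g(1) g'(1)]]
    by (simp add: Tens_cls HPlus_cls)
next
  fix X Y X' Y' c u v
  assume c: "c \<in> carrier R" and "u \<in> Hom \<C> X Y" "v \<in> Hom \<C> X' Y'"
  then obtain f g where f: "typed R P X Y f" "u = cls X Y f" and g: "typed R P X' Y' g" "v = cls X' Y' g"
    by (auto simp: Hom_iff)
  show "Tens \<C> (HScale \<C> c u) v = HScale \<C> c (Tens \<C> u v)"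
    using f g Tens_cls[OF typed.scl[OF c f(1)] g(1)] HScale_cls[OF c typed.ten[OF f(1) g(1)]]
      cls_eqI[OF eqv.ten_scl_left[OF c f(1) g(1)]] c
    by (simp add: Tens_cls HScale_cls)
  show "Tens \<C> u (HScale \<C> c v) = HScale \<C> c (Tens \<C> u v)"
    using f g Tens_cls[OF f(1) typed.scl[OF c g(1)]] HScale_cls[OF c typed.ten[OF f(1) g(1)]]
      cls_eqI[OF eqv.ten_scl_right[OF c f(1) g(1)]] c
    by (simp add: Tens_cls HScale_cls)
next
  fix X Y Z v u assume "v \<in> Hom \<C> Y Z" "u \<in> Hom \<C> X Y"
  then show "Comp \<C> v u \<in> Hom \<C> X Z" unfolding Hom_iff using Comp_cls typed.cmp by blast
next
  fix X Y X' Y' u v assume "u \<in> Hom \<C> X Y" "v \<in> Hom \<C> X' Y'"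
  then show "Tens \<C> u v \<in> Hom \<C> (TensO \<C> X X') (TensO \<C> Y Y')"
    unfolding Hom_iff strict_simps using Tens_cls typed.ten by blast
next
  fix X show "Ident \<C> X \<in> Hom \<C> X X" unfolding Hom_iff using Ident_cls typed.idt by blast
qed simp_all

end


section \<open>Building blocks for the relations\<close>

text \<open>
  The terms \<open>msum X Y f B\<close> for different enumerations of \<open>B\<close> are equivalent, so the choice of
  enumeration does not matter.
\<close>

definition msum ::
  "'o list \<Rightarrow> 'o list \<Rightarrow> ('b \<Rightarrow> ('k, 'o, 'g) mterm) \<Rightarrow> 'b set \<Rightarrow> ('k, 'o, 'g) mterm" where
  "msum X Y f B = foldr (\<lambda>b. Add (f b)) (SOME bs. distinct bs \<and> set bs = B) (Zer X Y)"

definition Sub :: "('k, 'r) ring_scheme \<Rightarrow> ('k, 'o, 'g) mterm \<Rightarrow> ('k, 'o, 'g) mterm \<Rightarrow> ('k, 'o, 'g) mterm" where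
  "Sub R f g = Add f (Scl (\<ominus>\<^bsub>R\<^esub> \<one>\<^bsub>R\<^esub>) g)"

text \<open>\<open>mpow e x r\<close> is the \<open>r\<close>-th power of \<open>x\<close>, with zeroth power \<open>e\<close>.\<close>

definition mpow :: "('k, 'o, 'g) mterm \<Rightarrow> ('k, 'o, 'g) mterm \<Rightarrow> nat \<Rightarrow> ('k, 'o, 'g) mterm" where
  "mpow e x r = ((\<lambda>f. x \<bullet> f) ^^ r) e"

text \<open>
  The relations stating, in the additive Karoubi envelope, that the column with entries \<open>t\<close> and
  \<open>d p\<close> (\<open>p \<in> I\<close>), a morphism \<open>(X, e) \<rightarrow> (Y, f) \<oplus> \<one>\<^bsup>I\<^esup>\<close>, has two-sided inverse
  the row with entries \<open>t'\<close> and \<open>u p\<close> (\<open>p \<in> I\<close>).  The first two relations say that the entries of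
  the row are morphisms \<open>(Y, f) \<rightarrow> (X, e)\<close> and \<open>\<one> \<rightarrow> (X, e)\<close>.
\<close>

definition column_inverse ::
  "'o list \<Rightarrow> ('k, 'o, 'g) mterm \<Rightarrow> 'o list \<Rightarrow> ('k, 'o, 'g) mterm \<Rightarrow>
   ('k, 'o, 'g) mterm \<Rightarrow> ('p \<Rightarrow> ('k, 'o, 'g) mterm) \<Rightarrow> 'p set \<Rightarrow>
   ('k, 'o, 'g) mterm \<Rightarrow> ('p \<Rightarrow> ('k, 'o, 'g) mterm) \<Rightarrow> (('k, 'o, 'g) mterm \<times> ('k, 'o, 'g) mterm) set" where
  "column_inverse X e Y f t d I t' u =
     {(e \<bullet> t' \<bullet> f, t')} \<union> {(e \<bullet> u p, u p) | p. p \<in> I} \<union>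
     {(Add (t' \<bullet> t) (msum X X (\<lambda>p. u p \<bullet> d p) I), e)} \<union>
     {(t \<bullet> t', f)} \<union>
     {(t \<bullet> u p, Zer [] Y) | p. p \<in> I} \<union>
     {(d p \<bullet> t', Zer Y []) | p. p \<in> I} \<union>
     {(d p \<bullet> u q, if p = q then Idt [] else Zer [] []) | p q. p \<in> I \<and> q \<in> I}"

text \<open>
  Likewise for the row with entries \<open>t\<close> and \<open>c p\<close>, a morphism \<open>(X, e) \<oplus> \<one>\<^bsup>I\<^esup> \<rightarrow> (Y, f)\<close>,
  and the column with entries \<open>t'\<close> and \<open>u p\<close>.
\<close>

definition row_inverse ::
  "'o list \<Rightarrow> ('k, 'o, 'g) mterm \<Rightarrow> 'o list \<Rightarrow> ('k, 'o, 'g) mterm \<Rightarrow>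
   ('k, 'o, 'g) mterm \<Rightarrow> ('p \<Rightarrow> ('k, 'o, 'g) mterm) \<Rightarrow> 'p set \<Rightarrow>
   ('k, 'o, 'g) mterm \<Rightarrow> ('p \<Rightarrow> ('k, 'o, 'g) mterm) \<Rightarrow> (('k, 'o, 'g) mterm \<times> ('k, 'o, 'g) mterm) set" where
  "row_inverse X e Y f t c I t' u =
     {(e \<bullet> t' \<bullet> f, t')} \<union> {(u p \<bullet> f, u p) | p. p \<in> I} \<union>
     {(Add (t \<bullet> t') (msum Y Y (\<lambda>p. c p \<bullet> u p) I), f)} \<union>
     {(t' \<bullet> t, e)} \<union>
     {(t' \<bullet> c p, Zer [] X) | p. p \<in> I} \<union>
     {(u p \<bullet> t, Zer X []) | p. p \<in> I} \<union>
     {(u p \<bullet> c q, if p = q then Idt [] else Zer [] []) | p q. p \<in> I \<and> q \<in> I}"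

datatype strand = Up | Down

abbreviation id_up :: "('k, strand, 'g) mterm" (\<open>\<one>\<^sub>+\<close>) where "\<one>\<^sub>+ \<equiv> Idt [Up]"
abbreviation id_down :: "('k, strand, 'g) mterm" (\<open>\<one>\<^sub>-\<close>) where "\<one>\<^sub>- \<equiv> Idt [Down]"

text \<open>
  The rotated crossing \<open>Q\<^sub>+Q\<^sub>- \<rightarrow> Q\<^sub>-Q\<^sub>+\<close> built from \<open>c\<close>, \<open>s\<close> and \<open>d\<close>, and the mate
  \<open>Q\<^sub>- \<rightarrow> Q\<^sub>-\<close> built from \<open>c\<close> and \<open>d\<close>.
\<close>

definition rotated_crossing ::
  "('k, strand, 'g) mterm \<Rightarrow> ('k, strand, 'g) mterm \<Rightarrow> ('k, strand, 'g) mterm \<Rightarrow> ('k, strand, 'g) mterm" where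
  "rotated_crossing s c d = (\<one>\<^sub>- \<boxtimes> \<one>\<^sub>+ \<boxtimes> d) \<bullet> (\<one>\<^sub>- \<boxtimes> s \<boxtimes> \<one>\<^sub>-) \<bullet> (c \<boxtimes> \<one>\<^sub>+ \<boxtimes> \<one>\<^sub>-)"

definition down_zigzag ::
  "('k, strand, 'g) mterm \<Rightarrow> ('k, strand, 'g) mterm \<Rightarrow> ('k, strand, 'g) mterm" where
  "down_zigzag c d = (\<one>\<^sub>- \<boxtimes> d) \<bullet> (c \<boxtimes> \<one>\<^sub>-)"


section \<open>The Frobenius Heisenberg category\<close>

text \<open>
  \<open>TInv\<close> and \<open>UInv r b\<close> are the matrix entries of the formally adjoined inverse; \<open>UInv r b\<close> is the
  entry belonging to the summand \<open>\<one>\<close> with index \<open>(r, b)\<close>.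
\<close>

datatype 'a hgen = XGen | SGen | CGen | DGen | BetaGen 'a | TInv | UInv nat 'a

definition heis_gens :: "('k, 'a, 'm) module_scheme \<Rightarrow> 'a set \<Rightarrow> int \<Rightarrow> 'a hgen set" where
  "heis_gens A B k =
     {XGen, SGen, CGen, DGen, TInv} \<union> BetaGen ` carrier A \<union> {UInv r b | r b. r < nat \<bar>k\<bar> \<and> b \<in> B}"

fun heis_source :: "int \<Rightarrow> 'a hgen \<Rightarrow> strand list" where
  "heis_source k XGen = [Up]"
| "heis_source k SGen = [Up, Up]"
| "heis_source k CGen = []"
| "heis_source k DGen = [Up, Down]"
| "heis_source k (BetaGen f) = [Up]"
| "heis_source k TInv = [Down, Up]"
| "heis_source k (UInv r b) = (if k \<ge> 0 then [] else [Down, Up])"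

fun heis_target :: "int \<Rightarrow> 'a hgen \<Rightarrow> strand list" where
  "heis_target k XGen = [Up]"
| "heis_target k SGen = [Up, Up]"
| "heis_target k CGen = [Down, Up]"
| "heis_target k DGen = []"
| "heis_target k (BetaGen f) = [Up]"
| "heis_target k TInv = [Up, Down]"
| "heis_target k (UInv r b) = (if k \<ge> 0 then [Up, Down] else [])"

inductive_set heis_rels ::
  "('k, 'r) ring_scheme \<Rightarrow> ('k, 'a, 'm) module_scheme \<Rightarrow> ('a \<Rightarrow> 'k) \<Rightarrow> 'a set \<Rightarrow> int \<Rightarrow>
     (('k, strand, 'a hgen) mterm \<times> ('k, strand, 'a hgen) mterm) set"
  for R A tr B k where
  beta_one: "(Gen (BetaGen \<one>\<^bsub>A\<^esub>), \<one>\<^sub>+) \<in> heis_rels R A tr B k"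
| beta_mult: "f \<in> carrier A \<Longrightarrow> g \<in> carrier A \<Longrightarrow>
    (Gen (BetaGen (f \<otimes>\<^bsub>A\<^esub> g)), Gen (BetaGen f) \<bullet> Gen (BetaGen g)) \<in> heis_rels R A tr B k"
| beta_add: "f \<in> carrier A \<Longrightarrow> g \<in> carrier A \<Longrightarrow>
    (Gen (BetaGen (f \<oplus>\<^bsub>A\<^esub> g)), Add (Gen (BetaGen f)) (Gen (BetaGen g))) \<in> heis_rels R A tr B k"
| beta_smult: "a \<in> carrier R \<Longrightarrow> f \<in> carrier A \<Longrightarrow>
    (Gen (BetaGen (a \<odot>\<^bsub>A\<^esub> f)), Scl a (Gen (BetaGen f))) \<in> heis_rels R A tr B k"
| braid: "((Gen SGen \<boxtimes> \<one>\<^sub>+) \<bullet> (\<one>\<^sub>+ \<boxtimes> Gen SGen) \<bullet> (Gen SGen \<boxtimes> \<one>\<^sub>+),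
    (\<one>\<^sub>+ \<boxtimes> Gen SGen) \<bullet> (Gen SGen \<boxtimes> \<one>\<^sub>+) \<bullet> (\<one>\<^sub>+ \<boxtimes> Gen SGen)) \<in> heis_rels R A tr B k"
| s_square: "(Gen SGen \<bullet> Gen SGen, Idt [Up, Up]) \<in> heis_rels R A tr B k"
| x_beta: "f \<in> carrier A \<Longrightarrow>
    (Gen XGen \<bullet> Gen (BetaGen f), Gen (BetaGen f) \<bullet> Gen XGen) \<in> heis_rels R A tr B k"
| s_beta: "f \<in> carrier A \<Longrightarrow>
    (Gen SGen \<bullet> (Gen (BetaGen f) \<boxtimes> \<one>\<^sub>+), (\<one>\<^sub>+ \<boxtimes> Gen (BetaGen f)) \<bullet> Gen SGen) \<in> heis_rels R A tr B k"
| x_s: "(Sub R ((Gen XGen \<boxtimes> \<one>\<^sub>+) \<bullet> Gen SGen) (Gen SGen \<bullet> (\<one>\<^sub>+ \<boxtimes> Gen XGen)),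
    msum [Up, Up] [Up, Up] (\<lambda>b. Gen (BetaGen (frob_dual R A tr B b)) \<boxtimes> Gen (BetaGen b)) B)
    \<in> heis_rels R A tr B k"
| zigzag_up: "((Gen DGen \<boxtimes> \<one>\<^sub>+) \<bullet> (\<one>\<^sub>+ \<boxtimes> Gen CGen), \<one>\<^sub>+) \<in> heis_rels R A tr B k"
| zigzag_down: "(down_zigzag (Gen CGen) (Gen DGen), \<one>\<^sub>-) \<in> heis_rels R A tr B k"
| inversion_nonneg: "k \<ge> 0 \<Longrightarrow>
    rel \<in> column_inverse [Up, Down] (Idt [Up, Down]) [Down, Up] (Idt [Down, Up])
      (rotated_crossing (Gen SGen) (Gen CGen) (Gen DGen))
      (\<lambda>(r, b). Gen DGen \<bullet> ((mpow \<one>\<^sub>+ (Gen XGen) r \<bullet> Gen (BetaGen (frob_dual R A tr B b))) \<boxtimes> \<one>\<^sub>-))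
      ({..<nat k} \<times> B) (Gen TInv) (\<lambda>(r, b). Gen (UInv r b))
    \<Longrightarrow> rel \<in> heis_rels R A tr B k"
| inversion_neg: "k < 0 \<Longrightarrow>
    rel \<in> row_inverse [Up, Down] (Idt [Up, Down]) [Down, Up] (Idt [Down, Up])
      (rotated_crossing (Gen SGen) (Gen CGen) (Gen DGen))
      (\<lambda>(r, b). (\<one>\<^sub>- \<boxtimes> (mpow \<one>\<^sub>+ (Gen XGen) r \<bullet> Gen (BetaGen (frob_dual R A tr B b)))) \<bullet> Gen CGen)
      ({..<nat (- k)} \<times> B) (Gen TInv) (\<lambda>(r, b). Gen (UInv r b))
    \<Longrightarrow> rel \<in> heis_rels R A tr B k"

definition Heis ::
  "('k, 'r) ring_scheme \<Rightarrow> ('k, 'a, 'm) module_scheme \<Rightarrow> ('a \<Rightarrow> 'k) \<Rightarrow> 'a set \<Rightarrow> int \<Rightarrow>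
     ('k, strand list, ('k, strand, 'a hgen) mterm set) lin_mon_cat" where
  "Heis R A tr B k = presented_cat R
     \<lparr>gens = heis_gens A B k, source = heis_source k, target = heis_target k,
      rels = heis_rels R A tr B k\<rparr>"


section \<open>The coloured presentation\<close>

text \<open>
  \<open>TInv' i j\<close> and \<open>UInv' i r b\<close> are the matrix entries of the formally adjoined inverses: \<open>TInv' i j\<close>
  for \<open>t\<^sub>i\<^sub>,\<^sub>j\<close>, and \<open>UInv' i r b\<close> for the summand \<open>\<one>\<close> with index \<open>(r, b)\<close> in colour \<open>i\<close>.
\<close>

datatype 'a cgen =
    XGen' nat | SGen' nat nat | CGen' nat | DGen' nat | BetaGen' 'a nat
  | TInv' nat nat | UInv' nat nat 'a

definition col_heis_gens ::
  "nat \<Rightarrow> (nat \<Rightarrow> ('k, 'a, 'm) module_scheme) \<Rightarrow> (nat \<Rightarrow> 'a set) \<Rightarrow> int \<Rightarrow> 'a cgen set" where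
  "col_heis_gens n F B k =
     {XGen' i | i. i \<in> {1..n}} \<union> {SGen' i j | i j. i \<in> {1..n} \<and> j \<in> {1..n}} \<union>
     {CGen' i | i. i \<in> {1..n}} \<union> {DGen' i | i. i \<in> {1..n}} \<union>
     {BetaGen' f i | f i. i \<in> {1..n} \<and> f \<in> carrier (F i)} \<union>
     {TInv' i j | i j. i \<in> {1..n} \<and> j \<in> {1..n}} \<union>
     {UInv' i r b | i r b. i \<in> {1..n} \<and> r < nat \<bar>k\<bar> \<and> b \<in> B i}"

fun col_heis_source :: "int \<Rightarrow> 'a cgen \<Rightarrow> strand list" where
  "col_heis_source k (XGen' i) = [Up]"
| "col_heis_source k (SGen' i j) = [Up, Up]"
| "col_heis_source k (CGen' i) = []"
| "col_heis_source k (DGen' i) = [Up, Down]"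
| "col_heis_source k (BetaGen' f i) = [Up]"
| "col_heis_source k (TInv' i j) = [Down, Up]"
| "col_heis_source k (UInv' i r b) = (if k \<ge> 0 then [] else [Down, Up])"

fun col_heis_target :: "int \<Rightarrow> 'a cgen \<Rightarrow> strand list" where
  "col_heis_target k (XGen' i) = [Up]"
| "col_heis_target k (SGen' i j) = [Up, Up]"
| "col_heis_target k (CGen' i) = [Down, Up]"
| "col_heis_target k (DGen' i) = []"
| "col_heis_target k (BetaGen' f i) = [Up]"
| "col_heis_target k (TInv' i j) = [Up, Down]"
| "col_heis_target k (UInv' i r b) = (if k \<ge> 0 then [Up, Down] else [])"

definition up_col ::
  "(nat \<Rightarrow> ('k, 'a, 'm) module_scheme) \<Rightarrow> nat \<Rightarrow> ('k, strand, 'a cgen) mterm" where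
  "up_col F i = Gen (BetaGen' \<one>\<^bsub>F i\<^esub> i)"

definition down_col :: "nat \<Rightarrow> ('k, strand, 'a cgen) mterm" where
  "down_col i = down_zigzag (Gen (CGen' i)) (Gen (DGen' i))"

definition t_col :: "nat \<Rightarrow> nat \<Rightarrow> ('k, strand, 'a cgen) mterm" where
  "t_col i j = rotated_crossing (Gen (SGen' j i)) (Gen (CGen' j)) (Gen (DGen' j))"

inductive_set col_heis_rels ::
  "('k, 'r) ring_scheme \<Rightarrow> nat \<Rightarrow> (nat \<Rightarrow> ('k, 'a, 'm) module_scheme) \<Rightarrow> (nat \<Rightarrow> 'a \<Rightarrow> 'k) \<Rightarrow>
     (nat \<Rightarrow> 'a set) \<Rightarrow> int \<Rightarrow> (('k, strand, 'a cgen) mterm \<times> ('k, strand, 'a cgen) mterm) set"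
  for R n F tr B k where
  col_beta_orth: "i \<in> {1..n} \<Longrightarrow> j \<in> {1..n} \<Longrightarrow> i \<noteq> j \<Longrightarrow> f \<in> carrier (F i) \<Longrightarrow> g \<in> carrier (F j) \<Longrightarrow>
    (Gen (BetaGen' f i) \<bullet> Gen (BetaGen' g j), Zer [Up] [Up]) \<in> col_heis_rels R n F tr B k"
| col_up_sum: "(msum [Up] [Up] (up_col F) {1..n}, \<one>\<^sub>+) \<in> col_heis_rels R n F tr B k"
| col_down_orth: "i \<in> {1..n} \<Longrightarrow> j \<in> {1..n} \<Longrightarrow>
    (down_col i \<bullet> down_col j, if i = j then down_col i else Zer [Down] [Down])
    \<in> col_heis_rels R n F tr B k"
| col_down_sum: "(msum [Down] [Down] down_col {1..n}, \<one>\<^sub>-) \<in> col_heis_rels R n F tr B k"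
| col_s: "i \<in> {1..n} \<Longrightarrow> j \<in> {1..n} \<Longrightarrow>
    (Gen (SGen' i j), (up_col F j \<boxtimes> up_col F i) \<bullet> Gen (SGen' i j) \<bullet> (up_col F i \<boxtimes> up_col F j))
    \<in> col_heis_rels R n F tr B k"
| col_x: "i \<in> {1..n} \<Longrightarrow>
    (Gen (XGen' i), up_col F i \<bullet> Gen (XGen' i) \<bullet> up_col F i) \<in> col_heis_rels R n F tr B k"
| col_c: "i \<in> {1..n} \<Longrightarrow>
    (Gen (CGen' i), (down_col i \<boxtimes> up_col F i) \<bullet> Gen (CGen' i)) \<in> col_heis_rels R n F tr B k"
| col_d: "i \<in> {1..n} \<Longrightarrow>
    (Gen (DGen' i), Gen (DGen' i) \<bullet> (up_col F i \<boxtimes> down_col i)) \<in> col_heis_rels R n F tr B k"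
| beta_add: "i \<in> {1..n} \<Longrightarrow> f \<in> carrier (F i) \<Longrightarrow> g \<in> carrier (F i) \<Longrightarrow>
    (Gen (BetaGen' (f \<oplus>\<^bsub>F i\<^esub> g) i), Add (Gen (BetaGen' f i)) (Gen (BetaGen' g i)))
    \<in> col_heis_rels R n F tr B k"
| beta_smult: "i \<in> {1..n} \<Longrightarrow> a \<in> carrier R \<Longrightarrow> f \<in> carrier (F i) \<Longrightarrow>
    (Gen (BetaGen' (a \<odot>\<^bsub>F i\<^esub> f) i), Scl a (Gen (BetaGen' f i))) \<in> col_heis_rels R n F tr B k"
| beta_mult: "i \<in> {1..n} \<Longrightarrow> f \<in> carrier (F i) \<Longrightarrow> g \<in> carrier (F i) \<Longrightarrow>
    (Gen (BetaGen' f i) \<bullet> Gen (BetaGen' g i), Gen (BetaGen' (f \<otimes>\<^bsub>F i\<^esub> g) i))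
    \<in> col_heis_rels R n F tr B k"
| braid: "i \<in> {1..n} \<Longrightarrow> j \<in> {1..n} \<Longrightarrow> l \<in> {1..n} \<Longrightarrow>
    ((Gen (SGen' j l) \<boxtimes> up_col F i) \<bullet> (up_col F j \<boxtimes> Gen (SGen' i l)) \<bullet> (Gen (SGen' i j) \<boxtimes> up_col F l),
     (up_col F l \<boxtimes> Gen (SGen' i j)) \<bullet> (Gen (SGen' i l) \<boxtimes> up_col F j) \<bullet> (up_col F i \<boxtimes> Gen (SGen' j l)))
    \<in> col_heis_rels R n F tr B k"
| s_inverse: "i \<in> {1..n} \<Longrightarrow> j \<in> {1..n} \<Longrightarrow>
    (Gen (SGen' j i) \<bullet> Gen (SGen' i j), up_col F i \<boxtimes> up_col F j) \<in> col_heis_rels R n F tr B k"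
| x_beta: "i \<in> {1..n} \<Longrightarrow> f \<in> carrier (F i) \<Longrightarrow>
    (Gen (XGen' i) \<bullet> Gen (BetaGen' f i), Gen (BetaGen' f i) \<bullet> Gen (XGen' i))
    \<in> col_heis_rels R n F tr B k"
| s_beta: "i \<in> {1..n} \<Longrightarrow> j \<in> {1..n} \<Longrightarrow> f \<in> carrier (F i) \<Longrightarrow>
    (Gen (SGen' i j) \<bullet> (Gen (BetaGen' f i) \<boxtimes> up_col F j),
     (up_col F j \<boxtimes> Gen (BetaGen' f i)) \<bullet> Gen (SGen' i j)) \<in> col_heis_rels R n F tr B k"
| x_s: "i \<in> {1..n} \<Longrightarrow> j \<in> {1..n} \<Longrightarrow>
    (Sub R ((Gen (XGen' j) \<boxtimes> up_col F i) \<bullet> Gen (SGen' i j)) (Gen (SGen' i j) \<bullet> (up_col F i \<boxtimes> Gen (XGen' j))),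
     if i = j
     then msum [Up, Up] [Up, Up]
       (\<lambda>b. Gen (BetaGen' (frob_dual R (F i) (tr i) (B i) b) i) \<boxtimes> Gen (BetaGen' b i)) (B i)
     else Zer [Up, Up] [Up, Up]) \<in> col_heis_rels R n F tr B k"
| zigzag_up: "i \<in> {1..n} \<Longrightarrow>
    ((Gen (DGen' i) \<boxtimes> \<one>\<^sub>+) \<bullet> (\<one>\<^sub>+ \<boxtimes> Gen (CGen' i)), up_col F i) \<in> col_heis_rels R n F tr B k"
| zigzag_down: "i \<in> {1..n} \<Longrightarrow>
    (down_zigzag (Gen (CGen' i)) (Gen (DGen' i)), down_col i) \<in> col_heis_rels R n F tr B k"
| inversion_distinct: "i \<in> {1..n} \<Longrightarrow> j \<in> {1..n} \<Longrightarrow> i \<noteq> j \<Longrightarrow>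
    rel \<in> {(Gen (TInv' i j), (up_col F i \<boxtimes> down_col j) \<bullet> Gen (TInv' i j) \<bullet> (down_col j \<boxtimes> up_col F i)),
      (Gen (TInv' i j) \<bullet> t_col i j, up_col F i \<boxtimes> down_col j),
      (t_col i j \<bullet> Gen (TInv' i j), down_col j \<boxtimes> up_col F i)}
    \<Longrightarrow> rel \<in> col_heis_rels R n F tr B k"
| inversion_nonneg: "k \<ge> 0 \<Longrightarrow> i \<in> {1..n} \<Longrightarrow>
    rel \<in> column_inverse [Up, Down] (up_col F i \<boxtimes> down_col i) [Down, Up] (down_col i \<boxtimes> up_col F i)
      (t_col i i)
      (\<lambda>(r, b). Gen (DGen' i) \<bullet>
         ((mpow (up_col F i) (Gen (XGen' i)) r \<bullet> Gen (BetaGen' (frob_dual R (F i) (tr i) (B i) b) i)) \<boxtimes> \<one>\<^sub>-))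
      ({..<nat k} \<times> B i) (Gen (TInv' i i)) (\<lambda>(r, b). Gen (UInv' i r b))
    \<Longrightarrow> rel \<in> col_heis_rels R n F tr B k"
| inversion_neg: "k < 0 \<Longrightarrow> i \<in> {1..n} \<Longrightarrow>
    rel \<in> row_inverse [Up, Down] (up_col F i \<boxtimes> down_col i) [Down, Up] (down_col i \<boxtimes> up_col F i)
      (t_col i i)
      (\<lambda>(r, b).
         (\<one>\<^sub>- \<boxtimes> (mpow (up_col F i) (Gen (XGen' i)) r \<bullet> Gen (BetaGen' (frob_dual R (F i) (tr i) (B i) b) i))) \<bullet>
         Gen (CGen' i))
      ({..<nat (- k)} \<times> B i) (Gen (TInv' i i)) (\<lambda>(r, b). Gen (UInv' i r b))
    \<Longrightarrow> rel \<in> col_heis_rels R n F tr B k"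

definition Heis' ::
  "('k, 'r) ring_scheme \<Rightarrow> nat \<Rightarrow> (nat \<Rightarrow> ('k, 'a, 'm) module_scheme) \<Rightarrow> (nat \<Rightarrow> 'a \<Rightarrow> 'k) \<Rightarrow>
     (nat \<Rightarrow> 'a set) \<Rightarrow> int \<Rightarrow> ('k, strand list, ('k, strand, 'a cgen) mterm set) lin_mon_cat" where
  "Heis' R n F tr B k = presented_cat R
     \<lparr>gens = col_heis_gens n F B k, source = col_heis_source k, target = col_heis_target k,
      rels = col_heis_rels R n F tr B k\<rparr>"

end

theory Submission
  imports Defs
begin

text \<open>
  The units \<open>e\<^sub>i\<close> of the summands are orthogonal idempotents with sum \<open>1\<close>.  In the Frobenius
  Heisenberg category they cut the upward strand into \<open>n\<close> coloured strands, and since \<open>Q\<^sub>-\<close> is dual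
  to \<open>Q\<^sub>+\<close>, their mates cut the downward strand in the same way.  All generators commute with colours:
  \<open>x e\<^sub>i = e\<^sub>i x\<close>, \<open>s (e\<^sub>i \<otimes> e\<^sub>j) = (e\<^sub>j \<otimes> e\<^sub>i) s\<close>, and cups and caps turn an idempotent into its mate.
  Hence a generator is the sum of its coloured components, and an uncoloured relation holds if and
  only if all its components hold, because a morphism is the sum of its composites with tensor
  products of idempotents.  These components are the relations of the coloured presentation.  So the
  substitution \<open>merge\<close>, which replaces a generator by the sum of its coloured versions, and the
  substitution \<open>split\<close>, which replaces a coloured generator by a component, respect the relations and
  define functors.  They are mutually inverse because they are so on generators
  (\<open>presentations_isomorphic\<close>).

  The comparison of relations is made once, in the locale \<open>coloured_strands\<close> and its extensions,
  where uncoloured and coloured generators live in the same category; the lemmas \<open>braid_col\<close>,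
  \<open>x_s_col\<close>, \<open>zigzag_up_col\<close>, \<open>rotated_col\<close> and their companions compute components.  Locale
  \<open>uncoloured\<close> shows that the Frobenius Heisenberg category is an instance and reads the lemmas in one
  direction (\<open>split_respects\<close>); locale \<open>coloured\<close> does so for the coloured category and the other
  direction (\<open>merge_respects\<close>).

  Two points are more than bookkeeping.  First, the presentation relates the adjoined inverses to no
  tokens, so it must be proved that they commute with colours.  They do because the matrices \<open>t\<close>,
  \<open>d (x\<^sup>r \<beta> \<otimes> 1)\<close> and \<open>(1 \<otimes> x\<^sup>r \<beta>) c\<close> do (\<open>inverse_pair_idempotent_right\<close> and
  \<open>inverse_pair_idempotent_left\<close>); then invertibility can be tested block by block
  (\<open>inverse_pair_blocks\<close>), where different colours are connected by the crossings \<open>t\<^sub>i\<^sub>,\<^sub>j\<close> alone.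
  Second, the dual basis of the direct sum consists of the dual bases of the summands (\<open>dualA_incl\<close>),
  since the trace is the sum of the traces; so the sum over the basis in the relation between \<open>x\<close> and
  \<open>s\<close> has components only at equal colours (\<open>casimir_col\<close>).
\<close>

section \<open>Calculus of morphisms in a presented category\<close>

context presented
begin

abbreviation comp (infixr "\<cdot>" 65) where "g \<cdot> f \<equiv> Comp \<C> g f"
abbreviation tens (infixr "\<star>" 75) where "f \<star> g \<equiv> Tens \<C> f g"
abbreviation idm where "idm X \<equiv> Ident \<C> X"
abbreviation zerom where "zerom X Y \<equiv> HZero \<C> X Y"
abbreviation plusm (infixl "\<oplus>\<oplus>" 60) where "f \<oplus>\<oplus> g \<equiv> HPlus \<C> f g"
abbreviation hsum where "hsum X Y f A \<equiv> finsum (hom_module \<C> X Y) f A"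

text \<open>
  The class of a term without mention of its type.  An ill-typed term has the empty class, and the
  operations of the category send empty sets to the empty set; therefore \<open>mor\<close> commutes with all
  operations on all terms, well typed or not.
\<close>

definition mor :: "('k, 'o, 'g) mterm \<Rightarrow> ('k, 'o, 'g) mterm set" where
  "mor f = {h. \<exists>X Y. eqv R P X Y f h}"

lemma mor_cls: "typed R P X Y f \<Longrightarrow> mor f = cls X Y f"
  unfolding mor_def cls_def using eqv_ty(1) typed_unique by blast

lemma mor_in_Hom: "mor f \<in> Hom \<C> X Y \<longleftrightarrow> typed R P X Y f"
proof
  assume "mor f \<in> Hom \<C> X Y"
  then obtain g where g: "typed R P X Y g" "mor f = cls X Y g" by (auto simp: Hom_iff)
  then have "g \<in> mor f" by (simp add: cls_def eqv.refl)
  then obtain X' Y' where e: "eqv R P X' Y' f g" by (auto simp: mor_def)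
  then show "typed R P X Y f" using typed_unique[OF eqv_ty(2)[OF e] g(1)] eqv_ty(1)[OF e] by simp
qed (use mor_cls in \<open>auto simp: Hom_iff\<close>)

lemma Hom_mor: "u \<in> Hom \<C> X Y \<longleftrightarrow> (\<exists>f. typed R P X Y f \<and> u = mor f)"
  unfolding Hom_iff using mor_cls by metis

lemma Hom_morE:
  assumes "u \<in> Hom \<C> X Y" obtains f where "typed R P X Y f" "u = mor f"
  using assms Hom_mor by auto

lemma eqv_iff_mor: "eqv R P X Y f g \<longleftrightarrow> typed R P X Y f \<and> mor f = mor g"
proof (intro iffI conjI)
  assume e: "eqv R P X Y f g"
  show "typed R P X Y f" using eqv_ty(1)[OF e] .
  show "mor f = mor g" using mor_cls[OF eqv_ty(1)[OF e]] mor_cls[OF eqv_ty(2)[OF e]] cls_eqI[OF e] by simp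
next
  assume "typed R P X Y f \<and> mor f = mor g"
  then have "typed R P X Y f" "typed R P X Y g" "mor f = mor g" using mor_in_Hom by metis+
  then show "eqv R P X Y f g" using mor_cls cls_eq_iff by metis
qed

lemma mor_self: "typed R P X Y f \<Longrightarrow> f \<in> mor f"
  unfolding mor_def using eqv.refl by blast

lemma mor_Idt [simp]: "mor (Idt X) = idm X"
  using mor_cls[OF typed.idt] Ident_cls by simp

lemma mor_Zer [simp]: "mor (Zer X Y) = zerom X Y"
  using mor_cls[OF typed.zer] HZero_cls by simp

lemma mor_Cmp [simp]: "mor (g \<bullet> f) = mor g \<cdot> mor f"
proof (intro Set.set_eqI iffI)
  fix h assume "h \<in> mor (g \<bullet> f)"
  then obtain X Z where e: "eqv R P X Z (g \<bullet> f) h" by (auto simp: mor_def)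
  from eqv_ty(1)[OF e] obtain Y where "typed R P Y Z g" "typed R P X Y f" by (rule typed_CmpE)
  then have "g \<in> mor g" "f \<in> mor f" using mor_self by blast+
  then show "h \<in> mor g \<cdot> mor f" using e unfolding presented_cat_def by auto
next
  fix h assume "h \<in> mor g \<cdot> mor f"
  then obtain g' f' X Z X1 Y1 X2 Y2 where e: "eqv R P X Z (g' \<bullet> f') h"
    and g: "eqv R P X1 Y1 g g'" and f: "eqv R P X2 Y2 f f'" unfolding presented_cat_def mor_def by auto
  from eqv_ty(1)[OF e] obtain Y where ty: "typed R P Y Z g'" "typed R P X Y f'" by (rule typed_CmpE)
  have eq: "X1 = Y" "Y1 = Z" "X2 = X" "Y2 = Y"
    using typed_unique[OF ty(1) eqv_ty(2)[OF g]] typed_unique[OF ty(2) eqv_ty(2)[OF f]] by auto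
  have "eqv R P X Z (g \<bullet> f) (g' \<bullet> f')" using g f eq by (blast intro: eqv.cong_cmp)
  then show "h \<in> mor (g \<bullet> f)" using eqv.trans[OF _ e] by (auto simp: mor_def)
qed

lemma mor_Ten [simp]: "mor (f \<boxtimes> g) = mor f \<star> mor g"
proof (intro Set.set_eqI iffI)
  fix h assume "h \<in> mor (f \<boxtimes> g)"
  then obtain X Z where e: "eqv R P X Z (f \<boxtimes> g) h" by (auto simp: mor_def)
  from eqv_ty(1)[OF e] have "f \<in> mor f" "g \<in> mor g" by (auto elim!: typed_TenE intro: mor_self)
  then show "h \<in> mor f \<star> mor g" using e unfolding presented_cat_def by auto
next
  fix h assume "h \<in> mor f \<star> mor g"
  then obtain g' f' X Z X1 Y1 X2 Y2 where e: "eqv R P X Z (f' \<boxtimes> g') h"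
    and g: "eqv R P X1 Y1 g g'" and f: "eqv R P X2 Y2 f f'" unfolding presented_cat_def mor_def by auto
  have "eqv R P (X2 @ X1) (Y2 @ Y1) (f \<boxtimes> g) (f' \<boxtimes> g')" using g f by (rule eqv.cong_ten[rotated])
  moreover from this have "X = X2 @ X1" "Z = Y2 @ Y1"
    using typed_unique[OF eqv_ty(1)[OF e] eqv_ty(2)] by blast+
  ultimately have "eqv R P X Z (f \<boxtimes> g) h" using eqv.trans[OF _ e] by simp
  then show "h \<in> mor (f \<boxtimes> g)" by (auto simp: mor_def)
qed

lemma mor_Add [simp]: "mor (Add f g) = mor f \<oplus>\<oplus> mor g"
proof (intro Set.set_eqI iffI)
  fix h assume "h \<in> mor (Add f g)"
  then obtain X Z where e: "eqv R P X Z (Add f g) h" by (auto simp: mor_def)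
  from eqv_ty(1)[OF e] have "f \<in> mor f" "g \<in> mor g" by (auto elim!: typed_AddE intro: mor_self)
  then show "h \<in> mor f \<oplus>\<oplus> mor g" using e unfolding presented_cat_def by auto
next
  fix h assume "h \<in> mor f \<oplus>\<oplus> mor g"
  then obtain g' f' X Z X1 Y1 X2 Y2 where e: "eqv R P X Z (Add f' g') h"
    and g: "eqv R P X1 Y1 g g'" and f: "eqv R P X2 Y2 f f'" unfolding presented_cat_def mor_def by auto
  from eqv_ty(1)[OF e] have ty: "typed R P X Z f'" "typed R P X Z g'" by (auto elim: typed_AddE)
  have eq: "X1 = X" "Y1 = Z" "X2 = X" "Y2 = Z"
    using typed_unique[OF ty(2) eqv_ty(2)[OF g]] typed_unique[OF ty(1) eqv_ty(2)[OF f]] by auto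
  have "eqv R P X Z (Add f g) (Add f' g')" using g f eq by (blast intro: eqv.cong_add)
  then show "h \<in> mor (Add f g)" using eqv.trans[OF _ e] by (auto simp: mor_def)
qed

lemma mor_Scl [simp]: "mor (Scl a f) = HScale \<C> a (mor f)"
proof (intro Set.set_eqI iffI)
  fix h assume "h \<in> mor (Scl a f)"
  then obtain X Z where e: "eqv R P X Z (Scl a f) h" by (auto simp: mor_def)
  from eqv_ty(1)[OF e] have "f \<in> mor f" by (auto elim!: typed_SclE intro: mor_self)
  then show "h \<in> HScale \<C> a (mor f)" using e unfolding presented_cat_def by auto
next
  fix h assume "h \<in> HScale \<C> a (mor f)"
  then obtain f' X Z X2 Y2 where e: "eqv R P X Z (Scl a f') h"
    and f: "eqv R P X2 Y2 f f'" unfolding presented_cat_def mor_def by auto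
  from eqv_ty(1)[OF e] have ty: "typed R P X Z f'" "a \<in> carrier R" by (auto elim: typed_SclE)
  have eq: "X2 = X" "Y2 = Z" using typed_unique[OF ty(1) eqv_ty(2)[OF f]] by auto
  have "eqv R P X Z (Scl a f) (Scl a f')" using f eq ty by (blast intro: eqv.cong_scl)
  then show "h \<in> mor (Scl a f)" using eqv.trans[OF _ e] by (auto simp: mor_def)
qed

lemma relation_holds:
  assumes "(f, g) \<in> rels P" "mor f \<in> Hom \<C> X Y" "mor g \<in> Hom \<C> X Y"
  shows "mor f = mor g"
  using eqv.rel[OF assms(1), of R X Y] assms(2,3) by (simp add: mor_in_Hom eqv_iff_mor)

lemma Comp_mem: "h \<in> v \<cdot> u \<longleftrightarrow> (\<exists>g\<in>v. \<exists>f\<in>u. h \<in> mor (g \<bullet> f))"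
  by (simp add: presented_cat_def mor_def del: mor_Cmp)

lemma mor_ex_typed: "h \<in> mor f \<Longrightarrow> \<exists>X Y. typed R P X Y f"
  unfolding mor_def using eqv_ty(1) by blast

lemma mor_mem_eq: "k \<in> mor f \<Longrightarrow> mor k = mor f"
proof -
  assume "k \<in> mor f"
  then obtain X Y where "eqv R P X Y f k" unfolding mor_def by blast
  then show ?thesis by (simp only: eqv_iff_mor)
qed

text \<open>
  Composition is associative for arbitrary sets of terms, because a product of sets is the union of
  the classes of the typed products of their elements; so rewriting needs no typing conditions.
\<close>

lemma comp_assoc_total [simp]: "(w \<cdot> v) \<cdot> u = w \<cdot> v \<cdot> u"
proof -
  have eqm: "mor ((g \<bullet> f) \<bullet> e) = mor (g \<bullet> f \<bullet> e)" for g f e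
  proof (cases "\<exists>X Y. typed R P X Y (g \<bullet> f \<bullet> e)")
    case True
    then obtain W X Y Z where "typed R P Y Z g" "typed R P X Y f" "typed R P W X e"
      by (auto elim!: typed_CmpE)
    from eqv.cmp_assoc[OF this] show ?thesis by (simp only: eqv_iff_mor)
  next
    case False
    then have "\<nexists>X Y. typed R P X Y ((g \<bullet> f) \<bullet> e)" by (auto elim!: typed_CmpE intro: typed.cmp)
    with False have "mor ((g \<bullet> f) \<bullet> e) = {}" "mor (g \<bullet> f \<bullet> e) = {}"
      using mor_ex_typed by blast+
    then show ?thesis by simp
  qed
  have left': "h \<in> mor ((g \<bullet> f) \<bullet> e)" if "k \<in> mor (g \<bullet> f)" "h \<in> mor (k \<bullet> e)" for h k g f e
    using that mor_mem_eq[OF that(1)] by simp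
  have right': "h \<in> mor (g \<bullet> (f \<bullet> e))" if "k \<in> mor (f \<bullet> e)" "h \<in> mor (g \<bullet> k)" for h k g f e
    using that mor_mem_eq[OF that(1)] by simp
  have self: "g \<bullet> f \<in> mor (g \<bullet> f)" "f \<bullet> e \<in> mor (f \<bullet> e)" if h: "h \<in> mor (g \<bullet> f \<bullet> e)" for h g f e
  proof -
    obtain X Y where "typed R P X Y (g \<bullet> f \<bullet> e)" using mor_ex_typed[OF h] by blast
    then have "\<exists>X Y. typed R P X Y (g \<bullet> f)" "\<exists>X Y. typed R P X Y (f \<bullet> e)"
      by (auto elim!: typed_CmpE intro: typed.cmp)
    then show "g \<bullet> f \<in> mor (g \<bullet> f)" "f \<bullet> e \<in> mor (f \<bullet> e)" using mor_self by blast+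
  qed
  show ?thesis
  proof (intro Set.set_eqI iffI)
    fix h assume "h \<in> (w \<cdot> v) \<cdot> u"
    then obtain k e where k: "k \<in> w \<cdot> v" "e \<in> u" "h \<in> mor (k \<bullet> e)"
      unfolding Comp_mem[of h] by blast
    then obtain g f where gf: "g \<in> w" "f \<in> v" "k \<in> mor (g \<bullet> f)" unfolding Comp_mem by blast
    have h: "h \<in> mor (g \<bullet> f \<bullet> e)" using left'[OF gf(3) k(3)] eqm by simp
    have "f \<bullet> e \<in> v \<cdot> u" unfolding Comp_mem using self(2)[OF h] gf(2) k(2) by blast
    then show "h \<in> w \<cdot> v \<cdot> u" unfolding Comp_mem[of h] using h gf(1) by blast
  next
    fix h assume "h \<in> w \<cdot> v \<cdot> u"
    then obtain g k where k: "g \<in> w" "k \<in> v \<cdot> u" "h \<in> mor (g \<bullet> k)"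
      unfolding Comp_mem[of h] by blast
    then obtain f e where fe: "f \<in> v" "e \<in> u" "k \<in> mor (f \<bullet> e)" unfolding Comp_mem by blast
    have h: "h \<in> mor (g \<bullet> f \<bullet> e)" using right'[OF fe(3) k(3)] .
    then have h': "h \<in> mor ((g \<bullet> f) \<bullet> e)" by (simp only: eqm)
    have "g \<bullet> f \<in> w \<cdot> v" unfolding Comp_mem using self(1)[OF h] fe(1) k(1) by blast
    then show "h \<in> (w \<cdot> v) \<cdot> u" unfolding Comp_mem[of h] using h' fe(2) by blast
  qed
qed

text \<open>
  Source and target as functions of a morphism.  In contrast to membership in a hom-set, typing
  conditions in this form contain no objects that a rewriting engine would have to guess.
\<close>

definition arr where "arr u \<longleftrightarrow> (\<exists>X Y. u \<in> Hom \<C> X Y)"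
definition src where "src u = (THE X. \<exists>Y. u \<in> Hom \<C> X Y)"
definition tgt where "tgt u = (THE Y. \<exists>X. u \<in> Hom \<C> X Y)"

lemma Hom_unique: "u \<in> Hom \<C> X Y \<Longrightarrow> u \<in> Hom \<C> X' Y' \<Longrightarrow> X = X' \<and> Y = Y'"
  by (rule hom_disjoint) simp_all

lemma src_eq: "u \<in> Hom \<C> X Y \<Longrightarrow> src u = X"
  unfolding src_def using Hom_unique by (intro the_equality) blast+

lemma tgt_eq: "u \<in> Hom \<C> X Y \<Longrightarrow> tgt u = Y"
  unfolding tgt_def using Hom_unique by (intro the_equality) blast+

lemma in_Hom_iff: "u \<in> Hom \<C> X Y \<longleftrightarrow> arr u \<and> src u = X \<and> tgt u = Y"
  using src_eq tgt_eq arr_def by metis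

lemma ty_comp [simp]:
  assumes "arr g" "arr f" "src g = tgt f"
  shows "arr (g \<cdot> f)" "src (g \<cdot> f) = src f" "tgt (g \<cdot> f) = tgt g"
proof -
  have "g \<cdot> f \<in> Hom \<C> (src f) (tgt g)"
    by (rule comp_hom[where Y = "tgt f"]) (use assms in \<open>simp_all add: in_Hom_iff\<close>)
  then show "arr (g \<cdot> f)" "src (g \<cdot> f) = src f" "tgt (g \<cdot> f) = tgt g" by (simp_all add: in_Hom_iff)
qed

lemma ty_tens [simp]:
  assumes "arr f" "arr g"
  shows "arr (f \<star> g)" "src (f \<star> g) = src f @ src g" "tgt (f \<star> g) = tgt f @ tgt g"
proof -
  have "f \<star> g \<in> Hom \<C> (src f @ src g) (tgt f @ tgt g)"
    using tens_hom[of "src f" "tgt f" "src g" "tgt g" f g] assms by (simp add: in_Hom_iff)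
  then show "arr (f \<star> g)" "src (f \<star> g) = src f @ src g" "tgt (f \<star> g) = tgt f @ tgt g"
    by (simp_all add: in_Hom_iff)
qed

lemma ty_idm [simp]: "arr (idm X)" "src (idm X) = X" "tgt (idm X) = X"
  using id_hom[of X] by (simp_all add: in_Hom_iff)

lemma zerom_Hom: "zerom X Y \<in> Hom \<C> X Y"
  using mor_in_Hom[of "Zer X Y" X Y] by (simp add: typed.zer)

lemma ty_zerom [simp]: "arr (zerom X Y)" "src (zerom X Y) = X" "tgt (zerom X Y) = Y"
  using zerom_Hom[of X Y] by (simp_all add: in_Hom_iff)

lemma ty_plusm [simp]:
  assumes "arr f" "arr g" "src f = src g" "tgt f = tgt g"
  shows "arr (f \<oplus>\<oplus> g)" "src (f \<oplus>\<oplus> g) = src g" "tgt (f \<oplus>\<oplus> g) = tgt g"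
proof -
  interpret M: module R "hom_module \<C> (src g) (tgt g)" by (rule hom_module_presented)
  have "f \<oplus>\<oplus> g \<in> Hom \<C> (src g) (tgt g)"
    using M.a_closed[of f g] assms by (simp add: hom_module_def in_Hom_iff)
  then show "arr (f \<oplus>\<oplus> g)" "src (f \<oplus>\<oplus> g) = src g" "tgt (f \<oplus>\<oplus> g) = tgt g"
    by (simp_all add: in_Hom_iff)
qed

lemma ty_scale [simp]:
  assumes "arr f" "a \<in> carrier R"
  shows "arr (HScale \<C> a f)" "src (HScale \<C> a f) = src f" "tgt (HScale \<C> a f) = tgt f"
proof -
  interpret M: module R "hom_module \<C> (src f) (tgt f)" by (rule hom_module_presented)
  have "HScale \<C> a f \<in> Hom \<C> (src f) (tgt f)"
    using M.smult_closed[of a f] assms by (simp add: hom_module_def in_Hom_iff)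
  then show "arr (HScale \<C> a f)" "src (HScale \<C> a f) = src f" "tgt (HScale \<C> a f) = tgt f"
    by (simp_all add: in_Hom_iff)
qed

lemma idm_comp [simp]: "arr f \<Longrightarrow> tgt f = Y \<Longrightarrow> idm Y \<cdot> f = f"
  by (rule id_comp[of "src f"]) (simp_all add: in_Hom_iff)

lemma comp_idm [simp]: "arr f \<Longrightarrow> src f = X \<Longrightarrow> f \<cdot> idm X = f"
  by (rule comp_id[of _ "tgt f"]) (simp_all add: in_Hom_iff)

lemma tens_assoc' [simp]: "arr f \<Longrightarrow> arr g \<Longrightarrow> arr h \<Longrightarrow> (f \<star> g) \<star> h = f \<star> g \<star> h"
  by (rule tens_assoc[of "src f" "tgt f" "src g" "tgt g" "src h" "tgt h"]) (simp_all add: in_Hom_iff)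

lemma idm_tens [simp]: "idm X \<star> idm Y = idm (X @ Y)"
  using tens_id[of X Y] by simp

lemma idm_idm_tens [simp]: "arr f \<Longrightarrow> idm X \<star> idm Y \<star> f = idm (X @ Y) \<star> f"
  using tens_assoc'[of "idm X" "idm Y" f] by simp

lemma unit_tens [simp]: "arr f \<Longrightarrow> idm [] \<star> f = f"
  using tens_unit_left[of "src f" "tgt f" f] by (simp add: in_Hom_iff)

lemma tens_unit [simp]: "arr f \<Longrightarrow> f \<star> idm [] = f"
  using tens_unit_right[of "src f" "tgt f" f] by (simp add: in_Hom_iff)

lemma interchange':
  "arr g \<Longrightarrow> arr f \<Longrightarrow> arr g' \<Longrightarrow> arr f' \<Longrightarrow> src g = tgt f \<Longrightarrow> src g' = tgt f' \<Longrightarrow>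
    (g \<star> g') \<cdot> (f \<star> f') = (g \<cdot> f) \<star> (g' \<cdot> f')"
  by (rule interchange[of "src f" "src g" "tgt g" "src f'" "src g'" "tgt g'", symmetric])
    (simp_all add: in_Hom_iff)

text \<open>
  A layer is a morphism with identity strands on both sides.  Every diagram is a composite of layers,
  and the only laws that are left are functoriality of adding strands and the exchange of two layers
  that act on disjoint strands.
\<close>

definition lay where "lay W f Z = idm W \<star> f \<star> idm Z"

lemma ty_lay [simp]:
  assumes "arr f"
  shows "arr (lay W f Z)" "src (lay W f Z) = W @ src f @ Z" "tgt (lay W f Z) = W @ tgt f @ Z"
  using assms by (simp_all add: lay_def)

lemma lay_idm [simp]: "lay W (idm X) Z = idm (W @ X @ Z)"
  by (simp add: lay_def)

lemma lay_unit [simp]: "arr f \<Longrightarrow> lay [] f [] = f"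
  by (simp add: lay_def)

lemma lay_lay [simp]: "arr f \<Longrightarrow> lay W (lay W' f Z') Z = lay (W @ W') f (Z' @ Z)"
  by (simp add: lay_def)

lemma lay_comp [simp]:
  "arr g \<Longrightarrow> arr f \<Longrightarrow> src g = tgt f \<Longrightarrow> lay W (g \<cdot> f) Z = lay W g Z \<cdot> lay W f Z"
  unfolding lay_def by (simp add: interchange')

lemma tens_lay: "arr f \<Longrightarrow> arr g \<Longrightarrow> f \<star> g = lay [] f (tgt g) \<cdot> lay (src f) g []"
  unfolding lay_def by (simp add: interchange')

lemma lay_left: "arr f \<Longrightarrow> lay [] f Z = f \<star> idm Z"
  and lay_right: "arr f \<Longrightarrow> lay W f [] = idm W \<star> f"
  by (simp_all add: lay_def)

lemma exchange:
  assumes "arr f" "arr g"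
  shows "lay W f (A @ tgt g @ Z) \<cdot> lay (W @ src f @ A) g Z
       = lay (W @ tgt f @ A) g Z \<cdot> lay W f (A @ src g @ Z)"
proof -
  have "lay W f (A @ tgt g @ Z) \<cdot> lay (W @ src f @ A) g Z
     = (idm W \<star> f \<star> idm (A @ tgt g @ Z)) \<cdot> (idm W \<star> idm (src f) \<star> (idm A \<star> g \<star> idm Z))"
    using assms by (simp add: lay_def)
  also have "\<dots> = idm W \<star> f \<star> idm A \<star> g \<star> idm Z"
    using assms by (simp add: interchange' del: idm_tens idm_idm_tens)
  also have "\<dots> = (idm W \<star> idm (tgt f) \<star> (idm A \<star> g \<star> idm Z)) \<cdot> (idm W \<star> f \<star> idm (A @ src g @ Z))"
    using assms by (simp add: interchange' del: idm_tens idm_idm_tens)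
  also have "\<dots> = lay (W @ tgt f @ A) g Z \<cdot> lay W f (A @ src g @ Z)"
    using assms by (simp add: lay_def)
  finally show ?thesis .
qed


subsection \<open>Sums of morphisms\<close>

abbreviation homs where "homs X Y \<equiv> hom_module \<C> X Y"

lemma homs_sel [simp]:
  "carrier (homs X Y) = Hom \<C> X Y" "add (homs X Y) = HPlus \<C>" "zero (homs X Y) = zerom X Y"
  "smult (homs X Y) = HScale \<C>"
  by (simp_all add: hom_module_def)

lemma abelian_homs: "abelian_group (homs X Y)"
  using hom_module_presented by (rule module.axioms)

lemma comm_monoid_homs: "abelian_monoid (homs X Y)"
  using abelian_homs by (rule abelian_group.axioms)

lemma hsum_Hom:
  "(\<And>a. a \<in> A \<Longrightarrow> f a \<in> Hom \<C> X Y) \<Longrightarrow> hsum X Y f A \<in> Hom \<C> X Y"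
  using abelian_monoid.finsum_closed[OF comm_monoid_homs, of f A X Y] by auto

lemma ty_hsum [simp]:
  assumes "\<And>a. a \<in> A \<Longrightarrow> arr (f a)" "\<And>a. a \<in> A \<Longrightarrow> src (f a) = X" "\<And>a. a \<in> A \<Longrightarrow> tgt (f a) = Y"
  shows "arr (hsum X Y f A)" "src (hsum X Y f A) = X" "tgt (hsum X Y f A) = Y"
  using hsum_Hom[of A f X Y] assms by (simp_all add: in_Hom_iff)

lemma hsum_empty [simp]: "hsum X Y f {} = zerom X Y"
  using abelian_monoid.finsum_empty[OF comm_monoid_homs] by simp

lemma hsum_insert:
  assumes "finite A" "a \<notin> A" "\<And>b. b \<in> insert a A \<Longrightarrow> f b \<in> Hom \<C> X Y"
  shows "hsum X Y f (insert a A) = f a \<oplus>\<oplus> hsum X Y f A"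
  using abelian_monoid.finsum_insert[OF comm_monoid_homs, of A a f X Y] assms by auto

lemma hsum_cong:
  assumes "A = B" "\<And>b. b \<in> B \<Longrightarrow> f b = g b" "\<And>b. b \<in> B \<Longrightarrow> g b \<in> Hom \<C> X Y"
  shows "hsum X Y f A = hsum X Y g B"
  using abelian_monoid.finsum_cong'[OF comm_monoid_homs, of A B g X Y f] assms by auto

lemma zerom_plus [simp]: "arr f \<Longrightarrow> src f = X \<Longrightarrow> tgt f = Y \<Longrightarrow> zerom X Y \<oplus>\<oplus> f = f"
  using abelian_monoid.l_zero[OF comm_monoid_homs, of f X Y] by (simp add: in_Hom_iff)

lemma plus_zerom [simp]: "arr f \<Longrightarrow> src f = X \<Longrightarrow> tgt f = Y \<Longrightarrow> f \<oplus>\<oplus> zerom X Y = f"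
  using abelian_monoid.r_zero[OF comm_monoid_homs, of f X Y] by (simp add: in_Hom_iff)

text \<open>
  The congruence contains no axiom about zero morphisms in compositions and tensor products; such
  laws follow from additivity, since zero is the only solution of \<open>u + u = u\<close>.
\<close>

lemma plus_idem_zerom:
  assumes "u \<in> Hom \<C> X Y" "u \<oplus>\<oplus> u = u" shows "u = zerom X Y"
proof -
  interpret H: abelian_group "homs X Y" by (rule abelian_homs)
  show ?thesis using H.add.l_cancel_one'[of u u] assms by simp
qed

lemma comp_plus [simp]:
  assumes "arr g" "arr g'" "src g' = src g" "tgt g' = tgt g" "arr f" "tgt f = src g"
  shows "(g \<oplus>\<oplus> g') \<cdot> f = g \<cdot> f \<oplus>\<oplus> g' \<cdot> f"
  by (rule comp_plus_left[of "src f" "src g" "tgt g"]) (use assms in \<open>simp_all add: in_Hom_iff\<close>)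

lemma plus_comp [simp]:
  assumes "arr f" "arr f'" "src f' = src f" "tgt f' = tgt f" "arr g" "tgt f = src g"
  shows "g \<cdot> (f \<oplus>\<oplus> f') = g \<cdot> f \<oplus>\<oplus> g \<cdot> f'"
  by (rule comp_plus_right[of "src f" "src g" "tgt g"]) (use assms in \<open>simp_all add: in_Hom_iff\<close>)

lemma comp_zerom [simp]:
  assumes "arr g" "src g = Y" shows "g \<cdot> zerom X Y = zerom X (tgt g)"
  by (rule plus_idem_zerom) (use assms plus_comp[of "zerom X Y" "zerom X Y" g] in \<open>simp_all add: in_Hom_iff\<close>)

lemma zerom_comp [simp]:
  assumes "arr f" "tgt f = Y" shows "zerom Y Z \<cdot> f = zerom (src f) Z"
  by (rule plus_idem_zerom) (use assms comp_plus[of "zerom Y Z" "zerom Y Z" f] in \<open>simp_all add: in_Hom_iff\<close>)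

lemma comp_scale [simp]:
  assumes "arr g" "arr f" "src g = tgt f" "a \<in> carrier R"
  shows "HScale \<C> a g \<cdot> f = HScale \<C> a (g \<cdot> f)" "g \<cdot> HScale \<C> a f = HScale \<C> a (g \<cdot> f)"
  using assms comp_scale_left[of "src f" "src g" "tgt g" a g f]
    comp_scale_right[of "src f" "src g" "tgt g" a g f] by (simp_all add: in_Hom_iff)

lemma lay_plus [simp]:
  assumes "arr f" "arr g" "src g = src f" "tgt g = tgt f"
  shows "lay W (f \<oplus>\<oplus> g) Z = lay W f Z \<oplus>\<oplus> lay W g Z"
proof -
  have "(f \<oplus>\<oplus> g) \<star> idm Z = f \<star> idm Z \<oplus>\<oplus> g \<star> idm Z"
    using assms tens_plus_left[of "src f" "tgt f" Z Z f g "idm Z"] by (simp add: in_Hom_iff)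
  then show ?thesis unfolding lay_def
    using assms tens_plus_right[of W W "src f @ Z" "tgt f @ Z" "idm W" "f \<star> idm Z" "g \<star> idm Z"]
    by (simp add: in_Hom_iff)
qed

lemma lay_zerom [simp]: "lay W (zerom X Y) Z = zerom (W @ X @ Z) (W @ Y @ Z)"
  by (rule plus_idem_zerom) (use lay_plus[of "zerom X Y" "zerom X Y" W Z] in \<open>simp_all add: in_Hom_iff\<close>)

lemma comp_hsum:
  assumes "finite A" "\<And>a. a \<in> A \<Longrightarrow> arr (f a)" "\<And>a. a \<in> A \<Longrightarrow> src (f a) = X"
    "\<And>a. a \<in> A \<Longrightarrow> tgt (f a) = Y" "arr g" "src g = Y"
  shows "g \<cdot> hsum X Y f A = hsum X (tgt g) (\<lambda>a. g \<cdot> f a) A"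
  using assms
proof (induction A rule: finite_induct)
  case (insert a A)
  have "hsum X Y f (insert a A) = f a \<oplus>\<oplus> hsum X Y f A"
    by (rule hsum_insert) (use insert in \<open>auto simp: in_Hom_iff\<close>)
  moreover have "hsum X (tgt g) (\<lambda>a. g \<cdot> f a) (insert a A) = g \<cdot> f a \<oplus>\<oplus> hsum X (tgt g) (\<lambda>a. g \<cdot> f a) A"
    by (rule hsum_insert) (use insert in \<open>auto simp: in_Hom_iff\<close>)
  ultimately show ?case using insert by simp
qed simp

lemma hsum_comp:
  assumes "finite A" "\<And>a. a \<in> A \<Longrightarrow> arr (f a)" "\<And>a. a \<in> A \<Longrightarrow> src (f a) = X"
    "\<And>a. a \<in> A \<Longrightarrow> tgt (f a) = Y" "arr g" "tgt g = X"
  shows "hsum X Y f A \<cdot> g = hsum (src g) Y (\<lambda>a. f a \<cdot> g) A"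
  using assms
proof (induction A rule: finite_induct)
  case (insert a A)
  have "hsum X Y f (insert a A) = f a \<oplus>\<oplus> hsum X Y f A"
    by (rule hsum_insert) (use insert in \<open>auto simp: in_Hom_iff\<close>)
  moreover have "hsum (src g) Y (\<lambda>a. f a \<cdot> g) (insert a A) = f a \<cdot> g \<oplus>\<oplus> hsum (src g) Y (\<lambda>a. f a \<cdot> g) A"
    by (rule hsum_insert) (use insert in \<open>auto simp: in_Hom_iff\<close>)
  ultimately show ?case using insert by simp
qed simp

lemma lay_hsum:
  assumes "finite A" "\<And>a. a \<in> A \<Longrightarrow> arr (f a)" "\<And>a. a \<in> A \<Longrightarrow> src (f a) = X"
    "\<And>a. a \<in> A \<Longrightarrow> tgt (f a) = Y"
  shows "lay W (hsum X Y f A) Z = hsum (W @ X @ Z) (W @ Y @ Z) (\<lambda>a. lay W (f a) Z) A"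
  using assms
proof (induction A rule: finite_induct)
  case (insert a A)
  have "hsum X Y f (insert a A) = f a \<oplus>\<oplus> hsum X Y f A"
    by (rule hsum_insert) (use insert in \<open>auto simp: in_Hom_iff\<close>)
  moreover have "hsum (W @ X @ Z) (W @ Y @ Z) (\<lambda>a. lay W (f a) Z) (insert a A) = lay W (f a) Z \<oplus>\<oplus> hsum (W @ X @ Z) (W @ Y @ Z) (\<lambda>a. lay W (f a) Z) A"
    by (rule hsum_insert) (use insert in \<open>auto simp: in_Hom_iff\<close>)
  ultimately show ?case using insert by simp
qed simp

lemma hsum_zero: "hsum X Y (\<lambda>a. zerom X Y) A = zerom X Y"
proof -
  interpret H: abelian_group "homs X Y" by (rule abelian_homs)
  show ?thesis using H.finsum_zero[of A] by simp
qed

lemma hsum_restrict: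
  assumes "finite A" "B \<subseteq> A" "\<And>a. a \<in> B \<Longrightarrow> f a \<in> Hom \<C> X Y" "\<And>a. a \<in> A - B \<Longrightarrow> f a = zerom X Y"
  shows "hsum X Y f A = hsum X Y f B"
proof -
  interpret H: abelian_group "homs X Y" by (rule abelian_homs)
  have "f a \<in> Hom \<C> X Y" if "a \<in> A" for a using assms(3,4) that zerom_Hom by (cases "a \<in> B") auto
  then show ?thesis using H.add.finprod_mono_neutral_cong_right[of A B f f] assms by auto
qed

lemma hsum_single:
  assumes "finite A" "j \<in> A" "f j \<in> Hom \<C> X Y" "\<And>a. a \<in> A \<Longrightarrow> a \<noteq> j \<Longrightarrow> f a = zerom X Y"
  shows "hsum X Y f A = f j"
proof -
  have "hsum X Y f A = hsum X Y f {j}" by (rule hsum_restrict) (use assms in auto)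
  also have "\<dots> = f j" using hsum_insert[of "{}" j f X Y] assms(3) by (simp add: in_Hom_iff)
  finally show ?thesis .
qed

lemma hsum_reindex:
  assumes "inj_on h A" "\<And>a. a \<in> A \<Longrightarrow> f (h a) \<in> Hom \<C> X Y"
  shows "hsum X Y f (h ` A) = hsum X Y (\<lambda>a. f (h a)) A"
proof -
  interpret H: abelian_group "homs X Y" by (rule abelian_homs)
  show ?thesis using H.finsum_reindex[of f h A] assms by auto
qed

text \<open>
  A sum of terms is formed along an arbitrary enumeration of its index set; its class is the
  corresponding finite sum in the hom-module and hence does not depend on the enumeration.
\<close>

lemma mor_msum:
  assumes "finite A" "\<And>a. a \<in> A \<Longrightarrow> mor (f a) \<in> Hom \<C> X Y"
  shows "mor (msum X Y f A) = hsum X Y (\<lambda>a. mor (f a)) A"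
proof -
  define bs where "bs = (SOME bs. distinct bs \<and> set bs = A)"
  have bs: "distinct bs" "set bs = A"
    using someI_ex[of "\<lambda>bs. distinct bs \<and> set bs = A"] finite_distinct_list[OF assms(1)]
    by (auto simp: bs_def)
  have "mor (foldr (\<lambda>b. Add (f b)) cs (Zer X Y)) = hsum X Y (\<lambda>a. mor (f a)) (set cs)"
    if "distinct cs" "set cs \<subseteq> A" for cs
    using that
  proof (induction cs)
    case (Cons a cs)
    have "hsum X Y (\<lambda>a. mor (f a)) (insert a (set cs)) = mor (f a) \<oplus>\<oplus> hsum X Y (\<lambda>a. mor (f a)) (set cs)"
      by (rule hsum_insert) (use Cons.prems assms(2) in auto)
    then show ?case using Cons by simp
  qed simp
  from this[of bs] show ?thesis using bs by (simp add: msum_def bs_def[symmetric])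
qed

lemma mor_msum_eq:
  assumes "finite A" "\<And>a. a \<in> A \<Longrightarrow> mor (f a) = g a" "\<And>a. a \<in> A \<Longrightarrow> g a \<in> Hom \<C> X Y"
  shows "mor (msum X Y f A) = hsum X Y g A"
  using mor_msum[of A f X Y] hsum_cong[of A A "\<lambda>a. mor (f a)" g X Y] assms by simp

lemma mor_Sub: "mor (Sub R f g) = mor f \<oplus>\<oplus> HScale \<C> (\<ominus>\<^bsub>R\<^esub> \<one>\<^bsub>R\<^esub>) (mor g)"
  by (simp add: Sub_def)

end

section \<open>Functors between presented categories\<close>

primrec msubst :: "('g \<Rightarrow> ('k, 'o, 'h) mterm) \<Rightarrow> ('k, 'o, 'g) mterm \<Rightarrow> ('k, 'o, 'h) mterm" where
  "msubst \<sigma> (Gen g) = \<sigma> g"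
| "msubst \<sigma> (Idt X) = Idt X"
| "msubst \<sigma> (g \<bullet> f) = msubst \<sigma> g \<bullet> msubst \<sigma> f"
| "msubst \<sigma> (f \<boxtimes> g) = msubst \<sigma> f \<boxtimes> msubst \<sigma> g"
| "msubst \<sigma> (Zer X Y) = Zer X Y"
| "msubst \<sigma> (Add f g) = Add (msubst \<sigma> f) (msubst \<sigma> g)"
| "msubst \<sigma> (Scl c f) = Scl c (msubst \<sigma> f)"

lemma msubst_msum [simp]: "msubst \<sigma> (msum X Y f A) = msum X Y (\<lambda>a. msubst \<sigma> (f a)) A"
proof -
  have "msubst \<sigma> (foldr (\<lambda>b. Add (f b)) bs (Zer X Y)) = foldr (\<lambda>b. Add (msubst \<sigma> (f b))) bs (Zer X Y)" for bs
    by (induction bs) simp_all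
  then show ?thesis by (simp add: msum_def)
qed

lemma msubst_mpow [simp]: "msubst \<sigma> (mpow e x r) = mpow (msubst \<sigma> e) (msubst \<sigma> x) r"
  by (induction r) (simp_all add: mpow_def)

text \<open>
  The universal property of a presentation: a substitution of terms for the generators that keeps
  types and turns relations into equations extends to a strict linear monoidal functor, which is
  the identity on objects.
\<close>

locale presentation_map = C: presented R P + D: presented R Q
  for R :: "('k, 'r) ring_scheme" and P :: "('k, 'o, 'g) presentation"
    and Q :: "('k, 'o, 'h) presentation" +
  fixes \<sigma> :: "'g \<Rightarrow> ('k, 'o, 'h) mterm"
  assumes gen_typed: "a \<in> gens P \<Longrightarrow> typed R Q (source P a) (target P a) (\<sigma> a)"
    and rel_respected: "(f, g) \<in> rels P \<Longrightarrow> typed R P X Y f \<Longrightarrow> typed R P X Y g \<Longrightarrow>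
      D.mor (msubst \<sigma> f) = D.mor (msubst \<sigma> g)"
begin

lemma msubst_typed: "typed R P X Y f \<Longrightarrow> typed R Q X Y (msubst \<sigma> f)"
  by (induction rule: typed.induct) (auto intro: typed.intros gen_typed)

lemma msubst_eqv: "eqv R P X Y f g \<Longrightarrow> eqv R Q X Y (msubst \<sigma> f) (msubst \<sigma> g)"
proof (induction rule: eqv.induct)
  case (rel f g X Y)
  then show ?case using rel_respected msubst_typed D.eqv_iff_mor by blast
next
  case (sym X Y f g)
  show ?case by (rule eqv.sym) (rule sym.IH)
next
  case (trans X Y f g h)
  show ?case by (rule eqv.trans) (rule trans.IH)+
qed ((simp only: msubst.simps)?, (rule eqv.refl eqv.cong_cmp eqv.cong_ten eqv.cong_add eqv.cong_scl
    eqv.id_cmp eqv.cmp_id eqv.cmp_assoc eqv.ten_id eqv.ten_cmp eqv.unit_ten eqv.ten_unit eqv.ten_assoc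
    eqv.add_assoc eqv.add_comm eqv.add_zer eqv.add_neg eqv.scl_one eqv.scl_mult eqv.scl_add_left
    eqv.scl_add_right eqv.cmp_add_left eqv.cmp_add_right eqv.cmp_scl_left eqv.cmp_scl_right
    eqv.ten_add_left eqv.ten_add_right eqv.ten_scl_left eqv.ten_scl_right;
    (assumption | erule msubst_typed)))+

text \<open>
  The union runs over all representatives of the class \<open>u\<close>; they have the same image because the
  substitution respects the congruence.
\<close>

definition induced :: "('k, 'o, 'g) mterm set \<Rightarrow> ('k, 'o, 'h) mterm set" where
  "induced u = (\<Union>t\<in>u. D.mor (msubst \<sigma> t))"

lemma induced_mor:
  assumes "typed R P X Y f" shows "induced (C.mor f) = D.mor (msubst \<sigma> f)"
proof -
  have "D.mor (msubst \<sigma> g) = D.mor (msubst \<sigma> f)" if "g \<in> C.mor f" for g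
  proof -
    from that obtain X Y where "eqv R P X Y f g" unfolding C.mor_def by blast
    then show ?thesis using msubst_eqv D.eqv_iff_mor by metis
  qed
  then show ?thesis unfolding induced_def using C.mor_self[OF assms] by blast
qed

lemma functor_induced: "strict_lin_mon_functor R C.\<C> D.\<C> id induced"
proof (unfold_locales)
  fix X Y :: "'o list" and u assume "u \<in> Hom C.\<C> X Y"
  then obtain f where f: "typed R P X Y f" "u = C.mor f" by (elim C.Hom_morE)
  then show "induced u \<in> Hom D.\<C> (id X) (id Y)"
    by (simp add: induced_mor[OF f(1)] D.mor_in_Hom msubst_typed)
next
  fix X :: "'o list"
  show "induced (Ident C.\<C> X) = Ident D.\<C> (id X)"
    using induced_mor[OF typed.idt[of R P X]] by simp
next
  fix X Y Z :: "'o list" and v u assume "v \<in> Hom C.\<C> Y Z" "u \<in> Hom C.\<C> X Y"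
  then obtain f g where f: "typed R P X Y f" "u = C.mor f" and g: "typed R P Y Z g" "v = C.mor g"
    by (elim C.Hom_morE)
  show "induced (Comp C.\<C> v u) = Comp D.\<C> (induced v) (induced u)"
    using induced_mor[OF typed.cmp[OF g(1) f(1)]] f g by (simp add: induced_mor[OF f(1)] induced_mor[OF g(1)])
next
  fix X Y X' Y' :: "'o list" and v u assume "u \<in> Hom C.\<C> X Y" "v \<in> Hom C.\<C> X' Y'"
  then obtain f g where f: "typed R P X Y f" "u = C.mor f" and g: "typed R P X' Y' g" "v = C.mor g"
    by (elim C.Hom_morE)
  show "induced (Tens C.\<C> u v) = Tens D.\<C> (induced u) (induced v)"
    using induced_mor[OF typed.ten[OF f(1) g(1)]] f g by (simp add: induced_mor[OF f(1)] induced_mor[OF g(1)])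
next
  fix X Y :: "'o list" and v u assume "u \<in> Hom C.\<C> X Y" "v \<in> Hom C.\<C> X Y"
  then obtain f g where f: "typed R P X Y f" "u = C.mor f" and g: "typed R P X Y g" "v = C.mor g"
    by (elim C.Hom_morE)
  show "induced (HPlus C.\<C> u v) = HPlus D.\<C> (induced u) (induced v)"
    using induced_mor[OF typed.add[OF f(1) g(1)]] f g by (simp add: induced_mor[OF f(1)] induced_mor[OF g(1)])
next
  fix X Y :: "'o list" and c u assume c: "c \<in> carrier R" and "u \<in> Hom C.\<C> X Y"
  then obtain f where f: "typed R P X Y f" "u = C.mor f" by (elim C.Hom_morE)
  show "induced (HScale C.\<C> c u) = HScale D.\<C> c (induced u)"
    using induced_mor[OF typed.scl[OF c f(1)]] f by (simp add: induced_mor[OF f(1)])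
qed simp_all

end

text \<open>
  Two functors that are given on generators are mutually inverse as soon as their composites fix
  the generators, by induction on terms.
\<close>

theorem presentations_isomorphic:
  assumes "presentation_map R P Q \<sigma>" and "presentation_map R Q P \<tau>"
    and inv: "\<And>g. g \<in> gens P \<Longrightarrow> presented.mor R P (msubst \<tau> (\<sigma> g)) = presented.mor R P (Gen g)"
      "\<And>g. g \<in> gens Q \<Longrightarrow> presented.mor R Q (msubst \<sigma> (\<tau> g)) = presented.mor R Q (Gen g)"
  shows "lin_mon_cat_isomorphic R (presented_cat R P) (presented_cat R Q)"
proof -
  interpret S: presentation_map R P Q \<sigma> by fact
  interpret T: presentation_map R Q P \<tau> by fact
  have 1: "S.C.mor (msubst \<tau> (msubst \<sigma> f)) = S.C.mor f" if "typed R P X Y f" for X Y f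
    using that by (induction rule: typed.induct) (simp_all add: inv)
  have 2: "S.D.mor (msubst \<sigma> (msubst \<tau> f)) = S.D.mor f" if "typed R Q X Y f" for X Y f
    using that by (induction rule: typed.induct) (simp_all add: inv)
  have "bij_betw S.induced (Hom S.C.\<C> X Y) (Hom S.D.\<C> X Y)" for X Y
  proof (rule bij_betw_byWitness[where f' = T.induced])
    have "T.induced (S.induced (S.C.mor f)) = S.C.mor f" if f: "typed R P X Y f" for f
      by (simp only: S.induced_mor[OF f] T.induced_mor[OF S.msubst_typed[OF f]] 1[OF f])
    then show "\<forall>u\<in>Hom S.C.\<C> X Y. T.induced (S.induced u) = u" by (auto simp: S.C.Hom_mor)
    have "S.induced (T.induced (S.D.mor f)) = S.D.mor f" if f: "typed R Q X Y f" for f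
      by (simp only: T.induced_mor[OF f] S.induced_mor[OF T.msubst_typed[OF f]] 2[OF f])
    then show "\<forall>u\<in>Hom S.D.\<C> X Y. S.induced (T.induced u) = u" by (auto simp: S.D.Hom_mor)
    have "S.induced (S.C.mor f) \<in> Hom S.D.\<C> X Y" if f: "typed R P X Y f" for f
      by (simp only: S.induced_mor[OF f] S.D.mor_in_Hom S.msubst_typed[OF f])
    then show "S.induced ` Hom S.C.\<C> X Y \<subseteq> Hom S.D.\<C> X Y" by (auto simp: S.C.Hom_mor)
    have "T.induced (S.D.mor f) \<in> Hom S.C.\<C> X Y" if f: "typed R Q X Y f" for f
      by (simp only: T.induced_mor[OF f] S.C.mor_in_Hom T.msubst_typed[OF f])
    then show "T.induced ` Hom S.D.\<C> X Y \<subseteq> Hom S.C.\<C> X Y" by (auto simp: S.D.Hom_mor)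
  qed
  then show ?thesis unfolding lin_mon_cat_isomorphic_def
    using S.functor_induced by (intro exI[of _ id] exI[of _ S.induced]) simp
qed

abbreviation "UU \<equiv> [Up, Up]"
abbreviation "UD \<equiv> [Up, Down]"
abbreviation "DU \<equiv> [Down, Up]"

section \<open>Faithful families and blocks of inverse matrices\<close>

context presented
begin

text \<open>
  Composites are kept associated to the right; this turns a rule for two consecutive factors into a
  rule that also applies when further factors follow.
\<close>

lemma comp_trail: "a \<cdot> b = u \<Longrightarrow> a \<cdot> b \<cdot> r = u \<cdot> r"
  by (metis comp_assoc_total)

text \<open>
  The exchange law in two forms that work as rewrite rules: the strands between the two layers are
  computed from the words that occur on the left-hand side.
\<close>

lemma exchange_right:
  assumes "arr f" "arr g" "take (length W + length (tgt g)) V = W @ tgt g"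
    "Z = drop (length W + length (tgt g)) V @ src f @ T"
  shows "lay V f T \<cdot> lay W g Z
    = lay W g (drop (length W + length (tgt g)) V @ tgt f @ T)
      \<cdot> lay (W @ src g @ drop (length W + length (tgt g)) V) f T"
proof -
  define A where "A = drop (length W + length (tgt g)) V"
  have V: "V = W @ tgt g @ A" using append_take_drop_id[of "length W + length (tgt g)" V] assms(3)
    by (simp add: A_def)
  show ?thesis unfolding A_def[symmetric] assms(4) using exchange[OF assms(2,1), of W A T] V by simp
qed

lemma exchange_left:
  assumes "arr f" "arr g" "take (length W + length (src f)) V = W @ src f"
    "Z = drop (length W + length (src f)) V @ tgt g @ T"
  shows "lay W f Z \<cdot> lay V g T
    = lay (W @ tgt f @ drop (length W + length (src f)) V) g T
      \<cdot> lay W f (drop (length W + length (src f)) V @ src g @ T)"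
proof -
  define A where "A = drop (length W + length (src f)) V"
  have V: "V = W @ src f @ A" using append_take_drop_id[of "length W + length (src f)" V] assms(3)
    by (simp add: A_def)
  show ?thesis unfolding A_def[symmetric] assms(4) using exchange[OF assms(1,2), of W A T] V by simp
qed

text \<open>
  Morphisms are determined by their components: \<open>u = u (\<Sum> p\<^sub>i) = \<Sum> u p\<^sub>i\<close>.  By this principle the
  coloured components of a relation imply the relation.
\<close>

lemma jointly_faithful:
  assumes fin: "finite N" and p: "\<And>i. i \<in> N \<Longrightarrow> p i \<in> Hom \<C> X X" "hsum X X p N = idm X"
    and u: "u \<in> Hom \<C> (W @ X @ Z) Y" and v: "v \<in> Hom \<C> (W @ X @ Z) Y"
    and eq: "\<And>i. i \<in> N \<Longrightarrow> u \<cdot> lay W (p i) Z = v \<cdot> lay W (p i) Z"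
  shows "u = v"
proof -
  have *: "w = hsum (W @ X @ Z) Y (\<lambda>i. w \<cdot> lay W (p i) Z) N" if w: "w \<in> Hom \<C> (W @ X @ Z) Y" for w
  proof -
    have "w = w \<cdot> lay W (hsum X X p N) Z" using w p(2) by (simp add: in_Hom_iff)
    also have "\<dots> = hsum (W @ X @ Z) Y (\<lambda>i. w \<cdot> lay W (p i) Z) N"
      using fin p(1) w by (simp add: lay_hsum comp_hsum in_Hom_iff)
    finally show ?thesis .
  qed
  have "hsum (W @ X @ Z) Y (\<lambda>i. u \<cdot> lay W (p i) Z) N = hsum (W @ X @ Z) Y (\<lambda>i. v \<cdot> lay W (p i) Z) N"
    by (rule hsum_cong) (use eq p(1) v in \<open>auto simp: in_Hom_iff\<close>)
  then show ?thesis using *[OF u] *[OF v] by simp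
qed

lemma tens_zerom [simp]:
  "arr g \<Longrightarrow> zerom X Y \<star> g = zerom (X @ src g) (Y @ tgt g)"
  "arr g \<Longrightarrow> g \<star> zerom X Y = zerom (src g @ X) (tgt g @ Y)"
  by (simp_all add: tens_lay)

text \<open>
  The operation on morphisms that corresponds to \<open>mpow\<close> on terms.
\<close>

definition mpw where "mpw u f r = ((\<lambda>g. f \<cdot> g) ^^ r) u"

lemma mpw_simps [simp]: "mpw u f 0 = u" "mpw u f (Suc r) = f \<cdot> mpw u f r"
  by (simp_all add: mpw_def)

lemma mor_mpow [simp]: "mor (mpow e x r) = mpw (mor e) (mor x) r"
  by (induction r) (simp_all add: mpow_def mpw_def)

text \<open>
  The equations of the inversion relations: the column \<open>(t, dv)\<close>, a morphism from \<open>(X, E)\<close> to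
  \<open>(Y, G) \<oplus> \<one>\<^bsup>I\<^esup>\<close>, has the inverse row \<open>(T, U)\<close>.  Exchanging the two matrices describes a row
  with an inverse column, so that both signs of the central charge are covered.
\<close>

definition inverse_pair where
  "inverse_pair X Y E t dv I T U G \<longleftrightarrow>
     T \<cdot> t \<oplus>\<oplus> hsum X X (\<lambda>p. U p \<cdot> dv p) I = E \<and> t \<cdot> T = G \<and>
     (\<forall>p\<in>I. t \<cdot> U p = zerom [] Y) \<and> (\<forall>p\<in>I. dv p \<cdot> T = zerom Y []) \<and>
     (\<forall>p\<in>I. \<forall>q\<in>I. dv p \<cdot> U q = (if p = q then idm [] else zerom [] []))"

lemma inverse_pair_reindex:
  assumes "inj_on h I" "\<And>p. p \<in> h ` I \<Longrightarrow> U p \<cdot> dv p \<in> Hom \<C> X X"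
  shows "inverse_pair X Y E t dv (h ` I) T U G \<longleftrightarrow> inverse_pair X Y E t (\<lambda>p. dv (h p)) I T (\<lambda>p. U (h p)) G"
proof -
  have "hsum X X (\<lambda>p. U p \<cdot> dv p) (h ` I) = hsum X X (\<lambda>p. U (h p) \<cdot> dv (h p)) I"
    by (rule hsum_reindex) (use assms in auto)
  moreover have "h p = h q \<longleftrightarrow> p = q" if "p \<in> I" "q \<in> I" for p q
    using assms(1) that by (auto simp: inj_on_def)
  ultimately show ?thesis unfolding inverse_pair_def by (simp cong: conj_cong ball_cong)
qed

lemma inverse_pair_cong:
  assumes "\<And>p. p \<in> I \<Longrightarrow> dv p = dv' p" "\<And>p. p \<in> I \<Longrightarrow> U p = U' p"
    "\<And>p. p \<in> I \<Longrightarrow> U' p \<cdot> dv' p \<in> Hom \<C> X X"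
  shows "inverse_pair X Y E t dv I T U G \<longleftrightarrow> inverse_pair X Y E t dv' I T U' G"
proof -
  have "hsum X X (\<lambda>p. U p \<cdot> dv p) I = hsum X X (\<lambda>p. U' p \<cdot> dv' p) I"
    by (rule hsum_cong) (use assms in auto)
  then show ?thesis using assms(1,2) unfolding inverse_pair_def by (simp cong: conj_cong ball_cong)
qed

text \<open>
  Inserting \<open>1 = T t + \<Sum> U dv\<close> moves an idempotent from one of two inverse matrices to the other,
  since the off-diagonal products \<open>t U\<close>, \<open>dv T\<close> vanish.
\<close>

lemma inverse_pair_idempotent_right:
  assumes I: "finite I" and t: "t \<in> Hom \<C> X Y" and T: "T \<in> Hom \<C> Y X"
    and U: "\<And>p. p \<in> I \<Longrightarrow> U p \<in> Hom \<C> [] X" and dv: "\<And>p. p \<in> I \<Longrightarrow> dv p \<in> Hom \<C> X []"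
    and E: "E \<in> Hom \<C> X X" and G: "G \<in> Hom \<C> Y Y" and tE: "t \<cdot> E = G \<cdot> t"
    and dvE: "\<And>p. p \<in> I \<Longrightarrow> dv p \<cdot> E = (if Q p then dv p else zerom X [])"
    and inv: "inverse_pair X Y (idm X) t dv I T U (idm Y)"
  shows "T \<cdot> G = E \<cdot> T" "p \<in> I \<Longrightarrow> E \<cdot> U p = (if Q p then U p else zerom [] X)"
proof -
  note [simp] = t[unfolded in_Hom_iff] T[unfolded in_Hom_iff] U[unfolded in_Hom_iff] dv[unfolded in_Hom_iff]
    E[unfolded in_Hom_iff] G[unfolded in_Hom_iff]
  have one: "T \<cdot> t \<oplus>\<oplus> hsum X X (\<lambda>p. U p \<cdot> dv p) I = idm X"
    and tT: "t \<cdot> T = idm Y" and tU: "\<And>p. p \<in> I \<Longrightarrow> t \<cdot> U p = zerom [] Y"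
    and dT: "\<And>p. p \<in> I \<Longrightarrow> dv p \<cdot> T = zerom Y []"
    and dU: "\<And>p q. p \<in> I \<Longrightarrow> q \<in> I \<Longrightarrow> dv p \<cdot> U q = (if p = q then idm [] else zerom [] [])"
    using inv by (auto simp: inverse_pair_def)
  have expand: "w = T \<cdot> t \<cdot> w \<oplus>\<oplus> hsum (src w) X (\<lambda>p. U p \<cdot> dv p \<cdot> w) I"
    if w: "arr w" "tgt w = X" for w
  proof -
    have "w = (T \<cdot> t \<oplus>\<oplus> hsum X X (\<lambda>p. U p \<cdot> dv p) I) \<cdot> w" using one w by simp
    then show ?thesis using w I by (simp add: hsum_comp)
  qed
  have tE': "t \<cdot> E \<cdot> w = G \<cdot> t \<cdot> w" for w
    using tE by (metis comp_assoc_total)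
  have dE: "dv p \<cdot> E \<cdot> w = (if Q p then dv p \<cdot> w else zerom (src w) [])"
    if "p \<in> I" "arr w" "tgt w = X" for p w
    using dvE[OF that(1), THEN arg_cong, of "\<lambda>u. u \<cdot> w"] that by (simp split: if_splits)
  have "hsum Y X (\<lambda>p. U p \<cdot> dv p \<cdot> E \<cdot> T) I = hsum Y X (\<lambda>p. zerom Y X) I"
    by (rule hsum_cong) (simp_all add: dE dT in_Hom_iff)
  then show "T \<cdot> G = E \<cdot> T"
    using expand[of "E \<cdot> T"] by (simp add: tE' tT hsum_zero)
  assume p: "p \<in> I"
  have "hsum [] X (\<lambda>q. U q \<cdot> dv q \<cdot> E \<cdot> U p) I = U p \<cdot> dv p \<cdot> E \<cdot> U p"
    by (rule hsum_single) (use p I in \<open>auto simp: dE dU in_Hom_iff\<close>)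
  then show "E \<cdot> U p = (if Q p then U p else zerom [] X)"
    using expand[of "E \<cdot> U p"] p by (simp add: tE' tU dE dU)
qed

lemma inverse_pair_idempotent_left:
  assumes I: "finite I" and t: "t \<in> Hom \<C> X Y" and T: "T \<in> Hom \<C> Y X"
    and U: "\<And>p. p \<in> I \<Longrightarrow> U p \<in> Hom \<C> [] X" and dv: "\<And>p. p \<in> I \<Longrightarrow> dv p \<in> Hom \<C> X []"
    and E: "E \<in> Hom \<C> X X" and G: "G \<in> Hom \<C> Y Y" and TG: "T \<cdot> G = E \<cdot> T"
    and EU: "\<And>p. p \<in> I \<Longrightarrow> E \<cdot> U p = (if Q p then U p else zerom [] X)"
    and inv: "inverse_pair X Y (idm X) t dv I T U (idm Y)"
  shows "t \<cdot> E = G \<cdot> t" "p \<in> I \<Longrightarrow> dv p \<cdot> E = (if Q p then dv p else zerom X [])"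
proof -
  note [simp] = t[unfolded in_Hom_iff] T[unfolded in_Hom_iff] U[unfolded in_Hom_iff] dv[unfolded in_Hom_iff]
    E[unfolded in_Hom_iff] G[unfolded in_Hom_iff]
  have one: "T \<cdot> t \<oplus>\<oplus> hsum X X (\<lambda>p. U p \<cdot> dv p) I = idm X"
    using inv by (auto simp: inverse_pair_def)
  have tT: "t \<cdot> T \<cdot> w = w" if "arr w" "tgt w = Y" for w
    using inv that comp_trail[of t T "idm Y" w] by (simp add: inverse_pair_def)
  have tU: "t \<cdot> U p \<cdot> w = zerom (src w) Y" if "p \<in> I" "arr w" "tgt w = []" for p w
    using inv that comp_trail[of t "U p" "zerom [] Y" w] by (simp add: inverse_pair_def)
  have dT: "dv p \<cdot> T \<cdot> w = zerom (src w) []" if "p \<in> I" "arr w" "tgt w = Y" for p w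
    using inv that comp_trail[of "dv p" T "zerom Y []" w] by (simp add: inverse_pair_def)
  have dU: "dv p \<cdot> U q \<cdot> w = (if p = q then w else zerom (src w) [])"
    if "p \<in> I" "q \<in> I" "arr w" "tgt w = []" for p q w
    using inv that comp_trail[of "dv p" "U q" "if p = q then idm [] else zerom [] []" w]
    by (simp add: inverse_pair_def split: if_splits)
  have expand: "w = w \<cdot> T \<cdot> t \<oplus>\<oplus> hsum X (tgt w) (\<lambda>p. w \<cdot> U p \<cdot> dv p) I"
    if w: "arr w" "src w = X" for w
  proof -
    have "w = w \<cdot> (T \<cdot> t \<oplus>\<oplus> hsum X X (\<lambda>p. U p \<cdot> dv p) I)" using one w by simp
    then show ?thesis using w I by (simp add: comp_hsum)
  qed
  have ET: "E \<cdot> T \<cdot> w = T \<cdot> G \<cdot> w" for w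
    using TG by (metis comp_assoc_total)
  have EU': "E \<cdot> U p \<cdot> w = (if Q p then U p \<cdot> w else zerom (src w) X)"
    if "p \<in> I" "arr w" "tgt w = []" for p w
    using EU[OF that(1), THEN arg_cong, of "\<lambda>u. u \<cdot> w"] that by (simp split: if_splits)
  have "hsum X Y (\<lambda>p. t \<cdot> E \<cdot> U p \<cdot> dv p) I = hsum X Y (\<lambda>p. zerom X Y) I"
    by (rule hsum_cong) (simp_all add: EU' tU in_Hom_iff)
  then show "t \<cdot> E = G \<cdot> t"
    using expand[of "t \<cdot> E"] by (simp add: ET tT hsum_zero)
  assume p: "p \<in> I"
  have "hsum X [] (\<lambda>q. dv p \<cdot> E \<cdot> U q \<cdot> dv q) I = dv p \<cdot> E \<cdot> U p \<cdot> dv p"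
    by (rule hsum_single) (use p I in \<open>auto simp: EU' dU in_Hom_iff\<close>)
  then show "dv p \<cdot> E = (if Q p then dv p else zerom X [])"
    using expand[of "dv p \<cdot> E"] p by (simp add: ET dT EU' dU)
qed

text \<open>
  Composing with the idempotents \<open>E \<kappa>\<close> and \<open>G \<kappa>\<close> splits every equation between the matrices into
  equations between their blocks, and joint faithfulness reassembles them; products of entries of
  different colours vanish.
\<close>

lemma inverse_pair_blocks:
  assumes I: "finite I" and t: "t \<in> Hom \<C> X Y" and T: "T \<in> Hom \<C> Y X"
    and U: "\<And>p. p \<in> I \<Longrightarrow> U p \<in> Hom \<C> [] X" and dv: "\<And>p. p \<in> I \<Longrightarrow> dv p \<in> Hom \<C> X []"
    and E: "\<And>\<kappa>. \<kappa> \<in> K \<Longrightarrow> E \<kappa> \<in> Hom \<C> X X" "\<And>\<kappa>. \<kappa> \<in> K \<Longrightarrow> E \<kappa> \<cdot> E \<kappa> = E \<kappa>"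
    and G: "\<And>\<kappa>. \<kappa> \<in> K \<Longrightarrow> G \<kappa> \<in> Hom \<C> Y Y" "\<And>\<kappa>. \<kappa> \<in> K \<Longrightarrow> G \<kappa> \<cdot> G \<kappa> = G \<kappa>"
    and E_faithful: "\<And>u v Z. u \<in> Hom \<C> X Z \<Longrightarrow> v \<in> Hom \<C> X Z \<Longrightarrow> (\<And>\<kappa>. \<kappa> \<in> K \<Longrightarrow> u \<cdot> E \<kappa> = v \<cdot> E \<kappa>) \<Longrightarrow> u = v"
    and G_faithful: "\<And>u v Z. u \<in> Hom \<C> Y Z \<Longrightarrow> v \<in> Hom \<C> Y Z \<Longrightarrow> (\<And>\<kappa>. \<kappa> \<in> K \<Longrightarrow> u \<cdot> G \<kappa> = v \<cdot> G \<kappa>) \<Longrightarrow> u = v"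
    and col: "\<And>p. p \<in> I \<Longrightarrow> col p \<in> K"
    and tE: "\<And>\<kappa>. \<kappa> \<in> K \<Longrightarrow> t \<cdot> E \<kappa> = G \<kappa> \<cdot> t" and TG: "\<And>\<kappa>. \<kappa> \<in> K \<Longrightarrow> T \<cdot> G \<kappa> = E \<kappa> \<cdot> T"
    and dvE: "\<And>p \<kappa>. p \<in> I \<Longrightarrow> \<kappa> \<in> K \<Longrightarrow> dv p \<cdot> E \<kappa> = (if col p = \<kappa> then dv p else zerom X [])"
    and EU: "\<And>p \<kappa>. p \<in> I \<Longrightarrow> \<kappa> \<in> K \<Longrightarrow> E \<kappa> \<cdot> U p = (if col p = \<kappa> then U p else zerom [] X)"
  shows "inverse_pair X Y (idm X) t dv I T U (idm Y) \<longleftrightarrow>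
    (\<forall>\<kappa>\<in>K. inverse_pair X Y (E \<kappa>) (t \<cdot> E \<kappa>) dv {p \<in> I. col p = \<kappa>} (T \<cdot> G \<kappa>) U (G \<kappa>))"
proof -
  note [simp] = t[unfolded in_Hom_iff] T[unfolded in_Hom_iff] U[unfolded in_Hom_iff] dv[unfolded in_Hom_iff]
    E(1)[unfolded in_Hom_iff] G(1)[unfolded in_Hom_iff]
  let ?S = "hsum X X (\<lambda>p. U p \<cdot> dv p) I"
  have one: "(T \<cdot> t \<oplus>\<oplus> ?S) \<cdot> E \<kappa> = (T \<cdot> G \<kappa>) \<cdot> t \<cdot> E \<kappa> \<oplus>\<oplus> hsum X X (\<lambda>p. U p \<cdot> dv p) {p \<in> I. col p = \<kappa>}"
    if \<kappa>: "\<kappa> \<in> K" for \<kappa>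
  proof -
    have "?S \<cdot> E \<kappa> = hsum X X (\<lambda>p. U p \<cdot> dv p \<cdot> E \<kappa>) I" using I \<kappa> by (simp add: hsum_comp)
    also have "\<dots> = hsum X X (\<lambda>p. U p \<cdot> dv p \<cdot> E \<kappa>) {p \<in> I. col p = \<kappa>}"
      by (rule hsum_restrict) (use I \<kappa> dvE in \<open>auto simp: in_Hom_iff\<close>)
    also have "\<dots> = hsum X X (\<lambda>p. U p \<cdot> dv p) {p \<in> I. col p = \<kappa>}"
      by (rule hsum_cong) (use \<kappa> dvE in \<open>auto simp: in_Hom_iff\<close>)
    finally have S: "?S \<cdot> E \<kappa> = \<dots>" .
    have "G \<kappa> \<cdot> t \<cdot> E \<kappa> = t \<cdot> E \<kappa>" using tE[OF \<kappa>] E(2)[OF \<kappa>] by (metis comp_assoc_total)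
    then show ?thesis using S \<kappa> by simp
  qed
  have two: "(t \<cdot> T) \<cdot> G \<kappa> = (t \<cdot> E \<kappa>) \<cdot> T \<cdot> G \<kappa>" if \<kappa>: "\<kappa> \<in> K" for \<kappa>
    using TG[OF \<kappa>] E(2)[OF \<kappa>] by (metis comp_assoc_total)
  have tU: "t \<cdot> U p = (t \<cdot> E (col p)) \<cdot> U p" if p: "p \<in> I" for p
    using EU[OF p col[OF p]] by simp
  have dT: "(dv p \<cdot> T) \<cdot> G \<kappa> = (if col p = \<kappa> then dv p \<cdot> T \<cdot> G \<kappa> else zerom Y [])"
    if p: "p \<in> I" and \<kappa>: "\<kappa> \<in> K" for p \<kappa>
  proof (cases "col p = \<kappa>")
    case False
    have "(dv p \<cdot> T) \<cdot> G \<kappa> = (dv p \<cdot> E \<kappa>) \<cdot> T" using TG[OF \<kappa>] by simp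
    then show ?thesis using False dvE[OF p \<kappa>] by (simp only: if_False) simp
  qed simp
  have dU: "dv p \<cdot> U q = zerom [] []" if "p \<in> I" "q \<in> I" "col p \<noteq> col q" for p q
  proof -
    have "dv p \<cdot> U q = (dv p \<cdot> E (col p)) \<cdot> U q" using dvE[OF that(1) col] that by simp
    also have "\<dots> = dv p \<cdot> E (col p) \<cdot> U q" by simp
    also have "E (col p) \<cdot> U q = zerom [] X" using EU[OF that(2) col] that by simp
    finally show ?thesis using that by simp
  qed
  show ?thesis
  proof (intro iffI ballI)
    fix \<kappa> assume inv: "inverse_pair X Y (idm X) t dv I T U (idm Y)" and \<kappa>: "\<kappa> \<in> K"
    show "inverse_pair X Y (E \<kappa>) (t \<cdot> E \<kappa>) dv {p \<in> I. col p = \<kappa>} (T \<cdot> G \<kappa>) U (G \<kappa>)"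
      unfolding inverse_pair_def
    proof (intro conjI ballI)
      show "(T \<cdot> G \<kappa>) \<cdot> t \<cdot> E \<kappa> \<oplus>\<oplus> hsum X X (\<lambda>p. U p \<cdot> dv p) {p \<in> I. col p = \<kappa>} = E \<kappa>"
        using one[OF \<kappa>] inv \<kappa> by (simp add: inverse_pair_def del: comp_plus)
      show "(t \<cdot> E \<kappa>) \<cdot> T \<cdot> G \<kappa> = G \<kappa>"
        using two[OF \<kappa>] inv \<kappa> by (simp add: inverse_pair_def del: comp_assoc_total)
    next
      fix p assume "p \<in> {p \<in> I. col p = \<kappa>}"
      then show "(t \<cdot> E \<kappa>) \<cdot> U p = zerom [] Y" using tU[of p] inv by (auto simp: inverse_pair_def)
    next
      fix p assume p: "p \<in> {p \<in> I. col p = \<kappa>}"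
      then have "(dv p \<cdot> T) \<cdot> G \<kappa> = zerom Y []" using inv \<kappa> by (simp add: inverse_pair_def del: comp_assoc_total)
      then show "dv p \<cdot> T \<cdot> G \<kappa> = zerom Y []" by simp
    qed (use inv in \<open>auto simp: inverse_pair_def\<close>)
  next
    assume inv: "\<forall>\<kappa>\<in>K. inverse_pair X Y (E \<kappa>) (t \<cdot> E \<kappa>) dv {p \<in> I. col p = \<kappa>} (T \<cdot> G \<kappa>) U (G \<kappa>)"
    show "inverse_pair X Y (idm X) t dv I T U (idm Y)"
      unfolding inverse_pair_def
    proof (intro conjI ballI)
      show "T \<cdot> t \<oplus>\<oplus> ?S = idm X"
        by (rule E_faithful[of _ X]) (use one inv in \<open>auto simp: inverse_pair_def in_Hom_iff simp del: comp_plus\<close>)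
      show "t \<cdot> T = idm Y"
        by (rule G_faithful[of _ Y]) (use two inv in \<open>auto simp: inverse_pair_def in_Hom_iff simp del: comp_assoc_total\<close>)
    next
      fix p assume "p \<in> I"
      then show "t \<cdot> U p = zerom [] Y" using tU[of p] col[of p] inv by (auto simp: inverse_pair_def)
    next
      fix p assume p: "p \<in> I"
      show "dv p \<cdot> T = zerom Y []"
        by (rule G_faithful[of _ "[]"]) (use p dT[OF p] inv in \<open>auto simp: inverse_pair_def in_Hom_iff simp del: comp_assoc_total\<close>)
    next
      fix p q assume pq: "p \<in> I" "q \<in> I"
      show "dv p \<cdot> U q = (if p = q then idm [] else zerom [] [])"
        using dU[OF pq] inv[THEN bspec, OF col[OF pq(1)]] pq by (cases "col p = col q") (auto simp: inverse_pair_def)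
    qed
  qed
qed

end

section \<open>Coloured strands\<close>

locale strands = presented R P
  for R :: "('k, 'r) ring_scheme" and P :: "('k, strand, 'g) presentation"
begin

text \<open>
  The operations on morphisms that correspond to the rotated crossing and to the zigzag of terms.
\<close>

definition rot where
  "rot s c d = (idm DU \<star> d) \<cdot> (idm [Down] \<star> s \<star> idm [Down]) \<cdot> (c \<star> idm UD)"

lemma mor_rotated: "arr (mor d) \<Longrightarrow> mor (rotated_crossing s c d) = rot (mor s) (mor c) (mor d)"
  by (simp add: rotated_crossing_def rot_def)

lemma rot_lay:
  "s \<in> Hom \<C> UU UU \<Longrightarrow> c \<in> Hom \<C> [] DU \<Longrightarrow> d \<in> Hom \<C> UD [] \<Longrightarrow>
    rot s c d = lay DU d [] \<cdot> lay [Down] s [Down] \<cdot> lay [] c UD"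
  by (simp add: rot_def tens_lay in_Hom_iff)

definition zz where "zz c d = (idm [Down] \<star> d) \<cdot> (c \<star> idm [Down])"

lemma mor_zigzag [simp]: "mor (down_zigzag c d) = zz (mor c) (mor d)"
  by (simp add: down_zigzag_def zz_def)

lemma zz_lay:
  "c \<in> Hom \<C> [] DU \<Longrightarrow> d \<in> Hom \<C> UD [] \<Longrightarrow>
    zz c d = lay [Down] d [] \<cdot> lay [] c [Down]"
  by (simp add: zz_def tens_lay in_Hom_iff)

abbreviation column_inv where
  "column_inv E t dv I T U G \<equiv> inverse_pair UD DU E t dv I T U G"

abbreviation row_inv where
  "row_inv E t cv I T U G \<equiv> inverse_pair DU UD G T U I t cv E"

lemma mor_column_inverse:
  assumes "finite I" "\<And>p. p \<in> I \<Longrightarrow> mor (u p) \<cdot> mor (d p) \<in> Hom \<C> UD UD"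
  shows "(\<forall>(a, b) \<in> column_inverse UD e DU f t d I t' u. mor a = mor b) \<longleftrightarrow>
    mor e \<cdot> mor t' \<cdot> mor f = mor t' \<and> (\<forall>p\<in>I. mor e \<cdot> mor (u p) = mor (u p)) \<and>
    column_inv (mor e) (mor t) (\<lambda>p. mor (d p)) I (mor t') (\<lambda>p. mor (u p)) (mor f)"
proof -
  have "mor (msum UD UD (\<lambda>p. u p \<bullet> d p) I)
    = hsum UD UD (\<lambda>p. mor (u p) \<cdot> mor (d p)) I"
    using assms by (subst mor_msum) simp_all
  moreover have "mor (if p = q then Idt [] else Zer [] []) = (if p = q then idm [] else zerom [] [])" for p q
    by simp
  moreover have one: "(\<forall>ab \<in> {(g p, h p) | p. p \<in> I}. Q ab) \<longleftrightarrow> (\<forall>p\<in>I. Q (g p, h p))"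
    and two: "(\<forall>ab \<in> {(g' p q, h' p q) | p q. p \<in> I \<and> q \<in> I}. Q ab) \<longleftrightarrow> (\<forall>p\<in>I. \<forall>q\<in>I. Q (g' p q, h' p q))"
    for g' h' :: "_ \<Rightarrow> _ \<Rightarrow> ('k, strand, 'g) mterm" and g h :: "_ \<Rightarrow> ('k, strand, 'g) mterm" and Q by blast+
  ultimately show ?thesis unfolding column_inverse_def inverse_pair_def ball_Un one two by (simp add: conj_ac)
qed

lemma mor_row_inverse:
  assumes "finite I" "\<And>p. p \<in> I \<Longrightarrow> mor (c p) \<cdot> mor (u p) \<in> Hom \<C> DU DU"
  shows "(\<forall>(a, b) \<in> row_inverse UD e DU f t c I t' u. mor a = mor b) \<longleftrightarrow>
    mor e \<cdot> mor t' \<cdot> mor f = mor t' \<and> (\<forall>p\<in>I. mor (u p) \<cdot> mor f = mor (u p)) \<and>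
    row_inv (mor e) (mor t) (\<lambda>p. mor (c p)) I (mor t') (\<lambda>p. mor (u p)) (mor f)"
proof -
  have "mor (msum DU DU (\<lambda>p. c p \<bullet> u p) I)
    = hsum DU DU (\<lambda>p. mor (c p) \<cdot> mor (u p)) I"
    using assms by (subst mor_msum) simp_all
  moreover have "mor (if p = q then Idt [] else Zer [] []) = (if p = q then idm [] else zerom [] [])" for p q
    by simp
  moreover have one: "(\<forall>ab \<in> {(g p, h p) | p. p \<in> I}. Q ab) \<longleftrightarrow> (\<forall>p\<in>I. Q (g p, h p))"
    and two: "(\<forall>ab \<in> {(g' p q, h' p q) | p q. p \<in> I \<and> q \<in> I}. Q ab) \<longleftrightarrow> (\<forall>p\<in>I. \<forall>q\<in>I. Q (g' p q, h' p q))"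
    for g' h' :: "_ \<Rightarrow> _ \<Rightarrow> ('k, strand, 'g) mterm" and g h :: "_ \<Rightarrow> ('k, strand, 'g) mterm" and Q by blast+
  ultimately show ?thesis unfolding row_inverse_def inverse_pair_def ball_Un one two by (simp add: conj_ac)
qed

lemma column_inverse_Hom:
  assumes "finite I" "mor e \<in> Hom \<C> UD UD" "mor f \<in> Hom \<C> DU DU"
    "mor t \<in> Hom \<C> UD DU" "mor t' \<in> Hom \<C> DU UD"
    "\<And>p. p \<in> I \<Longrightarrow> mor (d p) \<in> Hom \<C> UD []" "\<And>p. p \<in> I \<Longrightarrow> mor (u p) \<in> Hom \<C> [] UD"
    "(a, b) \<in> column_inverse UD e DU f t d I t' u"
  shows "\<exists>X Y. mor a \<in> Hom \<C> X Y \<and> mor b \<in> Hom \<C> X Y"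
proof -
  have "mor (msum UD UD (\<lambda>p. u p \<bullet> d p) I) \<in> Hom \<C> UD UD"
    using assms by (subst mor_msum) (auto intro!: hsum_Hom simp: in_Hom_iff)
  then show ?thesis using assms unfolding column_inverse_def by (auto simp: in_Hom_iff)
qed

lemma row_inverse_Hom:
  assumes "finite I" "mor e \<in> Hom \<C> UD UD" "mor f \<in> Hom \<C> DU DU"
    "mor t \<in> Hom \<C> UD DU" "mor t' \<in> Hom \<C> DU UD"
    "\<And>p. p \<in> I \<Longrightarrow> mor (c p) \<in> Hom \<C> [] DU" "\<And>p. p \<in> I \<Longrightarrow> mor (u p) \<in> Hom \<C> DU []"
    "(a, b) \<in> row_inverse UD e DU f t c I t' u"
  shows "\<exists>X Y. mor a \<in> Hom \<C> X Y \<and> mor b \<in> Hom \<C> X Y"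
proof -
  have "mor (msum DU DU (\<lambda>p. c p \<bullet> u p) I) \<in> Hom \<C> DU DU"
    using assms by (subst mor_msum) (auto intro!: hsum_Hom simp: in_Hom_iff)
  then show ?thesis using assms unfolding row_inverse_def by (auto simp: in_Hom_iff)
qed

end

lemma msubst_column_inverse:
  "(a, b) \<in> column_inverse X e Y f t d I t' u \<Longrightarrow> (msubst \<sigma> a, msubst \<sigma> b) \<in>
    column_inverse X (msubst \<sigma> e) Y (msubst \<sigma> f) (msubst \<sigma> t) (\<lambda>p. msubst \<sigma> (d p)) I
      (msubst \<sigma> t') (\<lambda>p. msubst \<sigma> (u p))"
  unfolding column_inverse_def Un_iff
  by (elim disjE CollectE exE conjE singletonE) (simp; blast?)+

lemma msubst_row_inverse:
  "(a, b) \<in> row_inverse X e Y f t c I t' u \<Longrightarrow> (msubst \<sigma> a, msubst \<sigma> b) \<in>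
    row_inverse X (msubst \<sigma> e) Y (msubst \<sigma> f) (msubst \<sigma> t) (\<lambda>p. msubst \<sigma> (c p)) I
      (msubst \<sigma> t') (\<lambda>p. msubst \<sigma> (u p))"
  unfolding row_inverse_def Un_iff
  by (elim disjE CollectE exE conjE singletonE) (simp; blast?)+

lemma msubst_building_blocks [simp]:
  "msubst \<sigma> (rotated_crossing s c d) = rotated_crossing (msubst \<sigma> s) (msubst \<sigma> c) (msubst \<sigma> d)"
  "msubst \<sigma> (down_zigzag c d) = down_zigzag (msubst \<sigma> c) (msubst \<sigma> d)"
  "msubst \<sigma> (Sub R f g) = Sub R (msubst \<sigma> f) (msubst \<sigma> g)"
  by (simp_all add: rotated_crossing_def down_zigzag_def Sub_def)

text \<open>
  Uncoloured and coloured generators in one category.  The idempotents \<open>e i\<close> and \<open>f i\<close> cut the upward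
  and the downward strand into colours.  The generators \<open>x\<close>, \<open>s\<close>, \<open>c\<close>, \<open>d\<close> commute with colours,
  where \<open>c\<close> and \<open>d\<close> exchange \<open>e i\<close> and \<open>f i\<close>, and \<open>xc\<close>, \<open>sc\<close>, \<open>cc\<close>, \<open>dc\<close> are their components.
  Both categories of the theorem are instances: in one the uncoloured generators are given, in the
  other the coloured ones.
\<close>

locale coloured_strands = strands R P
  for R :: "('k, 'r) ring_scheme" and P :: "('k, strand, 'g) presentation" +
  fixes N :: "nat set" and x s c d :: "('k, strand, 'g) mterm set"
    and e f xc cc dc :: "nat \<Rightarrow> ('k, strand, 'g) mterm set"
    and sc :: "nat \<Rightarrow> nat \<Rightarrow> ('k, strand, 'g) mterm set"
  assumes finite_N: "finite N"
    and x_Hom: "x \<in> Hom \<C> [Up] [Up]" and s_Hom: "s \<in> Hom \<C> UU UU"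
    and c_Hom: "c \<in> Hom \<C> [] DU" and d_Hom: "d \<in> Hom \<C> UD []"
    and e_Hom: "i \<in> N \<Longrightarrow> e i \<in> Hom \<C> [Up] [Up]" and f_Hom: "i \<in> N \<Longrightarrow> f i \<in> Hom \<C> [Down] [Down]"
    and e_orth: "i \<in> N \<Longrightarrow> j \<in> N \<Longrightarrow> e i \<cdot> e j = (if i = j then e i else zerom [Up] [Up])"
    and f_orth: "i \<in> N \<Longrightarrow> j \<in> N \<Longrightarrow> f i \<cdot> f j = (if i = j then f i else zerom [Down] [Down])"
    and e_sum: "hsum [Up] [Up] e N = idm [Up]" and f_sum: "hsum [Down] [Down] f N = idm [Down]"
    and x_col: "i \<in> N \<Longrightarrow> x \<cdot> e i = xc i" "i \<in> N \<Longrightarrow> e i \<cdot> x = xc i"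
    and s_slide: "i \<in> N \<Longrightarrow> lay [] (e i) [Up] \<cdot> s = s \<cdot> lay [Up] (e i) []"
      "i \<in> N \<Longrightarrow> lay [Up] (e i) [] \<cdot> s = s \<cdot> lay [] (e i) [Up]"
    and sc: "i \<in> N \<Longrightarrow> j \<in> N \<Longrightarrow> sc i j = s \<cdot> lay [] (e i) [Up] \<cdot> lay [Up] (e j) []"
    and c_slide: "i \<in> N \<Longrightarrow> lay [] (f i) [Up] \<cdot> c = lay [Down] (e i) [] \<cdot> c"
    and cc: "i \<in> N \<Longrightarrow> cc i = lay [Down] (e i) [] \<cdot> c"
    and d_slide: "i \<in> N \<Longrightarrow> d \<cdot> lay [Up] (f i) [] = d \<cdot> lay [] (e i) [Down]"
    and dc: "i \<in> N \<Longrightarrow> dc i = d \<cdot> lay [] (e i) [Down]"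
begin

lemma ty [simp]:
  "arr x" "src x = [Up]" "tgt x = [Up]" "arr s" "src s = UU" "tgt s = UU"
  "arr c" "src c = []" "tgt c = DU" "arr d" "src d = UD" "tgt d = []"
  "i \<in> N \<Longrightarrow> arr (e i)" "i \<in> N \<Longrightarrow> src (e i) = [Up]" "i \<in> N \<Longrightarrow> tgt (e i) = [Up]"
  "i \<in> N \<Longrightarrow> arr (f i)" "i \<in> N \<Longrightarrow> src (f i) = [Down]" "i \<in> N \<Longrightarrow> tgt (f i) = [Down]"
  using x_Hom s_Hom c_Hom d_Hom e_Hom f_Hom by (simp_all add: in_Hom_iff)

lemma xc: "i \<in> N \<Longrightarrow> xc i = x \<cdot> e i"
  by (simp add: x_col)

lemma x_slide: "i \<in> N \<Longrightarrow> e i \<cdot> x = x \<cdot> e i"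
  by (simp add: x_col)

lemma ty_col [simp]:
  "i \<in> N \<Longrightarrow> arr (xc i)" "i \<in> N \<Longrightarrow> src (xc i) = [Up]" "i \<in> N \<Longrightarrow> tgt (xc i) = [Up]"
  "i \<in> N \<Longrightarrow> arr (cc i)" "i \<in> N \<Longrightarrow> src (cc i) = []" "i \<in> N \<Longrightarrow> tgt (cc i) = DU"
  "i \<in> N \<Longrightarrow> arr (dc i)" "i \<in> N \<Longrightarrow> src (dc i) = UD" "i \<in> N \<Longrightarrow> tgt (dc i) = []"
  "i \<in> N \<Longrightarrow> j \<in> N \<Longrightarrow> arr (sc i j)" "i \<in> N \<Longrightarrow> j \<in> N \<Longrightarrow> src (sc i j) = UU"
  "i \<in> N \<Longrightarrow> j \<in> N \<Longrightarrow> tgt (sc i j) = UU"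
  by (simp_all add: xc cc dc sc)

lemmas e_faithful = jointly_faithful[OF finite_N e_Hom e_sum]
lemmas f_faithful = jointly_faithful[OF finite_N f_Hom f_sum]

lemma e_idem: "i \<in> N \<Longrightarrow> e i \<cdot> e i = e i" and f_idem: "i \<in> N \<Longrightarrow> f i \<cdot> f i = f i"
  by (simp_all add: e_orth f_orth)

lemma lay_idem: "i \<in> N \<Longrightarrow> lay W (e i) Z \<cdot> lay W (e i) Z = lay W (e i) Z"
  "i \<in> N \<Longrightarrow> lay W (f i) Z \<cdot> lay W (f i) Z = lay W (f i) Z"
  using lay_comp[of "e i" "e i" W Z] lay_comp[of "f i" "f i" W Z] by (simp_all add: e_idem f_idem)

lemma lay_slide_x: "i \<in> N \<Longrightarrow> lay W (e i) Z \<cdot> lay W x Z = lay W x Z \<cdot> lay W (e i) Z"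
  using arg_cong[OF x_slide, of i "\<lambda>u. lay W u Z"] by simp

lemma lay_slide_s:
  assumes i: "i \<in> N"
  shows "T = Up # Z \<Longrightarrow> lay W (e i) T \<cdot> lay W s Z = lay W s Z \<cdot> lay (W @ [Up]) (e i) Z"
    "V = W @ [Up] \<Longrightarrow> lay V (e i) Z \<cdot> lay W s Z = lay W s Z \<cdot> lay W (e i) (Up # Z)"
  using arg_cong[OF s_slide(1)[OF i], of "\<lambda>u. lay W u Z"] arg_cong[OF s_slide(2)[OF i], of "\<lambda>u. lay W u Z"] i
  by simp_all

lemma lay_slide_c: "i \<in> N \<Longrightarrow> T = Up # Z \<Longrightarrow> lay W (f i) T \<cdot> lay W c Z = lay (W @ [Down]) (e i) Z \<cdot> lay W c Z"
  using arg_cong[OF c_slide, of i "\<lambda>u. lay W u Z"] by simp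

lemma lay_slide_d: "i \<in> N \<Longrightarrow> V = W @ [Up] \<Longrightarrow> lay W d Z \<cdot> lay V (f i) Z = lay W d Z \<cdot> lay W (e i) (Down # Z)"
  using arg_cong[OF d_slide, of i "\<lambda>u. lay W u Z"] by simp

text \<open>
  Rewriting with these rules moves every colour idempotent towards the source of a diagram, sorts
  the idempotents by position and merges equal neighbours.
\<close>

lemmas push0 = lay_idem(1) lay_slide_x lay_slide_s x_slide s_slide e_idem
  exchange_right[where f = "e i" for i] exchange_left[where f = "e i" and g = x for i]
  exchange_left[where f = "e i" and g = s for i]
  exchange_left[where f = "e i" and g = d for i] exchange_left[where f = "e i" and g = c for i]

lemmas push = push0 push0[THEN comp_trail]

abbreviation "e2 i j \<equiv> lay [] (e i) [Up] \<cdot> lay [Up] (e j) []"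
abbreviation "e3 i j l \<equiv> lay [] (e i) UU \<cdot> lay [Up] (e j) [Up] \<cdot> lay UU (e l) []"

text \<open>
  Lemmas of this kind identify a component of one side of an uncoloured relation with the same side
  of the coloured relation.  Composing with idempotents thus gives the coloured relations from
  the uncoloured one, and joint faithfulness gives the converse.
\<close>

lemma braid_col:
  assumes "i \<in> N" "j \<in> N" "l \<in> N"
  shows "((s \<star> idm [Up]) \<cdot> (idm [Up] \<star> s) \<cdot> (s \<star> idm [Up])) \<cdot> e3 i j l
     = (sc j l \<star> e i) \<cdot> (e j \<star> sc i l) \<cdot> (sc i j \<star> e l)"
    "((idm [Up] \<star> s) \<cdot> (s \<star> idm [Up]) \<cdot> (idm [Up] \<star> s)) \<cdot> e3 i j l
     = (e l \<star> sc i j) \<cdot> (sc i l \<star> e j) \<cdot> (e i \<star> sc j l)"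
  using assms by (simp_all add: tens_lay sc push)


lemma square_col:
  assumes "i \<in> N" "j \<in> N"
  shows "(s \<cdot> s) \<cdot> e2 i j = sc j i \<cdot> sc i j"
    "idm UU \<cdot> e2 i j = e i \<star> e j"
  using assms by (simp_all add: tens_lay sc push)

lemma x_s_col:
  assumes "i \<in> N" "j \<in> N"
  shows "((x \<star> idm [Up]) \<cdot> s) \<cdot> e2 i j = (xc j \<star> e i) \<cdot> sc i j"
    "(s \<cdot> (idm [Up] \<star> x)) \<cdot> e2 i j = sc i j \<cdot> (e i \<star> xc j)"
  using assms by (simp_all add: tens_lay sc xc push)

text \<open>
  The colour of the cup travels along its downward leg to the cap: \<open>e i\<close> on the cup is \<open>f i\<close> on the
  middle strand, which the cap turns into \<open>e i\<close> again.
\<close>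

lemma zigzag_up_col:
  assumes i: "i \<in> N"
  shows "((d \<star> idm [Up]) \<cdot> (idm [Up] \<star> c)) \<cdot> e i = (dc i \<star> idm [Up]) \<cdot> (idm [Up] \<star> cc i)"
proof -
  have "(dc i \<star> idm [Up]) \<cdot> (idm [Up] \<star> cc i)
    = lay [] d [Up] \<cdot> lay [] (e i) DU \<cdot> (lay UD (e i) [] \<cdot> lay [Up] c [])"
    using i by (simp add: tens_lay dc cc)
  also have "lay UD (e i) [] \<cdot> lay [Up] c [] = lay [Up] (f i) [Up] \<cdot> lay [Up] c []"
    using lay_slide_c[OF i, of "[Up]" "[]" "[Up]"] by simp
  also have "lay [] d [Up] \<cdot> lay [] (e i) DU \<cdot> lay [Up] (f i) [Up] \<cdot> lay [Up] c []
    = lay [] d [Up] \<cdot> lay [Up] (f i) [Up] \<cdot> lay [] (e i) DU \<cdot> lay [Up] c []"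
    using exchange_left[of "e i" "f i" "[]" "[Up]" "DU" "[Up]", THEN comp_trail] i by simp
  also have "\<dots> = lay [] d [Up] \<cdot> lay [] (e i) DU \<cdot> lay [] (e i) DU \<cdot> lay [Up] c []"
    using lay_slide_d[OF i, of "[Up]" "[]" "[Up]", THEN comp_trail] by simp
  also have "\<dots> = ((d \<star> idm [Up]) \<cdot> (idm [Up] \<star> c)) \<cdot> e i"
    using i by (simp add: tens_lay push)
  finally show ?thesis by simp
qed

lemma zigzag_down_col:
  assumes i: "i \<in> N"
  shows "zz c d \<cdot> f i = zz (cc i) (dc i)"
proof -
  have "zz c d \<cdot> f i = lay [Down] d [] \<cdot> (lay [] c [Down] \<cdot> lay [] (f i) [])"
    using i by (simp add: zz_lay c_Hom d_Hom)
  also have "lay [] c [Down] \<cdot> lay [] (f i) [] = lay DU (f i) [] \<cdot> lay [] c [Down]"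
    using exchange_left[of c "f i" "[]" "[]" "[Down]" "[]"] i by simp
  also have "lay [Down] d [] \<cdot> lay DU (f i) [] \<cdot> lay [] c [Down]
    = lay [Down] d [] \<cdot> lay [Down] (e i) [Down] \<cdot> lay [] c [Down]"
    using lay_slide_d[OF i, of "DU" "[Down]" "[]", THEN comp_trail] by simp
  also have "\<dots> = zz (cc i) (dc i)"
    using i zz_lay[of "cc i" "dc i"] by (simp add: in_Hom_iff dc cc push)
  finally show ?thesis .
qed

definition t where "t = rot s c d"
definition tc where "tc i j = rot (sc j i) (cc j) (dc j)"
definition E where "E i j = e i \<star> f j"
definition G where "G i j = f j \<star> e i"

lemma t_lay: "t = lay DU d [] \<cdot> lay [Down] s [Down] \<cdot> lay [] c UD"
  unfolding t_def by (rule rot_lay[OF s_Hom c_Hom d_Hom])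

lemma E_lay: "i \<in> N \<Longrightarrow> j \<in> N \<Longrightarrow> E i j = lay [] (e i) [Down] \<cdot> lay [Up] (f j) []"
  by (simp add: E_def tens_lay)

lemma G_lay: "i \<in> N \<Longrightarrow> j \<in> N \<Longrightarrow> G i j = lay [] (f j) [Up] \<cdot> lay [Down] (e i) []"
  by (simp add: G_def tens_lay)

lemma ty_t [simp]:
  "arr t" "src t = UD" "tgt t = DU"
  "i \<in> N \<Longrightarrow> j \<in> N \<Longrightarrow> arr (E i j)" "i \<in> N \<Longrightarrow> j \<in> N \<Longrightarrow> src (E i j) = UD"
  "i \<in> N \<Longrightarrow> j \<in> N \<Longrightarrow> tgt (E i j) = UD"
  "i \<in> N \<Longrightarrow> j \<in> N \<Longrightarrow> arr (G i j)" "i \<in> N \<Longrightarrow> j \<in> N \<Longrightarrow> src (G i j) = DU"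
  "i \<in> N \<Longrightarrow> j \<in> N \<Longrightarrow> tgt (G i j) = DU"
  by (simp_all add: t_lay E_def G_def)

text \<open>
  The idempotent \<open>e i\<close> slides along the upward strand of \<open>t\<close>.  The other strand is a downward arc
  that consists of \<open>c\<close>, \<open>s\<close> and \<open>d\<close>: an idempotent \<open>f j\<close> at either end enters it as \<open>e j\<close> and can be
  moved to the upward leg of \<open>c\<close>.
\<close>

lemma rotated_col:
  assumes ij: "i \<in> N" "j \<in> N"
  shows "t \<cdot> E i j = tc i j" "G i j \<cdot> t = tc i j"
proof -
  \<comment> \<open>common normal form of the three diagrams: \<open>e j\<close> sits on the cup, \<open>e i\<close> at the bottom\<close>
  let ?n = "lay DU d [] \<cdot> lay [Down] s [Down] \<cdot> lay [Down] (e j) UD \<cdot> lay [] c UD \<cdot> lay [] (e i) [Down]"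
  have tc: "tc i j = ?n" unfolding tc_def using ij
    by (subst rot_lay) (simp_all add: in_Hom_iff sc cc dc push)
  have "t \<cdot> E i j = (lay DU d [] \<cdot> lay [Down] s [Down] \<cdot> lay [] c UD \<cdot> lay [Up] (f j) []) \<cdot> lay [] (e i) [Down]"
    using ij exchange_left[of "e i" "f j" "[]" "[Up]" "[Down]" "[]"] by (simp add: t_lay E_lay)
  also have "lay DU d [] \<cdot> lay [Down] s [Down] \<cdot> lay [] c UD \<cdot> lay [Up] (f j) []
    = lay DU d [] \<cdot> lay [Down] s [Down] \<cdot> lay [Down, Up, Up] (f j) [] \<cdot> lay [] c UD"
    using ij exchange_left[of c "f j" "[]" "[Up]" "UD" "[]"] by simp
  also have "\<dots> = lay DU d [] \<cdot> lay [Down, Up, Up] (f j) [] \<cdot> lay [Down] s [Down] \<cdot> lay [] c UD"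
    using ij exchange_left[of s "f j" "[Down]" "[Down, Up, Up]" "[Down]" "[]", THEN comp_trail] by simp
  also have "\<dots> = lay DU d [] \<cdot> lay DU (e j) [Down] \<cdot> lay [Down] s [Down] \<cdot> lay [] c UD"
    using ij lay_slide_d[of j "[Down, Up, Up]" "DU" "[]", THEN comp_trail] by simp
  finally show "t \<cdot> E i j = tc i j" using ij by (simp add: tc push)
  have "G i j \<cdot> t = lay [] (f j) [Up] \<cdot> (lay [Down] (e i) [] \<cdot> t)" using ij by (simp add: G_lay)
  moreover have "lay [Down] (e i) [] \<cdot> t
    = lay DU d [] \<cdot> lay [Down] s [Down] \<cdot> lay [] c UD \<cdot> lay [] (e i) [Down]"
    using ij by (simp add: t_lay push)
  ultimately have "G i j \<cdot> t = lay [] (f j) [Up] \<cdot> lay DU d [] \<cdot> lay [Down] s [Down] \<cdot> lay [] c UD \<cdot> lay [] (e i) [Down]"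
    by simp
  also have "\<dots> = lay DU d [] \<cdot> lay [Down] s [Down] \<cdot> lay [] (f j) [Up, Up, Down] \<cdot> lay [] c UD \<cdot> lay [] (e i) [Down]"
    using ij exchange_left[of "f j" d "[]" "DU" "[Up]" "[]", THEN comp_trail]
      exchange_left[of "f j" s "[]" "[Down]" "[Up, Up, Down]" "[Down]", THEN comp_trail] by simp
  also have "\<dots> = ?n" using ij lay_slide_c[of j "[Up, Up, Down]" "UD" "[]", THEN comp_trail] by simp
  finally show "G i j \<cdot> t = tc i j" using tc by simp
qed

lemma ty_tc [simp]:
  assumes "i \<in> N" "j \<in> N"
  shows "arr (tc i j)" "src (tc i j) = UD" "tgt (tc i j) = DU"
  unfolding rotated_col(1)[OF assms, symmetric] using assms by simp_all

lemma EG_orth: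
  assumes "i \<in> N" "j \<in> N" "i' \<in> N" "j' \<in> N"
  shows "E i j \<cdot> E i' j' = (if i = i' \<and> j = j' then E i j else zerom UD UD)"
    "G i j \<cdot> G i' j' = (if i = i' \<and> j = j' then G i j else zerom DU DU)"
  using assms by (simp_all add: E_def G_def interchange' e_orth f_orth)

lemma E_faithful:
  assumes "u \<in> Hom \<C> UD Y" "v \<in> Hom \<C> UD Y"
    "\<And>i j. i \<in> N \<Longrightarrow> j \<in> N \<Longrightarrow> u \<cdot> E i j = v \<cdot> E i j"
  shows "u = v"
proof (rule e_faithful[where W = "[]" and Z = "[Down]" and Y = Y])
  fix i assume i: "i \<in> N"
  show "u \<cdot> lay [] (e i) [Down] = v \<cdot> lay [] (e i) [Down]"
    by (rule f_faithful[where W = "[Up]" and Z = "[]" and Y = Y])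
      (use i assms in \<open>simp_all add: in_Hom_iff E_lay\<close>)
qed (use assms in simp_all)

lemma G_faithful:
  assumes "u \<in> Hom \<C> DU Y" "v \<in> Hom \<C> DU Y"
    "\<And>i j. i \<in> N \<Longrightarrow> j \<in> N \<Longrightarrow> u \<cdot> G i j = v \<cdot> G i j"
  shows "u = v"
proof (rule f_faithful[where W = "[]" and Z = "[Up]" and Y = Y])
  fix j assume j: "j \<in> N"
  show "u \<cdot> lay [] (f j) [Up] = v \<cdot> lay [] (f j) [Up]"
    by (rule e_faithful[where W = "[Down]" and Z = "[]" and Y = Y])
      (use j assms in \<open>simp_all add: in_Hom_iff G_lay\<close>)
qed (use assms in simp_all)


text \<open>
  Joint faithfulness one strand at a time, which avoids sums over tuples of colours.
\<close>

lemma EE_faithful: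
  assumes "u \<in> Hom \<C> UU Y" "v \<in> Hom \<C> UU Y"
    "\<And>i j. i \<in> N \<Longrightarrow> j \<in> N \<Longrightarrow> u \<cdot> e2 i j = v \<cdot> e2 i j"
  shows "u = v"
proof (rule e_faithful[where W = "[]" and Z = "[Up]" and Y = Y])
  fix i assume i: "i \<in> N"
  show "u \<cdot> lay [] (e i) [Up] = v \<cdot> lay [] (e i) [Up]"
    by (rule e_faithful[where W = "[Up]" and Z = "[]" and Y = Y])
      (use i assms in \<open>simp_all add: in_Hom_iff\<close>)
qed (use assms in simp_all)

lemma EEE_faithful:
  assumes "u \<in> Hom \<C> [Up, Up, Up] Y" "v \<in> Hom \<C> [Up, Up, Up] Y"
    "\<And>i j l. i \<in> N \<Longrightarrow> j \<in> N \<Longrightarrow> l \<in> N \<Longrightarrow>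
      u \<cdot> e3 i j l
      = v \<cdot> e3 i j l"
  shows "u = v"
proof (rule e_faithful[where W = "[]" and Z = "UU" and Y = Y])
  fix i assume i: "i \<in> N"
  show "u \<cdot> lay [] (e i) UU = v \<cdot> lay [] (e i) UU"
  proof (rule e_faithful[where W = "[Up]" and Z = "[Up]" and Y = Y])
    fix j assume j: "j \<in> N"
    show "(u \<cdot> lay [] (e i) UU) \<cdot> lay [Up] (e j) [Up] = (v \<cdot> lay [] (e i) UU) \<cdot> lay [Up] (e j) [Up]"
      by (rule e_faithful[where W = "UU" and Z = "[]" and Y = Y])
        (use i j assms in \<open>simp_all add: in_Hom_iff\<close>)
  qed (use i assms in \<open>simp_all add: in_Hom_iff\<close>)
qed (use assms in simp_all)

lemma EG_Hom [simp]: "i \<in> N \<Longrightarrow> j \<in> N \<Longrightarrow> E i j \<in> Hom \<C> UD UD"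
  "i \<in> N \<Longrightarrow> j \<in> N \<Longrightarrow> G i j \<in> Hom \<C> DU DU"
  by (simp_all add: in_Hom_iff)

lemma t_Hom: "t \<in> Hom \<C> UD DU"
  by (simp add: in_Hom_iff)

lemma t_EG: "i \<in> N \<Longrightarrow> j \<in> N \<Longrightarrow> t \<cdot> E i j = G i j \<cdot> t"
  by (simp add: rotated_col)

text \<open>
  The formally adjoined inverses commute with the colours because the matrices that they invert do.
\<close>

lemma column_links:
  assumes I: "finite I" and T: "T \<in> Hom \<C> DU UD"
    and U: "\<And>p. p \<in> I \<Longrightarrow> U p \<in> Hom \<C> [] UD" and dv: "\<And>p. p \<in> I \<Longrightarrow> dv p \<in> Hom \<C> UD []"
    and dvE: "\<And>p i j. p \<in> I \<Longrightarrow> i \<in> N \<Longrightarrow> j \<in> N \<Longrightarrow>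
      dv p \<cdot> E i j = (if col p = i \<and> col p = j then dv p else zerom UD [])"
    and inv: "column_inv (idm UD) t dv I T U (idm DU)"
    and ij: "i \<in> N" "j \<in> N"
  shows "T \<cdot> G i j = E i j \<cdot> T"
    "p \<in> I \<Longrightarrow> E i j \<cdot> U p = (if col p = i \<and> col p = j then U p else zerom [] UD)"
  using inverse_pair_idempotent_right[OF I t_Hom T U dv EG_Hom(1)[OF ij] EG_Hom(2)[OF ij] t_EG[OF ij] dvE[OF _ ij] inv]
  by blast+

lemma row_links:
  assumes I: "finite I" and T: "T \<in> Hom \<C> DU UD"
    and U: "\<And>p. p \<in> I \<Longrightarrow> U p \<in> Hom \<C> DU []" and cv: "\<And>p. p \<in> I \<Longrightarrow> cv p \<in> Hom \<C> [] DU"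
    and Gcv: "\<And>p i j. p \<in> I \<Longrightarrow> i \<in> N \<Longrightarrow> j \<in> N \<Longrightarrow>
      G i j \<cdot> cv p = (if col p = i \<and> col p = j then cv p else zerom [] DU)"
    and inv: "row_inv (idm UD) t cv I T U (idm DU)"
    and ij: "i \<in> N" "j \<in> N"
  shows "T \<cdot> G i j = E i j \<cdot> T"
    "p \<in> I \<Longrightarrow> U p \<cdot> G i j = (if col p = i \<and> col p = j then U p else zerom DU [])"
  using inverse_pair_idempotent_left[OF I T t_Hom cv U EG_Hom(2)[OF ij] EG_Hom(1)[OF ij] t_EG[OF ij] Gcv[OF _ ij] inv]
  by blast+

lemma EG_faithful:
  "u \<in> Hom \<C> UD Y \<Longrightarrow> v \<in> Hom \<C> UD Y \<Longrightarrow>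
    (\<And>\<kappa>. \<kappa> \<in> N \<times> N \<Longrightarrow> u \<cdot> E (fst \<kappa>) (snd \<kappa>) = v \<cdot> E (fst \<kappa>) (snd \<kappa>)) \<Longrightarrow> u = v"
  "u \<in> Hom \<C> DU Y \<Longrightarrow> v \<in> Hom \<C> DU Y \<Longrightarrow>
    (\<And>\<kappa>. \<kappa> \<in> N \<times> N \<Longrightarrow> u \<cdot> G (fst \<kappa>) (snd \<kappa>) = v \<cdot> G (fst \<kappa>) (snd \<kappa>)) \<Longrightarrow> u = v"
  using E_faithful[of u Y v] G_faithful[of u Y v] by fastforce+

lemma column_inv_col:
  assumes I: "finite I" and T: "T \<in> Hom \<C> DU UD"
    and U: "\<And>p. p \<in> I \<Longrightarrow> U p \<in> Hom \<C> [] UD" and dv: "\<And>p. p \<in> I \<Longrightarrow> dv p \<in> Hom \<C> UD []"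
    and col: "\<And>p. p \<in> I \<Longrightarrow> col p \<in> N"
    and dvE: "\<And>p i j. p \<in> I \<Longrightarrow> i \<in> N \<Longrightarrow> j \<in> N \<Longrightarrow>
      dv p \<cdot> E i j = (if col p = i \<and> col p = j then dv p else zerom UD [])"
    and TG: "\<And>i j. i \<in> N \<Longrightarrow> j \<in> N \<Longrightarrow> T \<cdot> G i j = E i j \<cdot> T"
    and EU: "\<And>p i j. p \<in> I \<Longrightarrow> i \<in> N \<Longrightarrow> j \<in> N \<Longrightarrow>
      E i j \<cdot> U p = (if col p = i \<and> col p = j then U p else zerom [] UD)"
  shows "column_inv (idm UD) t dv I T U (idm DU) \<longleftrightarrow>
    (\<forall>i\<in>N. \<forall>j\<in>N. column_inv (E i j) (tc i j) dv {p \<in> I. col p = i \<and> col p = j} (T \<cdot> G i j) U (G i j))"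
proof -
  let ?E = "\<lambda>\<kappa>. E (fst \<kappa>) (snd \<kappa>)" and ?G = "\<lambda>\<kappa>. G (fst \<kappa>) (snd \<kappa>)"
  have "column_inv (idm UD) t dv I T U (idm DU) \<longleftrightarrow>
    (\<forall>\<kappa>\<in>N \<times> N. column_inv (?E \<kappa>) (t \<cdot> ?E \<kappa>) dv {p \<in> I. (col p, col p) = \<kappa>} (T \<cdot> ?G \<kappa>) U (?G \<kappa>))"
    by (rule inverse_pair_blocks[OF I t_Hom T U dv _ _ _ _ EG_faithful];
        (assumption | use col t_EG TG dvE EU in \<open>auto simp: EG_orth split: if_splits\<close>))
  then show ?thesis by (simp add: rotated_col)
qed

lemma row_inv_col:
  assumes I: "finite I" and T: "T \<in> Hom \<C> DU UD"
    and U: "\<And>p. p \<in> I \<Longrightarrow> U p \<in> Hom \<C> DU []" and cv: "\<And>p. p \<in> I \<Longrightarrow> cv p \<in> Hom \<C> [] DU"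
    and col: "\<And>p. p \<in> I \<Longrightarrow> col p \<in> N"
    and Gcv: "\<And>p i j. p \<in> I \<Longrightarrow> i \<in> N \<Longrightarrow> j \<in> N \<Longrightarrow>
      G i j \<cdot> cv p = (if col p = i \<and> col p = j then cv p else zerom [] DU)"
    and TG: "\<And>i j. i \<in> N \<Longrightarrow> j \<in> N \<Longrightarrow> T \<cdot> G i j = E i j \<cdot> T"
    and UG: "\<And>p i j. p \<in> I \<Longrightarrow> i \<in> N \<Longrightarrow> j \<in> N \<Longrightarrow>
      U p \<cdot> G i j = (if col p = i \<and> col p = j then U p else zerom DU [])"
  shows "row_inv (idm UD) t cv I T U (idm DU) \<longleftrightarrow>
    (\<forall>i\<in>N. \<forall>j\<in>N. row_inv (E i j) (tc i j) cv {p \<in> I. col p = i \<and> col p = j} (T \<cdot> G i j) U (G i j))"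
proof -
  let ?E = "\<lambda>\<kappa>. E (fst \<kappa>) (snd \<kappa>)" and ?G = "\<lambda>\<kappa>. G (fst \<kappa>) (snd \<kappa>)"
  have "row_inv (idm UD) t cv I T U (idm DU) \<longleftrightarrow>
    (\<forall>\<kappa>\<in>N \<times> N. row_inv (?E \<kappa>) (t \<cdot> ?E \<kappa>) cv {p \<in> I. (col p, col p) = \<kappa>} (T \<cdot> ?G \<kappa>) U (?G \<kappa>))"
    by (rule inverse_pair_blocks[OF I T t_Hom cv U _ _ _ _ EG_faithful(2) EG_faithful(1)];
        (assumption | use col t_EG TG Gcv UG in \<open>auto simp: EG_orth split: if_splits\<close>))
  then show ?thesis by (simp add: rotated_col)
qed

end

section \<open>Tokens on coloured strands\<close>

text \<open>
  A token \<open>\<beta> a\<close> of the direct sum carries on the strand of colour \<open>i\<close> the component of \<open>a\<close> in the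
  \<open>i\<close>-th summand.
\<close>

locale coloured_tokens = coloured_strands R P "{1..n}" x s c d e f xc cc dc sc
  for R :: "('k, 'r) ring_scheme" and P :: "('k, strand, 'g) presentation"
    and n x s c d e f xc cc dc sc +
  fixes F :: "nat \<Rightarrow> ('k, 'a) module"
    and \<beta> :: "(nat \<Rightarrow> 'a) \<Rightarrow> ('k, strand, 'g) mterm set"
    and \<beta>c :: "'a \<Rightarrow> nat \<Rightarrow> ('k, strand, 'g) mterm set"
  assumes \<beta>_Hom: "a \<in> carrier (direct_sum n F) \<Longrightarrow> \<beta> a \<in> Hom \<C> [Up] [Up]"
    and \<beta>_col: "a \<in> carrier (direct_sum n F) \<Longrightarrow> i \<in> {1..n} \<Longrightarrow> \<beta> a \<cdot> e i = \<beta>c (a i) i"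
      "a \<in> carrier (direct_sum n F) \<Longrightarrow> i \<in> {1..n} \<Longrightarrow> e i \<cdot> \<beta> a = \<beta>c (a i) i"
    and \<beta>c_zero: "i \<in> {1..n} \<Longrightarrow> \<beta>c \<zero>\<^bsub>F i\<^esub> i = zerom [Up] [Up]"
begin

lemma ty_\<beta> [simp]: "a \<in> carrier (direct_sum n F) \<Longrightarrow> arr (\<beta> a)" "a \<in> carrier (direct_sum n F) \<Longrightarrow> src (\<beta> a) = [Up]"
  "a \<in> carrier (direct_sum n F) \<Longrightarrow> tgt (\<beta> a) = [Up]"
  using \<beta>_Hom by (simp_all add: in_Hom_iff)

lemma \<beta>c: "a \<in> carrier (direct_sum n F) \<Longrightarrow> i \<in> {1..n} \<Longrightarrow> \<beta>c (a i) i = \<beta> a \<cdot> e i"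
  by (simp add: \<beta>_col)

lemma \<beta>_slide: "a \<in> carrier (direct_sum n F) \<Longrightarrow> i \<in> {1..n} \<Longrightarrow> e i \<cdot> \<beta> a = \<beta> a \<cdot> e i"
  by (simp add: \<beta>_col)

lemma lay_slide_\<beta>: "a \<in> carrier (direct_sum n F) \<Longrightarrow> i \<in> {1..n} \<Longrightarrow> lay W (e i) Z \<cdot> lay W (\<beta> a) Z = lay W (\<beta> a) Z \<cdot> lay W (e i) Z"
  using arg_cong[OF \<beta>_slide, of a i "\<lambda>u. lay W u Z"] by simp

lemmas push\<beta>0 = \<beta>_slide lay_slide_\<beta> exchange_left[where f = "e i" and g = "\<beta> a" for i a]
lemmas push\<beta> = push push\<beta>0 push\<beta>0[THEN comp_trail]

lemma \<beta>_mult_col: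
  assumes "a \<in> carrier (direct_sum n F)" "b \<in> carrier (direct_sum n F)" "i \<in> {1..n}"
  shows "(\<beta> a \<cdot> \<beta> b) \<cdot> e i = \<beta>c (a i) i \<cdot> \<beta>c (b i) i"
  using assms by (simp add: \<beta>c push\<beta>)

lemma x_\<beta>_col:
  assumes "a \<in> carrier (direct_sum n F)" "i \<in> {1..n}"
  shows "(x \<cdot> \<beta> a) \<cdot> e i = xc i \<cdot> \<beta>c (a i) i" "(\<beta> a \<cdot> x) \<cdot> e i = \<beta>c (a i) i \<cdot> xc i"
  using assms by (simp_all add: \<beta>c xc push\<beta>)

lemma s_\<beta>_col:
  assumes "a \<in> carrier (direct_sum n F)" "i \<in> {1..n}" "j \<in> {1..n}"
  shows "(s \<cdot> (\<beta> a \<star> idm [Up])) \<cdot> e2 i j = sc i j \<cdot> (\<beta>c (a i) i \<star> e j)"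
    "((idm [Up] \<star> \<beta> a) \<cdot> s) \<cdot> e2 i j = (e j \<star> \<beta>c (a i) i) \<cdot> sc i j"
  using assms by (simp_all add: \<beta>c sc tens_lay push\<beta>)

lemma \<beta>_\<beta>_col:
  assumes "a \<in> carrier (direct_sum n F)" "b \<in> carrier (direct_sum n F)" "i \<in> {1..n}" "j \<in> {1..n}"
  shows "(\<beta> a \<star> \<beta> b) \<cdot> e2 i j = \<beta>c (a i) i \<star> \<beta>c (b j) j"
  using assms by (simp_all add: \<beta>c tens_lay push\<beta>)

text \<open>The tokens \<open>x\<^sup>r \<beta>\<^sub>a\<close>, and the entries of the inversion matrices made from them.\<close>

definition tok where "tok r a = mpw (idm [Up]) x r \<cdot> \<beta> a"
definition tokc where "tokc i r b = mpw (e i) (xc i) r \<cdot> \<beta>c b i"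
definition dv where "dv r a = d \<cdot> (tok r a \<star> idm [Down])"
definition dvc where "dvc i r b = dc i \<cdot> (tokc i r b \<star> idm [Down])"
definition cv where "cv r a = (idm [Down] \<star> tok r a) \<cdot> c"
definition cvc where "cvc i r b = (idm [Down] \<star> tokc i r b) \<cdot> cc i"

lemma ty_mpw: "arr (mpw (idm [Up]) x r)" "src (mpw (idm [Up]) x r) = [Up]" "tgt (mpw (idm [Up]) x r) = [Up]"
  by (induction r) simp_all

lemma ty_tok [simp]: "a \<in> carrier (direct_sum n F) \<Longrightarrow> arr (tok r a)" "a \<in> carrier (direct_sum n F) \<Longrightarrow> src (tok r a) = [Up]"
  "a \<in> carrier (direct_sum n F) \<Longrightarrow> tgt (tok r a) = [Up]"
  by (simp_all add: tok_def ty_mpw)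

lemma tok_col:
  assumes a: "a \<in> carrier (direct_sum n F)" and i: "i \<in> {1..n}"
  shows "tok r a \<cdot> e i = tokc i r (a i)" "e i \<cdot> tok r a = tokc i r (a i)"
proof -
  have 1: "e i \<cdot> mpw (idm [Up]) x r = mpw (idm [Up]) x r \<cdot> e i" for r
  proof (induction r)
    case (Suc r)
    have "e i \<cdot> x \<cdot> mpw (idm [Up]) x r = x \<cdot> e i \<cdot> mpw (idm [Up]) x r"
      using x_slide[OF i, THEN comp_trail] by simp
    then show ?case using Suc by simp
  qed (use i in simp)
  have 2: "mpw (e i) (xc i) r = mpw (idm [Up]) x r \<cdot> e i"
  proof (induction r)
    case (Suc r)
    have "mpw (e i) (xc i) (Suc r) = x \<cdot> e i \<cdot> mpw (idm [Up]) x r \<cdot> e i" using Suc i by (simp add: xc)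
    also have "e i \<cdot> mpw (idm [Up]) x r \<cdot> e i = mpw (idm [Up]) x r \<cdot> e i"
      using 1[of r, THEN comp_trail] e_idem[OF i] by simp
    finally show ?case by simp
  qed (use i in simp)
  have "tokc i r (a i) = mpw (idm [Up]) x r \<cdot> e i \<cdot> \<beta> a \<cdot> e i" using a i by (simp add: tokc_def 2 \<beta>c)
  also have "\<dots> = tok r a \<cdot> e i" using a i \<beta>_slide[OF a i, THEN comp_trail] e_idem[OF i] by (simp add: tok_def)
  finally show t: "tok r a \<cdot> e i = tokc i r (a i)" by simp
  have "e i \<cdot> tok r a = tok r a \<cdot> e i"
    using 1[of r, THEN comp_trail] \<beta>_slide[OF a i] by (simp add: tok_def)
  then show "e i \<cdot> tok r a = tokc i r (a i)" using t by simp
qed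

text \<open>
  A token that comes from the \<open>l\<close>-th summand forces the colour \<open>l\<close> of its strand.
\<close>

lemma tok_supported:
  assumes a: "a \<in> carrier (direct_sum n F)" and l: "l \<in> {1..n}" and supp: "\<forall>i\<in>{1..n}. i \<noteq> l \<longrightarrow> a i = \<zero>\<^bsub>F i\<^esub>"
    and i: "i \<in> {1..n}"
  shows "tok r a \<cdot> e i = (if i = l then tok r a else zerom [Up] [Up])"
    "e i \<cdot> tok r a = (if i = l then tok r a else zerom [Up] [Up])" "tokc l r (a l) = tok r a"
proof -
  have *: "tok r a \<cdot> e i = zerom [Up] [Up]" if "i \<in> {1..n}" "i \<noteq> l" for i
  proof -
    have "\<beta> a \<cdot> e i = zerom [Up] [Up]" using \<beta>_col(1)[OF a that(1)] supp that \<beta>c_zero[OF that(1)] by simp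
    then show ?thesis by (simp add: tok_def ty_mpw)
  qed
  have "tok r a \<cdot> e l = tok r a"
  proof (rule e_faithful[where W = "[]" and Z = "[]" and Y = "[Up]"])
    fix i assume "i \<in> {1..n}"
    then show "(tok r a \<cdot> e l) \<cdot> lay [] (e i) [] = tok r a \<cdot> lay [] (e i) []"
      using a l *[of i] by (simp add: e_orth)
  qed (use a l in \<open>simp_all add: in_Hom_iff\<close>)
  then show "tok r a \<cdot> e i = (if i = l then tok r a else zerom [Up] [Up])" "tokc l r (a l) = tok r a"
    using * i tok_col[OF a l, of r] by auto
  then show "e i \<cdot> tok r a = (if i = l then tok r a else zerom [Up] [Up])" using tok_col[OF a i] by simp
qed

lemma ty_dv [simp]: "a \<in> carrier (direct_sum n F) \<Longrightarrow> arr (dv r a)" "a \<in> carrier (direct_sum n F) \<Longrightarrow> src (dv r a) = UD"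
  "a \<in> carrier (direct_sum n F) \<Longrightarrow> tgt (dv r a) = []"
  "a \<in> carrier (direct_sum n F) \<Longrightarrow> arr (cv r a)" "a \<in> carrier (direct_sum n F) \<Longrightarrow> src (cv r a) = []"
  "a \<in> carrier (direct_sum n F) \<Longrightarrow> tgt (cv r a) = DU"
  by (simp_all add: dv_def cv_def)

text \<open>
  In \<open>dv r a\<close> the colours of both legs of the cap meet at the token: \<open>f j\<close> becomes \<open>e j\<close> behind the
  token, and \<open>e i\<close> stands in front of it.
\<close>

lemma dv_col:
  assumes a: "a \<in> carrier (direct_sum n F)" and l: "l \<in> {1..n}" and supp: "\<forall>i\<in>{1..n}. i \<noteq> l \<longrightarrow> a i = \<zero>\<^bsub>F i\<^esub>"
  shows "i \<in> {1..n} \<Longrightarrow> j \<in> {1..n} \<Longrightarrow> dv r a \<cdot> E i j = (if l = i \<and> l = j then dv r a else zerom UD [])"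
    "dvc l r (a l) = dv r a"
proof -
  have dv: "dv r a = d \<cdot> lay [] (tok r a) [Down]" using a by (simp add: dv_def tens_lay)
  note ts = tok_supported[OF a l supp]
  assume ij: "i \<in> {1..n}" "j \<in> {1..n}"
  have "dv r a \<cdot> E i j = d \<cdot> lay [] (tok r a \<cdot> e i) [Down] \<cdot> lay [Up] (f j) []"
    using a ij by (simp add: dv E_lay)
  also have "\<dots> = d \<cdot> lay [Up] (f j) [] \<cdot> lay [] (tok r a \<cdot> e i) [Down]"
    using a ij exchange_left[of "tok r a \<cdot> e i" "f j" "[]" "[Up]" "[Down]" "[]"] by simp
  also have "\<dots> = d \<cdot> lay [] (e j \<cdot> tok r a \<cdot> e i) [Down]"
    using a ij d_slide[OF ij(2), THEN comp_trail] by simp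
  also have "e j \<cdot> tok r a \<cdot> e i = (if l = i \<and> l = j then tok r a else zerom [Up] [Up])"
    using ts(1)[OF ij(1), of r] ts(2)[OF ij(2), of r] ij a by (cases "i = l"; cases "j = l") simp_all
  also have "d \<cdot> lay [] \<dots> [Down] = (if l = i \<and> l = j then dv r a else zerom UD [])"
    using a by (simp add: dv)
  finally show "dv r a \<cdot> E i j = (if l = i \<and> l = j then dv r a else zerom UD [])" .
next
  note ts = tok_supported[OF a l supp]
  show "dvc l r (a l) = dv r a"
    using a l ts(3)[OF l] arg_cong[OF ts(2)[OF l], of "\<lambda>u. lay [] u [Down]"]
    by (simp add: dvc_def dv_def dc tens_lay)
qed

lemma cv_col:
  assumes a: "a \<in> carrier (direct_sum n F)" and l: "l \<in> {1..n}" and supp: "\<forall>i\<in>{1..n}. i \<noteq> l \<longrightarrow> a i = \<zero>\<^bsub>F i\<^esub>"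
  shows "i \<in> {1..n} \<Longrightarrow> j \<in> {1..n} \<Longrightarrow> G i j \<cdot> cv r a = (if l = i \<and> l = j then cv r a else zerom [] DU)"
    "cvc l r (a l) = cv r a"
proof -
  have cv: "cv r a = lay [Down] (tok r a) [] \<cdot> c" using a by (simp add: cv_def tens_lay)
  note ts = tok_supported[OF a l supp]
  assume ij: "i \<in> {1..n}" "j \<in> {1..n}"
  have *: "lay [] (f j) [Up] \<cdot> lay [Down] (e i \<cdot> tok r a) []
    = lay [Down] (e i \<cdot> tok r a) [] \<cdot> lay [] (f j) [Up]"
    using a ij exchange[of "f j" "e i \<cdot> tok r a" "[]" "[]" "[]"] by simp
  have "G i j \<cdot> cv r a = lay [] (f j) [Up] \<cdot> lay [Down] (e i \<cdot> tok r a) [] \<cdot> c"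
    using a ij by (simp add: cv G_lay)
  also have "\<dots> = lay [Down] (e i \<cdot> tok r a) [] \<cdot> lay [] (f j) [Up] \<cdot> c"
    by (simp only: comp_trail[OF *] comp_assoc_total)
  also have "\<dots> = lay [Down] (e i \<cdot> tok r a \<cdot> e j) [] \<cdot> c"
    using a ij c_slide[OF ij(2)] by simp
  also have "e i \<cdot> tok r a \<cdot> e j = (if l = i \<and> l = j then tok r a else zerom [Up] [Up])"
    using ts(2)[OF ij(1), of r, THEN comp_trail, of "e j"] ts(1)[OF ij(2), of r] ij a
    by (cases "i = l"; cases "j = l") simp_all
  also have "lay [Down] \<dots> [] \<cdot> c = (if l = i \<and> l = j then cv r a else zerom [] DU)"
    using a by (simp add: cv)
  finally show "G i j \<cdot> cv r a = (if l = i \<and> l = j then cv r a else zerom [] DU)" .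
next
  note ts = tok_supported[OF a l supp]
  show "cvc l r (a l) = cv r a"
    using a l ts(3)[OF l] arg_cong[OF ts(1)[OF l], of "\<lambda>u. lay [Down] u [] \<cdot> c"]
    by (simp add: cvc_def cv_def cc tens_lay)
qed

end

section \<open>Mates\<close>

text \<open>
  In the Frobenius Heisenberg category only the upward strand carries tokens.  The zigzag relations
  make \<open>Q\<^sub>-\<close> a dual of \<open>Q\<^sub>+\<close>, so an endomorphism of \<open>Q\<^sub>+\<close> has a mate on \<open>Q\<^sub>-\<close>; the mates of the
  idempotents \<open>e i\<close> are the colours of the downward strand.
\<close>

locale zigzag_strands = strands R P
  for R :: "('k, 'r) ring_scheme" and P :: "('k, strand, 'g) presentation" +
  fixes c d :: "('k, strand, 'g) mterm set"
  assumes c_Hom: "c \<in> Hom \<C> [] DU" and d_Hom: "d \<in> Hom \<C> UD []"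
    and zigzag_up: "(d \<star> idm [Up]) \<cdot> (idm [Up] \<star> c) = idm [Up]"
    and zigzag_down: "zz c d = idm [Down]"
begin

lemma ty [simp]: "arr c" "src c = []" "tgt c = DU" "arr d" "src d = UD" "tgt d = []"
  using c_Hom d_Hom by (simp_all add: in_Hom_iff)

lemma up: "lay [] d [Up] \<cdot> lay [Up] c [] = idm [Up]"
  using zigzag_up by (simp add: tens_lay)

lemma down: "lay [Down] d [] \<cdot> lay [] c [Down] = idm [Down]"
  using zigzag_down by (simp add: zz_lay c_Hom d_Hom)

lemma lay_up: "lay W d (Up # Z) \<cdot> lay (W @ [Up]) c Z = idm (W @ [Up] @ Z)"
  using arg_cong[OF up, of "\<lambda>u. lay W u Z"] by simp

definition mate where "mate a = lay [Down] d [] \<cdot> lay [Down] a [Down] \<cdot> lay [] c [Down]"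

lemma mate_Hom: "a \<in> Hom \<C> [Up] [Up] \<Longrightarrow> mate a \<in> Hom \<C> [Down] [Down]"
  by (simp add: mate_def in_Hom_iff)

lemma ty_mate [simp]: "a \<in> Hom \<C> [Up] [Up] \<Longrightarrow> arr (mate a)" "a \<in> Hom \<C> [Up] [Up] \<Longrightarrow> src (mate a) = [Down]"
  "a \<in> Hom \<C> [Up] [Up] \<Longrightarrow> tgt (mate a) = [Down]"
  using mate_Hom by (simp_all add: in_Hom_iff)

text \<open>
  After the two cups are exchanged, the cap in the mate and one of the cups form a zigzag, which can
  be straightened; what remains is the token on the other leg of the cup.
\<close>

lemma mate_c:
  assumes a: "a \<in> Hom \<C> [Up] [Up]"
  shows "lay [] (mate a) [Up] \<cdot> c = lay [Down] a [] \<cdot> c"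
proof -
  note [simp] = a[unfolded in_Hom_iff]
  have "lay [] (mate a) [Up] \<cdot> c
    = lay [Down] d [Up] \<cdot> lay [Down] a DU \<cdot> lay [] c DU \<cdot> lay [] c []"
    by (simp add: mate_def)
  also have "lay [] c DU \<cdot> lay [] c [] = lay DU c [] \<cdot> lay [] c []"
    using exchange[of c c "[]" "[]" "[]"] by simp
  also have "lay [Down] d [Up] \<cdot> lay [Down] a DU \<cdot> lay DU c [] \<cdot> lay [] c []
    = lay [Down] d [Up] \<cdot> lay DU c [] \<cdot> lay [Down] a [] \<cdot> lay [] c []"
    using exchange[of a c "[Down]" "[]" "[]", THEN comp_trail] by simp
  also have "\<dots> = lay [Down] a [] \<cdot> c" using lay_up[of "[Down]" "[]", THEN comp_trail] by simp
  finally show ?thesis .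
qed

lemma mate_d:
  assumes a: "a \<in> Hom \<C> [Up] [Up]"
  shows "d \<cdot> lay [Up] (mate a) [] = d \<cdot> lay [] a [Down]"
proof -
  note [simp] = a[unfolded in_Hom_iff]
  have "d \<cdot> lay [Up] (mate a) [] = lay [] d [] \<cdot> lay UD d [] \<cdot> lay UD a [Down] \<cdot> lay [Up] c [Down]"
    by (simp add: mate_def)
  also have "\<dots> = lay [] d [] \<cdot> lay [] d UD \<cdot> lay UD a [Down] \<cdot> lay [Up] c [Down]"
    using exchange[of d d "[]" "[]" "[]", THEN comp_trail] by simp
  also have "\<dots> = lay [] d [] \<cdot> lay [] a [Down] \<cdot> lay [] d UD \<cdot> lay [Up] c [Down]"
    using exchange[of d a "[]" "[]" "[Down]", THEN comp_trail] by simp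
  also have "\<dots> = d \<cdot> lay [] a [Down]" using lay_up[of "[]" "[Down]"] by simp
  finally show ?thesis .
qed

lemma mate_comp:
  assumes a: "a \<in> Hom \<C> [Up] [Up]" and b: "b \<in> Hom \<C> [Up] [Up]"
  shows "mate b \<cdot> mate a = mate (a \<cdot> b)"
proof -
  note [simp] = a[unfolded in_Hom_iff] b[unfolded in_Hom_iff]
  note [simp] = ty_mate[OF b]
  have "mate b \<cdot> mate a = lay [] (mate b) [] \<cdot> lay [Down] d [] \<cdot> lay [Down] a [Down] \<cdot> lay [] c [Down]"
    by (simp add: mate_def[of a])
  also have "\<dots> = lay [Down] d [] \<cdot> lay [] (mate b) UD \<cdot> lay [Down] a [Down] \<cdot> lay [] c [Down]"
    using exchange[of "mate b" d "[]" "[]" "[]", THEN comp_trail] by simp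
  also have "\<dots> = lay [Down] d [] \<cdot> lay [Down] a [Down] \<cdot> lay [] (mate b) UD \<cdot> lay [] c [Down]"
    using exchange[of "mate b" a "[]" "[]" "[Down]", THEN comp_trail] by simp
  also have "lay [] (mate b) UD \<cdot> lay [] c [Down] = lay [Down] b [Down] \<cdot> lay [] c [Down]"
    using arg_cong[OF mate_c[OF b], of "\<lambda>u. lay [] u [Down]"] by simp
  finally show ?thesis by (simp add: mate_def)
qed

lemma mate_idm: "mate (idm [Up]) = idm [Down]"
  by (simp add: mate_def down)

lemma mate_zerom: "mate (zerom [Up] [Up]) = zerom [Down] [Down]"
  by (simp add: mate_def)

lemma mate_hsum:
  assumes "finite N" "\<And>i. i \<in> N \<Longrightarrow> a i \<in> Hom \<C> [Up] [Up]"
  shows "mate (hsum [Up] [Up] a N) = hsum [Down] [Down] (\<lambda>i. mate (a i)) N"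
  using assms by (simp add: mate_def lay_hsum hsum_comp comp_hsum in_Hom_iff)

lemma zz_mate:
  assumes "a \<in> Hom \<C> [Up] [Up]" "a \<cdot> a = a"
  shows "zz (lay [Down] a [] \<cdot> c) (d \<cdot> lay [] a [Down]) = mate a"
  using assms lay_comp[of a a "[Down]" "[Down]"] comp_trail[of "lay [Down] a [Down]" "lay [Down] a [Down]"]
  by (subst zz_lay) (simp_all add: in_Hom_iff mate_def)

end

section \<open>The zero ring\<close>

text \<open>
  Over the zero ring \<open>0\<close> may belong to a basis, and then the bases of the summands are not disjoint in
  the direct sum.  But all hom-modules vanish, so any two presentations on the same objects have
  isomorphic categories.
\<close>

lemma (in presented) zero_ring_mor_eq:
  assumes z: "\<one>\<^bsub>R\<^esub> = \<zero>\<^bsub>R\<^esub>" and u: "u \<in> Hom \<C> X Y" and v: "v \<in> Hom \<C> X Y"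
  shows "u = v"
proof -
  interpret M: module R "homs X Y" by (rule hom_module_presented)
  have zero: "w = zerom X Y" if w: "w \<in> Hom \<C> X Y" for w
    using M.smult_one[of w] M.smult_l_null[of w] z w by simp
  show ?thesis using zero[OF u] zero[OF v] by simp
qed

lemma zero_ring_isomorphic:
  fixes P :: "('k, 'o, 'g) presentation" and Q :: "('k, 'o, 'h) presentation"
  assumes R: "cring R" and z: "\<one>\<^bsub>R\<^esub> = \<zero>\<^bsub>R\<^esub>"
  shows "lin_mon_cat_isomorphic R (presented_cat R P) (presented_cat R Q)"
proof -
  interpret C: presented R P by (rule presented.intro) (rule R)
  interpret D: presented R Q by (rule presented.intro) (rule R)
  let ?s = "\<lambda>g. Zer (source P g) (target P g)" and ?t = "\<lambda>g. Zer (source Q g) (target Q g)"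
  have s: "typed R Q X Y (msubst ?s f)" if "typed R P X Y f" for X Y f
    using that by (induction rule: typed.induct) (auto intro: typed.intros)
  interpret S: presentation_map R P Q ?s
  proof unfold_locales
    fix f g X Y assume "typed R P X Y f" "typed R P X Y g"
    then show "D.mor (msubst ?s f) = D.mor (msubst ?s g)"
      by (intro D.zero_ring_mor_eq[OF z, of _ X Y]) (simp_all add: D.mor_in_Hom s)
  qed (rule typed.zer)
  have t: "typed R P X Y (msubst ?t f)" if "typed R Q X Y f" for X Y f
    using that by (induction rule: typed.induct) (auto intro: typed.intros)
  interpret T: presentation_map R Q P ?t
  proof unfold_locales
    fix f g X Y assume "typed R Q X Y f" "typed R Q X Y g"
    then show "C.mor (msubst ?t f) = C.mor (msubst ?t g)"
      by (intro C.zero_ring_mor_eq[OF z, of _ X Y]) (simp_all add: C.mor_in_Hom t)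
  qed (rule typed.zer)
  show ?thesis
  proof (rule presentations_isomorphic[OF S.presentation_map_axioms T.presentation_map_axioms])
    fix g assume g: "g \<in> gens P"
    show "C.mor (msubst ?t (?s g)) = C.mor (Gen g)"
      by (rule C.zero_ring_mor_eq[OF z, of _ "source P g" "target P g"])
        (use typed.gen[OF g, of R] in \<open>simp_all add: C.mor_in_Hom C.zerom_Hom\<close>)
  next
    fix g assume g: "g \<in> gens Q"
    show "D.mor (msubst ?s (?t g)) = D.mor (Gen g)"
      by (rule D.zero_ring_mor_eq[OF z, of _ "source Q g" "target Q g"])
        (use typed.gen[OF g, of R] in \<open>simp_all add: D.mor_in_Hom D.zerom_Hom\<close>)
  qed
qed

section \<open>Direct sums of Frobenius algebras\<close>

context frobenius_algebra
begin

lemma tr_zero: "tr \<zero>\<^bsub>A\<^esub> = \<zero>\<^bsub>R\<^esub>"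
  using tr_add[of "\<zero>\<^bsub>A\<^esub>" "\<zero>\<^bsub>A\<^esub>"] tr_closed[of "\<zero>\<^bsub>A\<^esub>"] R.add.l_cancel_one'[of "tr \<zero>\<^bsub>A\<^esub>" "tr \<zero>\<^bsub>A\<^esub>"]
  by simp

lemma tr_finsum:
  "finite S \<Longrightarrow> f \<in> S \<rightarrow> carrier A \<Longrightarrow> tr (finsum A f S) = (\<Oplus>\<^bsub>R\<^esub>s\<in>S. tr (f s))"
proof (induction S rule: finite_induct)
  case (insert s S)
  have "(\<lambda>s. tr (f s)) \<in> insert s S \<rightarrow> carrier R" using insert.prems tr_closed by blast
  then show ?case using insert by (simp add: tr_add Pi_def M.finsum_closed)
qed (simp add: tr_zero)

text \<open>
  The coordinates of an element with respect to the dual basis are its traces against the basis, so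
  these traces determine the element.
\<close>

lemma trace_determines:
  assumes B: "is_basis R A B" and x: "x \<in> carrier A" and y: "y \<in> carrier A"
    and xy: "\<And>b. b \<in> B \<Longrightarrow> tr (x \<otimes>\<^bsub>A\<^esub> b) = tr (y \<otimes>\<^bsub>A\<^esub> b)"
  shows "x = y"
proof -
  obtain dual where D: "is_left_dual_basis R A tr B dual" using dual_basis[OF B] by blast
  have basis: "is_basis R A (dual ` B)" and delta: "\<And>a b. a \<in> B \<Longrightarrow> b \<in> B \<Longrightarrow>
      tr (dual a \<otimes>\<^bsub>A\<^esub> b) = (if a = b then \<one>\<^bsub>R\<^esub> else \<zero>\<^bsub>R\<^esub>)"
    using D by (auto simp: is_left_dual_basis_def)
  have fin: "finite (dual ` B)" and D_A: "dual ` B \<subseteq> carrier A" and B_A: "B \<subseteq> carrier A"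
    using basis B by (auto simp: is_basis_def)
  have coord: "c (dual b) = tr (z \<otimes>\<^bsub>A\<^esub> b)"
    if c: "c \<in> dual ` B \<rightarrow> carrier R" and z: "z = (\<Oplus>\<^bsub>A\<^esub>d\<in>dual ` B. c d \<odot>\<^bsub>A\<^esub> d)" and b: "b \<in> B" for c z b
  proof -
    have bA: "b \<in> carrier A" using b B_A by blast
    have cd: "(\<lambda>d. c d \<odot>\<^bsub>A\<^esub> d) \<in> dual ` B \<rightarrow> carrier A" using c D_A by auto
    have "tr (z \<otimes>\<^bsub>A\<^esub> b) = tr (\<Oplus>\<^bsub>A\<^esub>d\<in>dual ` B. (c d \<odot>\<^bsub>A\<^esub> d) \<otimes>\<^bsub>A\<^esub> b)"
      unfolding z using A.finsum_ldistr[OF fin bA cd] by simp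
    also have "\<dots> = (\<Oplus>\<^bsub>R\<^esub>d\<in>dual ` B. tr ((c d \<odot>\<^bsub>A\<^esub> d) \<otimes>\<^bsub>A\<^esub> b))"
      by (rule tr_finsum[OF fin]) (use cd bA in auto)
    also have "\<dots> = (\<Oplus>\<^bsub>R\<^esub>d\<in>dual ` B. if dual b = d then c d else \<zero>\<^bsub>R\<^esub>)"
    proof (rule R.add.finprod_cong')
      fix d assume d: "d \<in> dual ` B"
      then obtain a where a: "a \<in> B" "d = dual a" by blast
      have *: "c d \<in> carrier R" "d \<in> carrier A" using d c D_A by auto
      then have "tr ((c d \<odot>\<^bsub>A\<^esub> d) \<otimes>\<^bsub>A\<^esub> b) = c d \<otimes>\<^bsub>R\<^esub> tr (d \<otimes>\<^bsub>A\<^esub> b)"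
        using bA by (simp add: smult_mult_left tr_smult)
      also have "\<dots> = (if dual b = d then c d else \<zero>\<^bsub>R\<^esub>)"
      proof (cases "dual b = d")
        case True
        then have "tr (d \<otimes>\<^bsub>A\<^esub> b) = \<one>\<^bsub>R\<^esub>" using delta[OF b b] by simp
        then show ?thesis using True * by simp
      next
        case False
        then have "a \<noteq> b" using a by auto
        then have "tr (d \<otimes>\<^bsub>A\<^esub> b) = \<zero>\<^bsub>R\<^esub>" using delta[OF a(1) b] a by simp
        then show ?thesis using False * by simp
      qed
      finally show "tr ((c d \<odot>\<^bsub>A\<^esub> d) \<otimes>\<^bsub>A\<^esub> b) = (if dual b = d then c d else \<zero>\<^bsub>R\<^esub>)" .
    qed (use c in auto)
    also have "\<dots> = c (dual b)" using R.add.finprod_singleton[of "dual b" "dual ` B" c] fin b c by auto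
    finally show ?thesis by simp
  qed
  have repr: "\<exists>c. c \<in> dual ` B \<rightarrow>\<^sub>E carrier R \<and> z = (\<Oplus>\<^bsub>A\<^esub>d\<in>dual ` B. c d \<odot>\<^bsub>A\<^esub> d)" if "z \<in> carrier A" for z
    using basis that unfolding is_basis_def by (blast dest: ex1_implies_ex)
  obtain c where c: "c \<in> dual ` B \<rightarrow>\<^sub>E carrier R" "x = (\<Oplus>\<^bsub>A\<^esub>d\<in>dual ` B. c d \<odot>\<^bsub>A\<^esub> d)"
    using repr[OF x] by (elim exE conjE)
  obtain c' where c': "c' \<in> dual ` B \<rightarrow>\<^sub>E carrier R" "y = (\<Oplus>\<^bsub>A\<^esub>d\<in>dual ` B. c' d \<odot>\<^bsub>A\<^esub> d)"
    using repr[OF y] by (elim exE conjE)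
  have "c = c'"
  proof (rule PiE_ext[OF c(1) c'(1)])
    fix d assume "d \<in> dual ` B"
    then show "c d = c' d" using coord[OF _ c(2)] coord[OF _ c'(2)] c(1) c'(1) xy by (auto simp: PiE_def)
  qed
  then show ?thesis using c c' by simp
qed

lemma frob_dual:
  assumes B: "is_basis R A B" and b: "b \<in> B"
  shows "frob_dual R A tr B b \<in> carrier A"
    "b' \<in> B \<Longrightarrow> tr (frob_dual R A tr B b \<otimes>\<^bsub>A\<^esub> b') = (if b = b' then \<one>\<^bsub>R\<^esub> else \<zero>\<^bsub>R\<^esub>)"
proof -
  obtain dual where D: "is_left_dual_basis R A tr B dual" using dual_basis[OF B] by blast
  then show "frob_dual R A tr B b \<in> carrier A"
    "b' \<in> B \<Longrightarrow> tr (frob_dual R A tr B b \<otimes>\<^bsub>A\<^esub> b') = (if b = b' then \<one>\<^bsub>R\<^esub> else \<zero>\<^bsub>R\<^esub>)"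
    unfolding frob_dual_eq[OF B D b] using b by (auto simp: is_left_dual_basis_def is_basis_def)
qed

text \<open>
  A basis element pairs to \<open>1\<close> with its dual.
\<close>

lemma basis_nonzero:
  assumes "\<one>\<^bsub>R\<^esub> \<noteq> \<zero>\<^bsub>R\<^esub>" "is_basis R A B" "b \<in> B" shows "b \<noteq> \<zero>\<^bsub>A\<^esub>"
proof
  assume "b = \<zero>\<^bsub>A\<^esub>"
  then show False
    using frob_dual(1)[OF assms(2,3)] frob_dual(2)[OF assms(2,3,3)] assms(1) by (simp add: tr_zero)
qed

end

locale frobenius_sum =
  fixes R :: "'k ring" and n :: nat and F :: "nat \<Rightarrow> ('k, 'a) module"
    and tr :: "nat \<Rightarrow> 'a \<Rightarrow> 'k" and B :: "nat \<Rightarrow> 'a set" and k :: int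
  assumes R: "cring R" and nontrivial: "\<one>\<^bsub>R\<^esub> \<noteq> \<zero>\<^bsub>R\<^esub>"
    and frob: "\<And>i. i \<in> {1..n} \<Longrightarrow> frobenius_algebra R (F i) (tr i)"
    and basis: "\<And>i. i \<in> {1..n} \<Longrightarrow> is_basis R (F i) (B i)"
begin

declare atLeastAtMost_iff [simp del] One_nat_def [simp del]

abbreviation "N \<equiv> {1..n}"
abbreviation "A \<equiv> direct_sum n F"
abbreviation "trA \<equiv> sum_trace R n tr"
abbreviation "BA \<equiv> sum_basis n F B"
abbreviation "\<iota> \<equiv> summand_incl n F"
abbreviation "dual i b \<equiv> frob_dual R (F i) (tr i) (B i) b"
abbreviation "dualA b \<equiv> frob_dual R A trA BA b"

lemma ring_F: "i \<in> N \<Longrightarrow> ring (F i)"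
  using frob unfolding frobenius_algebra_def k_algebra_def by blast

lemma module_F: "i \<in> N \<Longrightarrow> module R (F i)"
  using frob unfolding frobenius_algebra_def k_algebra_def by blast

lemma F_simps [simp]:
  assumes "i \<in> N"
  shows "\<zero>\<^bsub>F i\<^esub> \<in> carrier (F i)" "\<one>\<^bsub>F i\<^esub> \<in> carrier (F i)"
    "a \<in> carrier (F i) \<Longrightarrow> a \<otimes>\<^bsub>F i\<^esub> \<zero>\<^bsub>F i\<^esub> = \<zero>\<^bsub>F i\<^esub>" "a \<in> carrier (F i) \<Longrightarrow> \<zero>\<^bsub>F i\<^esub> \<otimes>\<^bsub>F i\<^esub> a = \<zero>\<^bsub>F i\<^esub>"
    "a \<in> carrier (F i) \<Longrightarrow> a \<otimes>\<^bsub>F i\<^esub> \<one>\<^bsub>F i\<^esub> = a" "a \<in> carrier (F i) \<Longrightarrow> \<one>\<^bsub>F i\<^esub> \<otimes>\<^bsub>F i\<^esub> a = a"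
    "a \<in> carrier (F i) \<Longrightarrow> a \<oplus>\<^bsub>F i\<^esub> \<zero>\<^bsub>F i\<^esub> = a" "a \<in> carrier (F i) \<Longrightarrow> \<zero>\<^bsub>F i\<^esub> \<oplus>\<^bsub>F i\<^esub> a = a"
    "a \<in> carrier (F i) \<Longrightarrow> b \<in> carrier (F i) \<Longrightarrow> a \<otimes>\<^bsub>F i\<^esub> b \<in> carrier (F i)"
    "a \<in> carrier (F i) \<Longrightarrow> b \<in> carrier (F i) \<Longrightarrow> a \<oplus>\<^bsub>F i\<^esub> b \<in> carrier (F i)"
    "r \<in> carrier R \<Longrightarrow> a \<in> carrier (F i) \<Longrightarrow> r \<odot>\<^bsub>F i\<^esub> a \<in> carrier (F i)"
    "r \<in> carrier R \<Longrightarrow> r \<odot>\<^bsub>F i\<^esub> \<zero>\<^bsub>F i\<^esub> = \<zero>\<^bsub>F i\<^esub>"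
proof -
  interpret ring "F i" using ring_F[OF assms] .
  interpret M: module R "F i" using module_F[OF assms] .
  show "\<zero>\<^bsub>F i\<^esub> \<in> carrier (F i)" "\<one>\<^bsub>F i\<^esub> \<in> carrier (F i)"
    "a \<in> carrier (F i) \<Longrightarrow> a \<otimes>\<^bsub>F i\<^esub> \<zero>\<^bsub>F i\<^esub> = \<zero>\<^bsub>F i\<^esub>" "a \<in> carrier (F i) \<Longrightarrow> \<zero>\<^bsub>F i\<^esub> \<otimes>\<^bsub>F i\<^esub> a = \<zero>\<^bsub>F i\<^esub>"
    "a \<in> carrier (F i) \<Longrightarrow> a \<otimes>\<^bsub>F i\<^esub> \<one>\<^bsub>F i\<^esub> = a" "a \<in> carrier (F i) \<Longrightarrow> \<one>\<^bsub>F i\<^esub> \<otimes>\<^bsub>F i\<^esub> a = a"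
    "a \<in> carrier (F i) \<Longrightarrow> a \<oplus>\<^bsub>F i\<^esub> \<zero>\<^bsub>F i\<^esub> = a" "a \<in> carrier (F i) \<Longrightarrow> \<zero>\<^bsub>F i\<^esub> \<oplus>\<^bsub>F i\<^esub> a = a"
    "a \<in> carrier (F i) \<Longrightarrow> b \<in> carrier (F i) \<Longrightarrow> a \<otimes>\<^bsub>F i\<^esub> b \<in> carrier (F i)"
    "a \<in> carrier (F i) \<Longrightarrow> b \<in> carrier (F i) \<Longrightarrow> a \<oplus>\<^bsub>F i\<^esub> b \<in> carrier (F i)"
    "r \<in> carrier R \<Longrightarrow> a \<in> carrier (F i) \<Longrightarrow> r \<odot>\<^bsub>F i\<^esub> a \<in> carrier (F i)"
    "r \<in> carrier R \<Longrightarrow> r \<odot>\<^bsub>F i\<^esub> \<zero>\<^bsub>F i\<^esub> = \<zero>\<^bsub>F i\<^esub>"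
    by simp_all
qed

lemma A_sel:
  "carrier A = (\<Pi>\<^sub>E i\<in>N. carrier (F i))" "a \<otimes>\<^bsub>A\<^esub> b = (\<lambda>i\<in>N. a i \<otimes>\<^bsub>F i\<^esub> b i)" "\<one>\<^bsub>A\<^esub> = (\<lambda>i\<in>N. \<one>\<^bsub>F i\<^esub>)"
  "a \<oplus>\<^bsub>A\<^esub> b = (\<lambda>i\<in>N. a i \<oplus>\<^bsub>F i\<^esub> b i)" "r \<odot>\<^bsub>A\<^esub> a = (\<lambda>i\<in>N. r \<odot>\<^bsub>F i\<^esub> a i)"
  by (simp_all add: direct_sum_def)

lemma A_comp [simp]:
  "i \<in> N \<Longrightarrow> (a \<otimes>\<^bsub>A\<^esub> b) i = a i \<otimes>\<^bsub>F i\<^esub> b i" "i \<in> N \<Longrightarrow> \<one>\<^bsub>A\<^esub> i = \<one>\<^bsub>F i\<^esub>"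
  "i \<in> N \<Longrightarrow> (a \<oplus>\<^bsub>A\<^esub> b) i = a i \<oplus>\<^bsub>F i\<^esub> b i" "i \<in> N \<Longrightarrow> (r \<odot>\<^bsub>A\<^esub> a) i = r \<odot>\<^bsub>F i\<^esub> a i"
  "a \<in> carrier A \<Longrightarrow> i \<in> N \<Longrightarrow> a i \<in> carrier (F i)"
  by (auto simp: A_sel)

lemma restrict_A: "(\<And>i. i \<in> N \<Longrightarrow> f i \<in> carrier (F i)) \<Longrightarrow> restrict f N \<in> carrier A"
  by (simp add: A_sel(1) restrict_PiE_iff)

lemma A_closed [simp]:
  "\<one>\<^bsub>A\<^esub> \<in> carrier A" "a \<in> carrier A \<Longrightarrow> b \<in> carrier A \<Longrightarrow> a \<otimes>\<^bsub>A\<^esub> b \<in> carrier A"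
  "a \<in> carrier A \<Longrightarrow> b \<in> carrier A \<Longrightarrow> a \<oplus>\<^bsub>A\<^esub> b \<in> carrier A"
  "r \<in> carrier R \<Longrightarrow> a \<in> carrier A \<Longrightarrow> r \<odot>\<^bsub>A\<^esub> a \<in> carrier A"
  unfolding A_sel(2-5) by (rule restrict_A; simp)+

lemma A_eqI: "a \<in> carrier A \<Longrightarrow> b \<in> carrier A \<Longrightarrow> (\<And>i. i \<in> N \<Longrightarrow> a i = b i) \<Longrightarrow> a = b"
  unfolding A_sel by (rule PiE_ext)

lemma incl_apply [simp]: "j \<in> N \<Longrightarrow> \<iota> i a j = (if j = i then a else \<zero>\<^bsub>F j\<^esub>)"
  by (simp add: summand_incl_def)

lemma incl_closed [simp]: "i \<in> N \<Longrightarrow> a \<in> carrier (F i) \<Longrightarrow> \<iota> i a \<in> carrier A"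
  unfolding A_sel by (auto simp: summand_incl_def)

lemma incl_hom:
  assumes "i \<in> N" "a \<in> carrier (F i)" "b \<in> carrier (F i)"
  shows "\<iota> i a \<otimes>\<^bsub>A\<^esub> \<iota> i b = \<iota> i (a \<otimes>\<^bsub>F i\<^esub> b)" "\<iota> i a \<oplus>\<^bsub>A\<^esub> \<iota> i b = \<iota> i (a \<oplus>\<^bsub>F i\<^esub> b)"
    "r \<in> carrier R \<Longrightarrow> r \<odot>\<^bsub>A\<^esub> \<iota> i a = \<iota> i (r \<odot>\<^bsub>F i\<^esub> a)"
  by (rule A_eqI; use assms in auto)+

lemma incl_inj: "i \<in> N \<Longrightarrow> \<iota> i a = \<iota> i b \<longleftrightarrow> a = b"
  using incl_apply[of i i] by metis

lemma B_F: "i \<in> N \<Longrightarrow> b \<in> B i \<Longrightarrow> b \<in> carrier (F i)"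
  using basis by (auto simp: is_basis_def)

lemma finite_B: "i \<in> N \<Longrightarrow> finite (B i)"
  using basis by (auto simp: is_basis_def)

lemma finite_BA: "finite BA"
  using finite_B by (auto simp: sum_basis_def)

lemma BA_iff: "b \<in> BA \<longleftrightarrow> (\<exists>i\<in>N. \<exists>b'\<in>B i. b = \<iota> i b')"
  by (auto simp: sum_basis_def)

lemma B_nonzero: "i \<in> N \<Longrightarrow> b \<in> B i \<Longrightarrow> b \<noteq> \<zero>\<^bsub>F i\<^esub>"
  using frobenius_algebra.basis_nonzero[OF frob nontrivial basis] by blast

lemma incl_B_inj:
  assumes "i \<in> N" "b \<in> B i" "j \<in> N" "b' \<in> B j" "\<iota> i b = \<iota> j b'"
  shows "i = j \<and> b = b'"
proof -
  have "i = j"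
  proof (rule ccontr)
    assume "i \<noteq> j"
    then have "b = \<zero>\<^bsub>F i\<^esub>" using fun_cong[OF assms(5), of i] assms(1) by simp
    then show False using B_nonzero assms by blast
  qed
  then show ?thesis using assms incl_inj by simp
qed

text \<open>The colour of an element of the basis of the direct sum; basis elements are nonzero, so it is unique.\<close>

definition col where "col b = (SOME i. i \<in> N \<and> b \<in> \<iota> i ` B i)"

lemma col_incl [simp]: assumes "i \<in> N" "b \<in> B i" shows "col (\<iota> i b) = i"
  unfolding col_def
proof (rule some_equality)
  fix j assume "j \<in> N \<and> \<iota> i b \<in> \<iota> j ` B j"
  then obtain b' where "j \<in> N" "b' \<in> B j" "\<iota> i b = \<iota> j b'" by blast
  then show "j = i" using incl_B_inj[OF assms] by blast
qed (use assms in blast)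

lemma dual_closed: "i \<in> N \<Longrightarrow> b \<in> B i \<Longrightarrow> dual i b \<in> carrier (F i)"
  using frobenius_algebra.frob_dual(1)[OF frob basis] by blast

lemma trace_single:
  assumes i: "i \<in> N" and g: "\<And>j. j \<in> N \<Longrightarrow> g j \<in> carrier R" and z: "\<And>j. j \<in> N \<Longrightarrow> j \<noteq> i \<Longrightarrow> g j = \<zero>\<^bsub>R\<^esub>"
  shows "(\<Oplus>\<^bsub>R\<^esub>j\<in>N. g j) = g i"
proof -
  interpret cring R by (rule R)
  have "(\<Oplus>\<^bsub>R\<^esub>j\<in>N. g j) = (\<Oplus>\<^bsub>R\<^esub>j\<in>N. if i = j then g j else \<zero>\<^bsub>R\<^esub>)"
    by (rule finsum_cong') (use g z in \<open>auto simp del: atLeastAtMost_iff\<close>)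
  also have "\<dots> = g i" using finsum_singleton[OF i, of g] g by (auto simp del: atLeastAtMost_iff)
  finally show ?thesis .
qed

lemma sum_trace_incl:
  assumes a: "a \<in> carrier A" and i: "i \<in> N" and b: "b \<in> carrier (F i)"
  shows "trA (a \<otimes>\<^bsub>A\<^esub> \<iota> i b) = tr i (a i \<otimes>\<^bsub>F i\<^esub> b)"
proof -
  have "trA (a \<otimes>\<^bsub>A\<^esub> \<iota> i b) = tr i ((a \<otimes>\<^bsub>A\<^esub> \<iota> i b) i)"
    unfolding sum_trace_def
  proof (rule trace_single[OF i])
    fix j assume j: "j \<in> N"
    interpret frobenius_algebra R "F j" "tr j" by (rule frob[OF j])
    show "tr j ((a \<otimes>\<^bsub>A\<^esub> \<iota> i b) j) \<in> carrier R" using a i j b by (simp del: atLeastAtMost_iff add: tr_closed)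
    show "tr j ((a \<otimes>\<^bsub>A\<^esub> \<iota> i b) j) = \<zero>\<^bsub>R\<^esub>" if "j \<noteq> i"
      using a i j b that by (simp del: atLeastAtMost_iff add: tr_zero)
  qed
  then show ?thesis using i by (simp del: atLeastAtMost_iff)
qed

text \<open>
  The trace of the direct sum pairs elements of different summands to \<open>0\<close>, and
  \<open>trace_determines\<close> in each summand gives uniqueness.
\<close>

lemma dualA_incl:
  assumes i: "i \<in> N" and b: "b \<in> B i"
  shows "dualA (\<iota> i b) = \<iota> i (dual i b)"
  unfolding frob_dual_def[of R A]
proof (rule the_equality)
  have d: "\<iota> i (dual i b) \<in> carrier A" using i b dual_closed by simp
  have tr: "trA (\<iota> i (dual i b) \<otimes>\<^bsub>A\<^esub> b') = (if \<iota> i b = b' then \<one>\<^bsub>R\<^esub> else \<zero>\<^bsub>R\<^esub>)" if b': "b' \<in> BA" for b'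
  proof -
    obtain j b'' where j: "j \<in> N" "b'' \<in> B j" "b' = \<iota> j b''" using b' by (auto simp: BA_iff)
    interpret frobenius_algebra R "F j" "tr j" by (rule frob[OF j(1)])
    have "trA (\<iota> i (dual i b) \<otimes>\<^bsub>A\<^esub> b') = tr j ((if j = i then dual i b else \<zero>\<^bsub>F j\<^esub>) \<otimes>\<^bsub>F j\<^esub> b'')"
      using sum_trace_incl[OF d j(1) B_F[OF j(1,2)]] j by (simp del: atLeastAtMost_iff)
    also have "\<dots> = (if \<iota> i b = b' then \<one>\<^bsub>R\<^esub> else \<zero>\<^bsub>R\<^esub>)"
    proof (cases "j = i")
      case True
      then show ?thesis using frob_dual(2)[OF basis[OF j(1)] _ j(2), of b] b j incl_inj[OF i] by auto
    next
      case False
      then have "\<iota> i b \<noteq> b'" using incl_B_inj[OF i b j(1,2)] j(3) by blast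
      then show ?thesis using False B_F[OF j(1,2)] j(1) by (simp add: tr_zero)
    qed
    finally show ?thesis .
  qed
  show "\<iota> i (dual i b) \<in> carrier A \<and>
    (\<forall>b'\<in>BA. trA (\<iota> i (dual i b) \<otimes>\<^bsub>A\<^esub> b') = (if \<iota> i b = b' then \<one>\<^bsub>R\<^esub> else \<zero>\<^bsub>R\<^esub>))"
    using d tr by blast
  fix a assume a: "a \<in> carrier A \<and> (\<forall>b'\<in>BA. trA (a \<otimes>\<^bsub>A\<^esub> b') = (if \<iota> i b = b' then \<one>\<^bsub>R\<^esub> else \<zero>\<^bsub>R\<^esub>))"
  show "a = \<iota> i (dual i b)"
  proof (rule A_eqI)
    fix j assume j: "j \<in> N"
    show "a j = \<iota> i (dual i b) j"
    proof (rule frobenius_algebra.trace_determines[OF frob[OF j] basis[OF j]])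
      fix b' assume b': "b' \<in> B j"
      have m: "\<iota> j b' \<in> BA" using j b' by (auto simp: BA_iff)
      show "tr j (a j \<otimes>\<^bsub>F j\<^esub> b') = tr j (\<iota> i (dual i b) j \<otimes>\<^bsub>F j\<^esub> b')"
        using a m tr[OF m] sum_trace_incl[OF _ j B_F[OF j b']] d by metis
    qed (use a d j i b dual_closed in auto)
  qed (use a d in auto)
qed

end

section \<open>The two substitutions\<close>

abbreviation heis_presentation where
  "heis_presentation R n F tr B k \<equiv>
     \<lparr>gens = heis_gens (direct_sum n F) (sum_basis n F B) k, source = heis_source k, target = heis_target k,
      rels = heis_rels R (direct_sum n F) (sum_trace R n tr) (sum_basis n F B) k\<rparr>"

abbreviation col_presentation where
  "col_presentation R n F tr B k \<equiv>
     \<lparr>gens = col_heis_gens n F B k, source = col_heis_source k, target = col_heis_target k,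
      rels = col_heis_rels R n F tr B k\<rparr>"

context frobenius_sum
begin

text \<open>
  An uncoloured generator becomes the sum of its coloured versions.  The adjoined entry with index
  \<open>(r, b)\<close> belongs to the single colour of \<open>b\<close>.
\<close>

primrec merge :: "(nat \<Rightarrow> 'a) hgen \<Rightarrow> ('k, strand, 'a cgen) mterm" where
  "merge XGen = msum [Up] [Up] (\<lambda>i. Gen (XGen' i)) N"
| "merge SGen = msum UU UU (\<lambda>p. Gen (SGen' (fst p) (snd p))) (N \<times> N)"
| "merge CGen = msum [] DU (\<lambda>i. Gen (CGen' i)) N"
| "merge DGen = msum UD [] (\<lambda>i. Gen (DGen' i)) N"
| "merge (BetaGen a) = msum [Up] [Up] (\<lambda>i. Gen (BetaGen' (a i) i)) N"
| "merge TInv = msum DU UD (\<lambda>p. Gen (TInv' (fst p) (snd p))) (N \<times> N)"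
| "merge (UInv r b) = Gen (UInv' (col b) r (b (col b)))"

definition up_strand :: "nat \<Rightarrow> ('k, strand, (nat \<Rightarrow> 'a) hgen) mterm" where
  "up_strand i = Gen (BetaGen (\<iota> i \<one>\<^bsub>F i\<^esub>))"

definition cup :: "nat \<Rightarrow> ('k, strand, (nat \<Rightarrow> 'a) hgen) mterm" where
  "cup i = (\<one>\<^sub>- \<boxtimes> up_strand i) \<bullet> Gen CGen"

definition cap :: "nat \<Rightarrow> ('k, strand, (nat \<Rightarrow> 'a) hgen) mterm" where
  "cap i = Gen DGen \<bullet> (up_strand i \<boxtimes> \<one>\<^sub>-)"

text \<open>
  A coloured generator becomes the component of the uncoloured one.  Idempotents on one side suffice,
  since the generators commute with colours; \<open>UInv r b\<close> has the colour of \<open>b\<close> already.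
\<close>

primrec split :: "'a cgen \<Rightarrow> ('k, strand, (nat \<Rightarrow> 'a) hgen) mterm" where
  "split (XGen' i) = Gen XGen \<bullet> up_strand i"
| "split (SGen' i j) = Gen SGen \<bullet> (up_strand i \<boxtimes> up_strand j)"
| "split (CGen' i) = cup i"
| "split (DGen' i) = cap i"
| "split (BetaGen' b i) = Gen (BetaGen (\<iota> i b))"
| "split (TInv' i j) = Gen TInv \<bullet> (down_zigzag (cup j) (cap j) \<boxtimes> up_strand i)"
| "split (UInv' i r b) = Gen (UInv r (\<iota> i b))"

end

context frobenius_sum
begin

lemma dualA_closed: "b \<in> BA \<Longrightarrow> dualA b \<in> carrier A"
  using dual_closed by (auto simp: BA_iff dualA_incl)

lemma BA_carrier: "b \<in> BA \<Longrightarrow> b \<in> carrier A"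
  using B_F by (auto simp: BA_iff)

lemma minus_one: "\<ominus>\<^bsub>R\<^esub> \<one>\<^bsub>R\<^esub> \<in> carrier R"
  using R by (intro abelian_group.a_inv_closed cring.axioms(1)[THEN ring.is_abelian_group] monoid.one_closed
      cring.axioms(1)[THEN ring.is_monoid])

abbreviation "I \<equiv> {..<nat \<bar>k\<bar>} \<times> BA"

lemma finite_I: "finite I"
  using finite_BA by simp

lemma dual_supported:
  assumes "b \<in> BA"
  shows "dualA b \<in> carrier A" "col b \<in> N" "\<forall>i\<in>N. i \<noteq> col b \<longrightarrow> dualA b i = \<zero>\<^bsub>F i\<^esub>"
  using assms by (auto simp: dualA_closed BA_iff dualA_incl)

lemma col_I: "p \<in> I \<Longrightarrow> col (snd p) \<in> N"
  using dual_supported(2) by auto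

lemma incl_BA [simp]: "i \<in> N \<Longrightarrow> b \<in> B i \<Longrightarrow> \<iota> i b \<in> BA"
  by (auto simp: BA_iff)

lemma I_colour:
  assumes "i \<in> N"
  shows "{p \<in> I. col (snd p) = i \<and> col (snd p) = i} = (\<lambda>p. (fst p, \<iota> i (snd p))) ` ({..<nat \<bar>k\<bar>} \<times> B i)"
proof (intro Set.set_eqI iffI)
  fix p assume p: "p \<in> {p \<in> I. col (snd p) = i \<and> col (snd p) = i}"
  then obtain l b where l: "l \<in> N" "b \<in> B l" "snd p = \<iota> l b" by (auto simp: BA_iff)
  then have "l = i" using p by simp
  then show "p \<in> (\<lambda>p. (fst p, \<iota> i (snd p))) ` ({..<nat \<bar>k\<bar>} \<times> B i)"
    using p l by (intro image_eqI[of _ _ "(fst p, b)"]) (auto simp: prod_eq_iff)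
next
  fix p assume "p \<in> (\<lambda>p. (fst p, \<iota> i (snd p))) ` ({..<nat \<bar>k\<bar>} \<times> B i)"
  then show "p \<in> {p \<in> I. col (snd p) = i \<and> col (snd p) = i}" using assms by auto
qed

lemma incl_inj_on: "i \<in> N \<Longrightarrow> inj_on (\<lambda>p. (fst p, \<iota> i (snd p))) X"
  by (auto simp: inj_on_def incl_inj prod_eq_iff)

end

text \<open>
  The inversion matrices and the element \<open>\<Sum> dual b \<otimes> b\<close> of the direct sum, cut into colours.
\<close>

locale coloured_frobenius = frobenius_sum R n F tr B k + coloured_tokens R P n x s c d e f xc cc dc sc F \<beta> \<beta>c
  for R :: "'k ring" and n :: nat and F :: "nat \<Rightarrow> ('k, 'a) module"
    and tr :: "nat \<Rightarrow> 'a \<Rightarrow> 'k" and B :: "nat \<Rightarrow> 'a set" and k :: int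
    and P :: "('k, strand, 'g) presentation" and x s c d e f xc cc dc sc \<beta> \<beta>c
begin

abbreviation "dvA p \<equiv> dv (fst p) (dualA (snd p))"
abbreviation "cvA p \<equiv> cv (fst p) (dualA (snd p))"

lemma dv_Hom: "p \<in> I \<Longrightarrow> dvA p \<in> Hom \<C> UD []"
  and cv_Hom: "p \<in> I \<Longrightarrow> cvA p \<in> Hom \<C> [] DU"
  by (auto simp: in_Hom_iff dualA_closed)

lemma dv_E:
  assumes "p \<in> I" "i \<in> N" "j \<in> N"
  shows "dvA p \<cdot> E i j = (if col (snd p) = i \<and> col (snd p) = j then dvA p else zerom UD [])"
  using dv_col(1)[OF dual_supported assms(2,3)] assms(1) by (cases p) simp

lemma cv_G:
  assumes "p \<in> I" "i \<in> N" "j \<in> N"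
  shows "G i j \<cdot> cvA p = (if col (snd p) = i \<and> col (snd p) = j then cvA p else zerom [] DU)"
  using cv_col(1)[OF dual_supported assms(2,3)] assms(1) by (cases p) simp

lemma dvA_incl:
  assumes "i \<in> N" "b \<in> B i" shows "dvA (r, \<iota> i b) = dvc i r (dual i b)"
proof -
  have b: "\<iota> i b \<in> BA" using assms by (auto simp: BA_iff)
  show ?thesis using dv_col(2)[OF dual_supported[OF b]] assms by (simp add: dualA_incl)
qed

lemma cvA_incl:
  assumes "i \<in> N" "b \<in> B i" shows "cvA (r, \<iota> i b) = cvc i r (dual i b)"
proof -
  have b: "\<iota> i b \<in> BA" using assms by (auto simp: BA_iff)
  show ?thesis using cv_col(2)[OF dual_supported[OF b]] assms by (simp add: dualA_incl)
qed

text \<open>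
  The idempotent \<open>e i\<close> on the first strand leaves the terms whose dual basis element lies in the
  \<open>i\<close>-th summand, and \<open>e j\<close> on the second strand those whose basis element lies in the \<open>j\<close>-th.
\<close>

lemma casimir_col:
  assumes ij: "i \<in> N" "j \<in> N"
  shows "hsum UU UU (\<lambda>b. \<beta> (dualA b) \<star> \<beta> b) BA \<cdot> e2 i j
    = (if i = j then hsum UU UU (\<lambda>b. \<beta>c (dual i b) i \<star> \<beta>c b i) (B i) else zerom UU UU)"
proof -
  have ty: "arr (\<beta>c (a i) i)" "src (\<beta>c (a i) i) = [Up]" "tgt (\<beta>c (a i) i) = [Up]" if "a \<in> carrier A" "i \<in> N" for a i
    using that by (simp_all add: \<beta>c)
  have tyc: "arr (\<beta>c a i)" "src (\<beta>c a i) = [Up]" "tgt (\<beta>c a i) = [Up]" if "i \<in> N" "a \<in> carrier (F i)" for a i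
    using ty[of "\<iota> i a" i] that by simp_all
  let ?g = "\<lambda>b. \<beta>c (dualA b i) i \<star> \<beta>c (b j) j"
  have "hsum UU UU (\<lambda>b. \<beta> (dualA b) \<star> \<beta> b) BA \<cdot> e2 i j
    = hsum UU UU (\<lambda>b. (\<beta> (dualA b) \<star> \<beta> b) \<cdot> e2 i j) BA"
    using ij by (subst hsum_comp) (simp_all add: finite_BA dualA_closed BA_carrier)
  also have "\<dots> = hsum UU UU ?g BA"
    by (rule hsum_cong) (use ij in \<open>simp_all add: \<beta>_\<beta>_col dualA_closed BA_carrier ty in_Hom_iff\<close>)
  also have "\<dots> = hsum UU UU ?g (if i = j then \<iota> i ` B i else {})"
  proof (rule hsum_restrict[OF finite_BA])
    show "(if i = j then \<iota> i ` B i else {}) \<subseteq> BA" using ij by auto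
    fix b assume b: "b \<in> BA - (if i = j then \<iota> i ` B i else {})"
    then obtain l b' where l: "l \<in> N" "b' \<in> B l" "b = \<iota> l b'" by (auto simp: BA_iff)
    then have "l \<noteq> i \<or> l \<noteq> j" using b by (auto split: if_splits)
    then show "?g b = zerom UU UU"
      using l ij ty[of b i] ty[of b j] ty[of "dualA b" i] ty[of "dualA b" j] b BA_carrier[of b] dualA_closed[of b]
      by (auto simp: dualA_incl \<beta>c_zero)
  qed (use ij in \<open>auto simp: in_Hom_iff tyc dualA_incl dual_closed B_F split: if_splits\<close>)
  also have "\<dots> = (if i = j then hsum UU UU (\<lambda>b. \<beta>c (dual i b) i \<star> \<beta>c b i) (B i) else zerom UU UU)"
  proof (cases "i = j")
    case True
    have inj: "inj_on (\<iota> i) (B i)" using ij by (simp add: inj_on_def incl_inj)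
    have mem: "\<iota> i b \<in> BA" if "b \<in> B i" for b using that ij by (auto simp: BA_iff)
    have H: "?g (\<iota> i b) \<in> Hom \<C> UU UU" if "b \<in> B i" for b
      using that ij mem by (simp add: in_Hom_iff ty dualA_closed BA_carrier del: incl_apply)
    have "hsum UU UU ?g (\<iota> i ` B i) = hsum UU UU (\<lambda>b. ?g (\<iota> i b)) (B i)"
      by (rule hsum_reindex[OF inj, where f = ?g, OF H])
    also have "\<dots> = hsum UU UU (\<lambda>b. \<beta>c (dual i b) i \<star> \<beta>c b i) (B i)"
    proof (rule hsum_cong)
      fix b assume "b \<in> B i"
      then show "?g (\<iota> i b) = \<beta>c (dual i b) i \<star> \<beta>c b i" "\<beta>c (dual i b) i \<star> \<beta>c b i \<in> Hom \<C> UU UU"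
        using ij True H by (simp_all add: dualA_incl)
    qed simp
    finally show ?thesis using True by simp
  qed simp
  finally show ?thesis .
qed

end

section \<open>Colours in the Frobenius Heisenberg category\<close>

text \<open>
  The Frobenius Heisenberg category of the direct sum; its relations are restated as equations
  between morphisms.
\<close>

locale uncoloured = frobenius_sum R n F tr B k + strands R P
  for R :: "'k ring" and n :: nat and F :: "nat \<Rightarrow> ('k, 'a) module"
    and tr :: "nat \<Rightarrow> 'a \<Rightarrow> 'k" and B :: "nat \<Rightarrow> 'a set" and k :: int
    and P :: "('k, strand, (nat \<Rightarrow> 'a) hgen) presentation" +
  assumes P: "P = heis_presentation R n F tr B k"

context uncoloured
begin

abbreviation "x \<equiv> mor (Gen XGen)"
abbreviation "s \<equiv> mor (Gen SGen)"
abbreviation "c \<equiv> mor (Gen CGen)"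
abbreviation "d \<equiv> mor (Gen DGen)"
abbreviation "\<beta> a \<equiv> mor (Gen (BetaGen a))"
abbreviation "T \<equiv> mor (Gen TInv)"
abbreviation "U r b \<equiv> mor (Gen (UInv r b))"

lemma gen_Hom: "g \<in> heis_gens A BA k \<Longrightarrow> mor (Gen g) \<in> Hom \<C> (heis_source k g) (heis_target k g)"
  using typed.gen[of g P R] unfolding mor_in_Hom by (simp add: P)

lemma ty_gen [simp]:
  "arr x" "src x = [Up]" "tgt x = [Up]" "arr s" "src s = UU" "tgt s = UU"
  "arr c" "src c = []" "tgt c = DU" "arr d" "src d = UD" "tgt d = []"
  "a \<in> carrier A \<Longrightarrow> arr (\<beta> a)" "a \<in> carrier A \<Longrightarrow> src (\<beta> a) = [Up]" "a \<in> carrier A \<Longrightarrow> tgt (\<beta> a) = [Up]"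
  "arr T" "src T = DU" "tgt T = UD"
  using gen_Hom[of XGen] gen_Hom[of SGen] gen_Hom[of CGen] gen_Hom[of DGen] gen_Hom[of "BetaGen a"] gen_Hom[of TInv]
  by (simp_all add: heis_gens_def in_Hom_iff)

lemma U_Hom:
  assumes "r < nat \<bar>k\<bar>" "b \<in> BA"
  shows "U r b \<in> (if k \<ge> 0 then Hom \<C> [] UD else Hom \<C> DU [])"
  using gen_Hom[of "UInv r b"] assms by (auto simp: heis_gens_def)

lemma rel:
  assumes "(f, g) \<in> heis_rels R A trA BA k" "mor f \<in> Hom \<C> X Y" "mor g \<in> Hom \<C> X Y"
  shows "mor f = mor g"
  by (rule relation_holds) (use assms P in auto)

lemma \<beta>_one: "\<beta> \<one>\<^bsub>A\<^esub> = idm [Up]"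
  using rel[OF heis_rels.beta_one, of "[Up]" "[Up]"] by (simp add: in_Hom_iff)

lemma \<beta>_mult: "a \<in> carrier A \<Longrightarrow> b \<in> carrier A \<Longrightarrow> \<beta> a \<cdot> \<beta> b = \<beta> (a \<otimes>\<^bsub>A\<^esub> b)"
  using rel[OF heis_rels.beta_mult, of a b "[Up]" "[Up]"] by (simp add: in_Hom_iff)

lemma \<beta>_add: "a \<in> carrier A \<Longrightarrow> b \<in> carrier A \<Longrightarrow> \<beta> a \<oplus>\<oplus> \<beta> b = \<beta> (a \<oplus>\<^bsub>A\<^esub> b)"
  using rel[OF heis_rels.beta_add, of a b "[Up]" "[Up]"] by (simp add: in_Hom_iff)

lemma \<beta>_smult: "r \<in> carrier R \<Longrightarrow> a \<in> carrier A \<Longrightarrow> HScale \<C> r (\<beta> a) = \<beta> (r \<odot>\<^bsub>A\<^esub> a)"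
  using rel[OF heis_rels.beta_smult, of r a "[Up]" "[Up]"] by (simp add: in_Hom_iff)

lemma s_\<beta>: "a \<in> carrier A \<Longrightarrow> s \<cdot> (\<beta> a \<star> idm [Up]) = (idm [Up] \<star> \<beta> a) \<cdot> s"
  using rel[OF heis_rels.s_beta, of a "UU" "UU"] by (simp add: in_Hom_iff)

lemma s_square: "s \<cdot> s = idm UU"
  using rel[OF heis_rels.s_square, of "UU" "UU"] by (simp add: in_Hom_iff)

lemma x_\<beta>: "a \<in> carrier A \<Longrightarrow> x \<cdot> \<beta> a = \<beta> a \<cdot> x"
  using rel[OF heis_rels.x_beta, of a "[Up]" "[Up]"] by (simp add: in_Hom_iff)

lemma uncoloured_braid: "(s \<star> idm [Up]) \<cdot> (idm [Up] \<star> s) \<cdot> (s \<star> idm [Up]) = (idm [Up] \<star> s) \<cdot> (s \<star> idm [Up]) \<cdot> (idm [Up] \<star> s)"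
  using rel[OF heis_rels.braid, of "[Up, Up, Up]" "[Up, Up, Up]"] by (simp add: in_Hom_iff)

lemma uncoloured_x_s: "(x \<star> idm [Up]) \<cdot> s \<oplus>\<oplus> HScale \<C> (\<ominus>\<^bsub>R\<^esub> \<one>\<^bsub>R\<^esub>) (s \<cdot> (idm [Up] \<star> x))
    = hsum UU UU (\<lambda>b. \<beta> (dualA b) \<star> \<beta> b) BA"
proof -
  have "mor (msum UU UU (\<lambda>b. Gen (BetaGen (dualA b)) \<boxtimes> Gen (BetaGen b)) BA)
    = hsum UU UU (\<lambda>b. \<beta> (dualA b) \<star> \<beta> b) BA"
    by (subst mor_msum) (auto simp: finite_BA in_Hom_iff dualA_closed BA_carrier)
  then show ?thesis
    using rel[OF heis_rels.x_s, of "UU" "UU"] minus_one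
    by (simp add: in_Hom_iff mor_Sub dualA_closed BA_carrier)
qed

lemma uncoloured_zigzag_up: "(d \<star> idm [Up]) \<cdot> (idm [Up] \<star> c) = idm [Up]"
  using rel[OF heis_rels.zigzag_up, of "[Up]" "[Up]"] by (simp add: in_Hom_iff)

lemma zigzag_down: "zz c d = idm [Down]"
  using rel[OF heis_rels.zigzag_down, of "[Down]" "[Down]"] by (simp add: in_Hom_iff zz_def)

end

sublocale uncoloured \<subseteq> Z: zigzag_strands R P c d
  by unfold_locales (simp_all add: in_Hom_iff uncoloured_zigzag_up zigzag_down)

context uncoloured
begin

lemma \<beta>_zero: "\<beta> (\<lambda>i\<in>N. \<zero>\<^bsub>F i\<^esub>) = zerom [Up] [Up]"
proof (rule plus_idem_zerom)
  have z: "(\<lambda>i\<in>N. \<zero>\<^bsub>F i\<^esub>) \<in> carrier A" by (rule restrict_A) simp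
  have "(\<lambda>i\<in>N. \<zero>\<^bsub>F i\<^esub>) \<oplus>\<^bsub>A\<^esub> (\<lambda>i\<in>N. \<zero>\<^bsub>F i\<^esub>) = (\<lambda>i\<in>N. \<zero>\<^bsub>F i\<^esub>)"
    by (rule A_eqI) (use z in auto)
  then show "\<beta> (\<lambda>i\<in>N. \<zero>\<^bsub>F i\<^esub>) \<oplus>\<oplus> \<beta> (\<lambda>i\<in>N. \<zero>\<^bsub>F i\<^esub>) = \<beta> (\<lambda>i\<in>N. \<zero>\<^bsub>F i\<^esub>)"
    using \<beta>_add[OF z z] by simp
  show "\<beta> (\<lambda>i\<in>N. \<zero>\<^bsub>F i\<^esub>) \<in> Hom \<C> [Up] [Up]" using z by (simp add: in_Hom_iff)
qed

lemma \<beta>_incl_zero: "\<beta> (\<iota> i \<zero>\<^bsub>F i\<^esub>) = zerom [Up] [Up]"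
proof -
  have "\<iota> i \<zero>\<^bsub>F i\<^esub> = (\<lambda>i\<in>N. \<zero>\<^bsub>F i\<^esub>)" by (auto simp: summand_incl_def)
  then show ?thesis using \<beta>_zero by simp
qed

lemma \<beta>_sum:
  assumes a: "a \<in> carrier A"
  shows "hsum [Up] [Up] (\<lambda>i. \<beta> (\<iota> i (a i))) N = \<beta> a"
proof -
  have "hsum [Up] [Up] (\<lambda>i. \<beta> (\<iota> i (a i))) S = \<beta> (\<lambda>i\<in>N. if i \<in> S then a i else \<zero>\<^bsub>F i\<^esub>)"
    if "finite S" "S \<subseteq> N" for S
    using that
  proof (induction S rule: finite_induct)
    case empty
    show ?case by (simp only: empty_iff if_False \<beta>_zero hsum_empty)
  next
    case (insert j S)
    have j: "j \<in> N" "\<And>i. i \<in> S \<Longrightarrow> i \<in> N" using insert by auto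
    let ?r = "\<lambda>S. \<lambda>i\<in>N. if i \<in> S then a i else \<zero>\<^bsub>F i\<^esub>"
    have r: "?r S \<in> carrier A" for S by (rule restrict_A) (use a in auto)
    have IH: "hsum [Up] [Up] (\<lambda>i. \<beta> (\<iota> i (a i))) S = \<beta> (?r S)" by (rule insert.IH) (use insert in simp)
    have "hsum [Up] [Up] (\<lambda>i. \<beta> (\<iota> i (a i))) (insert j S)
      = \<beta> (\<iota> j (a j)) \<oplus>\<oplus> hsum [Up] [Up] (\<lambda>i. \<beta> (\<iota> i (a i))) S"
      by (rule hsum_insert) (use insert j a in \<open>auto simp: in_Hom_iff\<close>)
    also have "\<dots> = \<beta> (\<iota> j (a j)) \<oplus>\<oplus> \<beta> (?r S)" by (simp only: IH)
    also have "\<dots> = \<beta> (\<iota> j (a j) \<oplus>\<^bsub>A\<^esub> ?r S)" using j a r by (simp add: \<beta>_add)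
    also have "\<iota> j (a j) \<oplus>\<^bsub>A\<^esub> ?r S = ?r (insert j S)"
      by (rule A_eqI[OF A_closed(3)[OF incl_closed r] r]) (use j a insert in auto)
    finally show ?case .
  qed
  from this[of N] have "hsum [Up] [Up] (\<lambda>i. \<beta> (\<iota> i (a i))) N = \<beta> (\<lambda>i\<in>N. if i \<in> N then a i else \<zero>\<^bsub>F i\<^esub>)" by simp
  also have "(\<lambda>i\<in>N. if i \<in> N then a i else \<zero>\<^bsub>F i\<^esub>) = a"
    by (rule A_eqI[OF restrict_A]) (use a in auto)
  finally show ?thesis .
qed

definition e where "e i = \<beta> (\<iota> i \<one>\<^bsub>F i\<^esub>)"
definition f where "f i = Z.mate (e i)"
definition xc where "xc i = x \<cdot> e i"
definition sc where "sc i j = s \<cdot> lay [] (e i) [Up] \<cdot> lay [Up] (e j) []"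
definition cc where "cc i = lay [Down] (e i) [] \<cdot> c"
definition dc where "dc i = d \<cdot> lay [] (e i) [Down]"
definition \<beta>c where "\<beta>c b i = \<beta> (\<iota> i b)"

lemma ty_e [simp]: "i \<in> N \<Longrightarrow> arr (e i)" "i \<in> N \<Longrightarrow> src (e i) = [Up]" "i \<in> N \<Longrightarrow> tgt (e i) = [Up]"
  by (simp_all add: e_def)

lemma e_Hom': "i \<in> N \<Longrightarrow> e i \<in> Hom \<C> [Up] [Up]"
  by (simp add: in_Hom_iff)

lemma e_mult: "i \<in> N \<Longrightarrow> j \<in> N \<Longrightarrow> e i \<cdot> e j = (if i = j then e i else zerom [Up] [Up])"
proof -
  assume ij: "i \<in> N" "j \<in> N"
  have "\<iota> i \<one>\<^bsub>F i\<^esub> \<otimes>\<^bsub>A\<^esub> \<iota> j \<one>\<^bsub>F j\<^esub> = \<iota> i (if i = j then \<one>\<^bsub>F i\<^esub> else \<zero>\<^bsub>F i\<^esub>)"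
    by (rule A_eqI) (use ij in auto)
  then show ?thesis using ij by (simp add: e_def \<beta>_mult \<beta>_incl_zero)
qed

lemma e_sum': "hsum [Up] [Up] e N = idm [Up]"
proof -
  have "hsum [Up] [Up] e N = hsum [Up] [Up] (\<lambda>i. \<beta> (\<iota> i (\<one>\<^bsub>A\<^esub> i))) N"
    by (rule hsum_cong) (auto simp: e_def in_Hom_iff)
  then show ?thesis using \<beta>_sum[OF A_closed(1)] \<beta>_one by simp
qed

text \<open>
  The relation between crossings and tokens moves a token that starts on the first strand.  The
  other slide follows from it because \<open>s\<close> is its own inverse.
\<close>

lemma s_slide': assumes i: "i \<in> N"
  shows "lay [Up] (e i) [] \<cdot> s = s \<cdot> lay [] (e i) [Up]" "lay [] (e i) [Up] \<cdot> s = s \<cdot> lay [Up] (e i) []"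
proof -
  show *: "lay [Up] (e i) [] \<cdot> s = s \<cdot> lay [] (e i) [Up]"
    using s_\<beta>[of "\<iota> i \<one>\<^bsub>F i\<^esub>"] i by (simp add: e_def tens_lay)
  have "lay [] (e i) [Up] \<cdot> s = (s \<cdot> s) \<cdot> lay [] (e i) [Up] \<cdot> s" using i by (simp add: s_square)
  also have "\<dots> = s \<cdot> (s \<cdot> lay [] (e i) [Up]) \<cdot> s" by simp
  also have "\<dots> = s \<cdot> lay [Up] (e i) [] \<cdot> s \<cdot> s" by (simp add: *[symmetric])
  also have "\<dots> = s \<cdot> lay [Up] (e i) []" using i by (simp add: s_square)
  finally show "lay [] (e i) [Up] \<cdot> s = s \<cdot> lay [Up] (e i) []" .
qed

lemma f_sum': "hsum [Down] [Down] f N = idm [Down]"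
proof -
  have "Z.mate (hsum [Up] [Up] e N) = hsum [Down] [Down] (\<lambda>i. Z.mate (e i)) N"
    by (rule Z.mate_hsum) (simp_all add: e_Hom')
  then show ?thesis by (simp add: f_def[abs_def] e_sum' Z.mate_idm)
qed

end

sublocale uncoloured \<subseteq> C: coloured_frobenius R n F tr B k P x s c d e f xc cc dc sc \<beta> \<beta>c
proof unfold_locales
  fix i assume i: "i \<in> {1..n}"
  show "f i \<in> Hom \<C> [Down] [Down]" unfolding f_def by (rule Z.mate_Hom[OF e_Hom'[OF i]])
  show "lay [] (f i) [Up] \<cdot> c = lay [Down] (e i) [] \<cdot> c" unfolding f_def by (rule Z.mate_c[OF e_Hom'[OF i]])
  show "d \<cdot> lay [Up] (f i) [] = d \<cdot> lay [] (e i) [Down]" unfolding f_def by (rule Z.mate_d[OF e_Hom'[OF i]])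
  show "e i \<cdot> x = xc i" using x_\<beta>[of "\<iota> i \<one>\<^bsub>F i\<^esub>"] i by (simp add: xc_def e_def)
next
  fix i j assume ij: "i \<in> {1..n}" "j \<in> {1..n}"
  show "f i \<cdot> f j = (if i = j then f i else zerom [Down] [Down])"
    unfolding f_def using Z.mate_comp[OF e_Hom'[OF ij(2)] e_Hom'[OF ij(1)]] ij e_mult[OF ij(2,1)]
    by (simp add: Z.mate_zerom)
next
  fix a i assume a: "a \<in> carrier A" and i: "i \<in> {1..n}"
  have "a \<otimes>\<^bsub>A\<^esub> \<iota> i \<one>\<^bsub>F i\<^esub> = \<iota> i (a i)" "\<iota> i \<one>\<^bsub>F i\<^esub> \<otimes>\<^bsub>A\<^esub> a = \<iota> i (a i)"
    by (rule A_eqI; use a i in auto)+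
  then show "\<beta> a \<cdot> e i = \<beta>c (a i) i" "e i \<cdot> \<beta> a = \<beta>c (a i) i"
    using a i by (simp_all add: e_def \<beta>c_def \<beta>_mult)
qed (simp_all add: in_Hom_iff e_mult e_sum' f_sum' s_slide' xc_def sc_def cc_def dc_def \<beta>c_def \<beta>_incl_zero)

context uncoloured
begin

abbreviation "UA p \<equiv> U (fst p) (snd p)"

lemma UA_Hom: "k \<ge> 0 \<Longrightarrow> p \<in> I \<Longrightarrow> UA p \<in> Hom \<C> [] UD"
  "k < 0 \<Longrightarrow> p \<in> I \<Longrightarrow> UA p \<in> Hom \<C> DU []"
  using U_Hom[of "fst p" "snd p"] by auto

lemma T_Hom: "T \<in> Hom \<C> DU UD"
  by (simp add: in_Hom_iff)

text \<open>
  The adjoined relations for \<open>k \<ge> 0\<close> and for \<open>k < 0\<close> as statements about inverse matrices.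
\<close>

lemma inversion_column:
  assumes k: "k \<ge> 0"
  shows "column_inv (idm UD) C.t C.dvA I T UA (idm DU)"
proof -
  let ?t = "rotated_crossing (Gen SGen) (Gen CGen) (Gen DGen)"
  let ?d = "\<lambda>(r, b). Gen DGen \<bullet> ((mpow \<one>\<^sub>+ (Gen XGen) r \<bullet> Gen (BetaGen (dualA b))) \<boxtimes> \<one>\<^sub>-)"
  let ?u = "\<lambda>(r, b). Gen (UInv r b)"
  have I: "{..<nat k} \<times> BA = I" using k by simp
  have d: "mor (?d p) = C.dvA p" for p by (simp add: case_prod_unfold C.dv_def C.tok_def)
  have u: "mor (?u p) = UA p" for p by (simp add: case_prod_unfold)
  have t: "mor ?t = C.t" by (simp add: mor_rotated C.t_def)
  have "\<forall>(a, b) \<in> column_inverse UD (Idt UD) DU (Idt DU) ?t ?d I (Gen TInv) ?u. mor a = mor b"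
  proof clarify
    fix a b :: "('k, strand, (nat \<Rightarrow> 'a) hgen) mterm"
    assume ab: "(a, b) \<in> column_inverse UD (Idt UD) DU (Idt DU) ?t ?d I (Gen TInv) ?u"
    obtain X Y where "mor a \<in> Hom \<C> X Y" "mor b \<in> Hom \<C> X Y"
      using column_inverse_Hom[OF finite_I _ _ _ _ _ _ ab] C.dv_Hom UA_Hom(1)[OF k]
      by (auto simp: d u t in_Hom_iff)
    then show "mor a = mor b" using heis_rels.inversion_nonneg[OF k ab[folded I]] rel by blast
  qed
  then show ?thesis
    by (subst (asm) mor_column_inverse) (use finite_I C.dv_Hom UA_Hom(1)[OF k] in \<open>simp_all only: d u t mor_Idt, auto simp: in_Hom_iff\<close>)
qed

lemma inversion_row:
  assumes k: "k < 0"
  shows "row_inv (idm UD) C.t C.cvA I T UA (idm DU)"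
proof -
  let ?t = "rotated_crossing (Gen SGen) (Gen CGen) (Gen DGen)"
  let ?c = "\<lambda>(r, b). (\<one>\<^sub>- \<boxtimes> (mpow \<one>\<^sub>+ (Gen XGen) r \<bullet> Gen (BetaGen (dualA b)))) \<bullet> Gen CGen"
  let ?u = "\<lambda>(r, b). Gen (UInv r b)"
  have I: "{..<nat (- k)} \<times> BA = I" using k by simp
  have c: "mor (?c p) = C.cvA p" for p by (simp add: case_prod_unfold C.cv_def C.tok_def)
  have u: "mor (?u p) = UA p" for p by (simp add: case_prod_unfold)
  have t: "mor ?t = C.t" by (simp add: mor_rotated C.t_def)
  have "\<forall>(a, b) \<in> row_inverse UD (Idt UD) DU (Idt DU) ?t ?c I (Gen TInv) ?u. mor a = mor b"
  proof clarify
    fix a b :: "('k, strand, (nat \<Rightarrow> 'a) hgen) mterm"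
    assume ab: "(a, b) \<in> row_inverse UD (Idt UD) DU (Idt DU) ?t ?c I (Gen TInv) ?u"
    obtain X Y where "mor a \<in> Hom \<C> X Y" "mor b \<in> Hom \<C> X Y"
      using row_inverse_Hom[OF finite_I _ _ _ _ _ _ ab] C.cv_Hom UA_Hom(2)[OF k]
      by (auto simp: c u t in_Hom_iff)
    then show "mor a = mor b" using heis_rels.inversion_neg[OF k ab[folded I]] rel by blast
  qed
  then show ?thesis
    by (subst (asm) mor_row_inverse) (use finite_I C.cv_Hom UA_Hom(2)[OF k] in \<open>simp_all only: c u t mor_Idt, auto simp: in_Hom_iff\<close>)
qed

lemma T_G:
  assumes "i \<in> N" "j \<in> N" shows "T \<cdot> C.G i j = C.E i j \<cdot> T"
proof (cases "k \<ge> 0")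
  case True
  show ?thesis
    by (rule C.column_links(1)[OF finite_I T_Hom UA_Hom(1)[OF True] C.dv_Hom C.dv_E inversion_column[OF True] assms])
next
  case False
  then have k: "k < 0" by simp
  show ?thesis
    by (rule C.row_links(1)[OF finite_I T_Hom UA_Hom(2)[OF k] C.cv_Hom C.cv_G inversion_row[OF k] assms])
qed

lemma E_U:
  assumes "k \<ge> 0" "p \<in> I" "i \<in> N" "j \<in> N"
  shows "C.E i j \<cdot> UA p = (if col (snd p) = i \<and> col (snd p) = j then UA p else zerom [] UD)"
  by (rule C.column_links(2)[OF finite_I T_Hom UA_Hom(1)[OF assms(1)] C.dv_Hom C.dv_E
      inversion_column[OF assms(1)] assms(3,4,2)])

lemma U_G:
  assumes "k < 0" "p \<in> I" "i \<in> N" "j \<in> N"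
  shows "UA p \<cdot> C.G i j = (if col (snd p) = i \<and> col (snd p) = j then UA p else zerom DU [])"
  by (rule C.row_links(2)[OF finite_I T_Hom UA_Hom(2)[OF assms(1)] C.cv_Hom C.cv_G
      inversion_row[OF assms(1)] assms(3,4,2)])

lemma coloured_column:
  assumes "k \<ge> 0" "i \<in> N" "j \<in> N"
  shows "column_inv (C.E i j) (C.tc i j) C.dvA {p \<in> I. col (snd p) = i \<and> col (snd p) = j} (T \<cdot> C.G i j) UA (C.G i j)"
proof -
  have "\<forall>i\<in>N. \<forall>j\<in>N. column_inv (C.E i j) (C.tc i j) C.dvA {p \<in> I. col (snd p) = i \<and> col (snd p) = j}
      (T \<cdot> C.G i j) UA (C.G i j)"
    by (rule iffD1[OF C.column_inv_col[OF finite_I T_Hom UA_Hom(1)[OF assms(1)] C.dv_Hom col_I C.dv_E T_G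
          E_U[OF assms(1)]] inversion_column[OF assms(1)]])
  from this[THEN bspec, OF assms(2), THEN bspec, OF assms(3)] show ?thesis .
qed

lemma coloured_row:
  assumes "k < 0" "i \<in> N" "j \<in> N"
  shows "row_inv (C.E i j) (C.tc i j) C.cvA {p \<in> I. col (snd p) = i \<and> col (snd p) = j} (T \<cdot> C.G i j) UA (C.G i j)"
proof -
  have "\<forall>i\<in>N. \<forall>j\<in>N. row_inv (C.E i j) (C.tc i j) C.cvA {p \<in> I. col (snd p) = i \<and> col (snd p) = j}
      (T \<cdot> C.G i j) UA (C.G i j)"
    by (rule iffD1[OF C.row_inv_col[OF finite_I T_Hom UA_Hom(2)[OF assms(1)] C.cv_Hom col_I C.cv_G T_G
          U_G[OF assms(1)]] inversion_row[OF assms(1)]])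
  from this[THEN bspec, OF assms(2), THEN bspec, OF assms(3)] show ?thesis .
qed

end

section \<open>The functor from the coloured presentation\<close>

context uncoloured
begin

lemma mor_up [simp]: "mor (up_strand i) = e i"
  by (simp add: up_strand_def e_def)

lemma mor_cup_cap [simp]: "i \<in> N \<Longrightarrow> mor (cup i) = cc i" "i \<in> N \<Longrightarrow> mor (cap i) = dc i"
  by (simp_all add: cup_def cap_def cc_def dc_def tens_lay)

lemma zz_col [simp]: "i \<in> N \<Longrightarrow> zz (cc i) (dc i) = f i"
  using Z.zz_mate[OF e_Hom', of i] e_mult[of i i] by (simp add: cc_def dc_def f_def)

lemma mor_split:
  "i \<in> N \<Longrightarrow> mor (split (XGen' i)) = xc i" "i \<in> N \<Longrightarrow> j \<in> N \<Longrightarrow> mor (split (SGen' i j)) = sc i j"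
  "mor (split (BetaGen' b i)) = \<beta>c b i" "i \<in> N \<Longrightarrow> j \<in> N \<Longrightarrow> mor (split (TInv' i j)) = T \<cdot> C.G i j"
  "mor (split (UInv' i r b)) = UA (r, \<iota> i b)"
  "i \<in> N \<Longrightarrow> mor (split (CGen' i)) = cc i" "i \<in> N \<Longrightarrow> mor (split (DGen' i)) = dc i"
  by (simp_all add: xc_def sc_def \<beta>c_def C.G_def tens_lay)

declare split.simps [simp del]

lemma mor_split_strands [simp]:
  "mor (msubst split (up_col F i)) = e i" "i \<in> N \<Longrightarrow> mor (msubst split (down_col i)) = f i"
  "i \<in> N \<Longrightarrow> j \<in> N \<Longrightarrow> mor (msubst split (t_col i j)) = C.tc i j"
proof -
  show "mor (msubst split (up_col F i)) = e i" by (simp add: up_col_def e_def split.simps)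
  show "i \<in> N \<Longrightarrow> mor (msubst split (down_col i)) = f i" by (simp add: down_col_def split.simps)
  show "i \<in> N \<Longrightarrow> j \<in> N \<Longrightarrow> mor (msubst split (t_col i j)) = C.tc i j"
    by (simp add: t_col_def mor_rotated C.tc_def sc_def tens_lay split.simps)
qed

lemma split_typed:
  assumes "g \<in> col_heis_gens n F B k"
  shows "mor (split g) \<in> Hom \<C> (col_heis_source k g) (col_heis_target k g)"
proof (cases g)
  case (UInv' i r b)
  then have "(r, \<iota> i b) \<in> I" using assms by (auto simp: col_heis_gens_def)
  then show ?thesis using UA_Hom UInv' by (auto simp: mor_split)
qed (use assms in \<open>auto simp: col_heis_gens_def in_Hom_iff mor_split \<beta>c_def\<close>)

lemma \<beta>c_rules:
  assumes "i \<in> N" "a \<in> carrier (F i)" "b \<in> carrier (F i)"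
  shows "\<beta>c a i \<cdot> \<beta>c b i = \<beta>c (a \<otimes>\<^bsub>F i\<^esub> b) i" "\<beta>c a i \<oplus>\<oplus> \<beta>c b i = \<beta>c (a \<oplus>\<^bsub>F i\<^esub> b) i"
    "r \<in> carrier R \<Longrightarrow> HScale \<C> r (\<beta>c a i) = \<beta>c (r \<odot>\<^bsub>F i\<^esub> a) i"
  using assms by (simp_all add: \<beta>c_def \<beta>_mult \<beta>_add \<beta>_smult incl_hom)

lemma \<beta>c_orth:
  assumes "i \<in> N" "j \<in> N" "i \<noteq> j" "a \<in> carrier (F i)" "b \<in> carrier (F j)"
  shows "\<beta>c a i \<cdot> \<beta>c b j = zerom [Up] [Up]"
proof -
  have "\<iota> i a \<otimes>\<^bsub>A\<^esub> \<iota> j b = \<iota> i \<zero>\<^bsub>F i\<^esub>" by (rule A_eqI) (use assms in auto)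
  then show ?thesis using assms by (simp add: \<beta>c_def \<beta>_mult \<beta>_incl_zero)
qed

lemma T_G_idem: "i \<in> N \<Longrightarrow> j \<in> N \<Longrightarrow> C.E i j \<cdot> (T \<cdot> C.G i j) \<cdot> C.G i j = T \<cdot> C.G i j"
  using T_G[of i j] C.EG_orth[of i j i j] by (metis comp_assoc_total)

text \<open>
  No entry of the matrix other than \<open>t\<close> connects two different colours.
\<close>

lemma distinct_inverse:
  assumes "i \<in> N" "j \<in> N" "i \<noteq> j"
  shows "T \<cdot> C.G i j \<cdot> C.tc i j = C.E i j" "C.tc i j \<cdot> T \<cdot> C.G i j = C.G i j"
proof -
  have empty: "{p \<in> I. col (snd p) = i \<and> col (snd p) = j} = {}" using assms by auto
  have "T \<cdot> C.G i j \<cdot> C.tc i j = C.E i j \<and> C.tc i j \<cdot> T \<cdot> C.G i j = C.G i j"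
  proof (cases "k \<ge> 0")
    case True
    then show ?thesis using coloured_column[OF _ assms(1,2)] assms unfolding empty by (simp add: inverse_pair_def)
  next
    case False
    then show ?thesis using coloured_row[OF _ assms(1,2)] assms unfolding empty by (simp add: inverse_pair_def)
  qed
  then show "T \<cdot> C.G i j \<cdot> C.tc i j = C.E i j" "C.tc i j \<cdot> T \<cdot> C.G i j = C.G i j" by auto
qed

text \<open>
  Each coloured relation is a component of the corresponding uncoloured one or expresses that the
  images of the generators are components.
\<close>

lemma split_respects:
  assumes "(lhs, rhs) \<in> col_heis_rels R n F tr B k"
  shows "mor (msubst split lhs) = mor (msubst split rhs)"
  using assms
proof (cases rule: col_heis_rels.cases)
  case (col_beta_orth i j a b)
  then show ?thesis by (simp add: mor_split \<beta>c_orth)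
next
  case col_up_sum
  have "mor (msubst split lhs) = hsum [Up] [Up] e N"
    unfolding col_up_sum(1) msubst_msum by (subst mor_msum) (simp_all add: e_Hom')
  then show ?thesis using col_up_sum by (simp add: e_sum')
next
  case (col_down_orth i j)
  then show ?thesis by (simp add: C.f_orth)
next
  case col_down_sum
  have "mor (msubst split lhs) = hsum [Down] [Down] (\<lambda>i. mor (msubst split (down_col i))) N"
    unfolding col_down_sum(1) msubst_msum by (subst mor_msum) (simp_all add: C.f_Hom)
  also have "\<dots> = hsum [Down] [Down] f N" by (rule hsum_cong) (simp_all add: C.f_Hom)
  finally show ?thesis using col_down_sum by (simp add: f_sum')
next
  case (col_s i j)
  then show ?thesis by (simp add: mor_split C.sc tens_lay C.push)
next
  case (col_x i)
  then show ?thesis by (simp add: mor_split C.xc C.push)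
next
  case (col_c i)
  have "(f i \<star> e i) \<cdot> cc i = lay [Down] (e i) [] \<cdot> c"
  proof -
    have "(f i \<star> e i) \<cdot> cc i = lay [] (f i) [Up] \<cdot> lay [Down] (e i) [] \<cdot> lay [Down] (e i) [] \<cdot> c"
      using col_c by (simp add: cc_def tens_lay)
    also have "\<dots> = lay [Down] (e i) [] \<cdot> lay [] (f i) [Up] \<cdot> c"
      using col_c exchange[of "f i" "e i" "[]" "[]" "[]", THEN comp_trail] C.lay_idem(1)[of i, THEN comp_trail]
      by simp
    also have "\<dots> = lay [Down] (e i) [] \<cdot> c" using col_c C.c_slide C.lay_idem(1)[of i, THEN comp_trail] by simp
    finally show ?thesis .
  qed
  then show ?thesis using col_c by (simp add: mor_split cc_def)
next
  case (col_d i)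
  have "dc i \<cdot> (e i \<star> f i) = d \<cdot> lay [] (e i) [Down]"
  proof -
    have "dc i \<cdot> (e i \<star> f i) = d \<cdot> lay [] (e i) [Down] \<cdot> lay [Up] (f i) []"
      using col_d C.lay_idem(1)[of i "[]" "[Down]", THEN comp_trail] by (simp add: dc_def tens_lay)
    also have "\<dots> = d \<cdot> lay [Up] (f i) [] \<cdot> lay [] (e i) [Down]"
      using col_d exchange[of "e i" "f i" "[]" "[]" "[]"] by simp
    also have "\<dots> = d \<cdot> lay [] (e i) [Down]"
      using col_d C.d_slide[of i, THEN comp_trail] C.lay_idem(1)[of i "[]" "[Down]"] by simp
    finally show ?thesis .
  qed
  then show ?thesis using col_d by (simp add: mor_split dc_def)
next
  case (beta_add i a b)
  then show ?thesis by (simp add: mor_split \<beta>c_rules)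
next
  case (beta_smult i r a)
  then show ?thesis by (simp add: mor_split \<beta>c_rules)
next
  case (beta_mult i a b)
  then show ?thesis by (simp add: mor_split \<beta>c_rules)
next
  case (braid i j l)
  then show ?thesis using C.braid_col[of i j l] uncoloured_braid by (simp add: mor_split)
next
  case (s_inverse i j)
  then show ?thesis using C.square_col[of i j] s_square by (simp add: mor_split del: comp_assoc_total)
next
  case (x_beta i b)
  then show ?thesis using C.x_\<beta>_col[of "\<iota> i b" i] x_\<beta>[of "\<iota> i b"] by (simp add: mor_split del: comp_assoc_total)
next
  case (s_beta i j b)
  then show ?thesis using C.s_\<beta>_col[of "\<iota> i b" i j] s_\<beta>[of "\<iota> i b"] by (simp add: mor_split del: comp_assoc_total)
next
  case (x_s i j)
  note ij = x_s(3,4)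
  let ?p = "C.e2 i j"
  have "((x \<star> idm [Up]) \<cdot> s \<oplus>\<oplus> HScale \<C> (\<ominus>\<^bsub>R\<^esub> \<one>\<^bsub>R\<^esub>) (s \<cdot> (idm [Up] \<star> x))) \<cdot> ?p
    = ((x \<star> idm [Up]) \<cdot> s) \<cdot> ?p \<oplus>\<oplus> HScale \<C> (\<ominus>\<^bsub>R\<^esub> \<one>\<^bsub>R\<^esub>) ((s \<cdot> (idm [Up] \<star> x)) \<cdot> ?p)"
    using ij minus_one by (simp del: comp_assoc_total)
  also have "\<dots> = mor (msubst split lhs)"
    using ij C.x_s_col[OF ij] by (simp add: x_s(1) mor_Sub mor_split del: comp_assoc_total)
  finally have l: "mor (msubst split lhs) = hsum UU UU (\<lambda>b. \<beta> (dualA b) \<star> \<beta> b) BA \<cdot> ?p"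
    by (simp only: uncoloured_x_s)
  have "mor (msubst split rhs) = (if i = j then hsum UU UU (\<lambda>b. \<beta>c (dual i b) i \<star> \<beta>c b i) (B i) else zerom UU UU)"
  proof (cases "i = j")
    case True
    then show ?thesis unfolding x_s(2) using ij
      by (simp, subst mor_msum)
        (auto simp: finite_B mor_split in_Hom_iff \<beta>c_def dual_closed B_F)
  qed (simp add: x_s(2))
  then show ?thesis unfolding l by (simp only: C.casimir_col[OF ij])
next
  case (zigzag_up i)
  then show ?thesis using C.zigzag_up_col[of i] uncoloured_zigzag_up by (simp add: mor_split del: comp_assoc_total)
next
  case (zigzag_down i)
  then show ?thesis by (simp add: mor_split down_col_def)
next
  case (inversion_distinct i j)
  then show ?thesis using distinct_inverse[of i j] T_G_idem[of i j]
    by (auto simp: mor_split C.E_def[symmetric] C.G_def[symmetric])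
next
  case (inversion_nonneg i)
  let ?J = "{..<nat k} \<times> B i" and ?E = "up_col F i \<boxtimes> down_col i" and ?G = "down_col i \<boxtimes> up_col F i"
  let ?d = "\<lambda>(r, b). Gen (DGen' i) \<bullet> ((mpow (up_col F i) (Gen (XGen' i)) r \<bullet> Gen (BetaGen' (dual i b) i)) \<boxtimes> \<one>\<^sub>-)"
  let ?u = "\<lambda>(r, b). Gen (UInv' i r b)"
  let ?h = "\<lambda>p. (fst p, \<iota> i (snd p))"
  have i: "i \<in> N" and k: "k \<ge> 0" and J: "{..<nat \<bar>k\<bar>} \<times> B i = ?J" "finite ?J" using inversion_nonneg finite_B by simp_all
  have E: "mor (msubst split ?E) = C.E i i" "mor (msubst split ?G) = C.G i i"
    using i by (simp_all add: C.E_def C.G_def)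
  have d: "mor (msubst split (?d p)) = C.dvA (?h p)" and u: "mor (msubst split (?u p)) = UA (?h p)" if "p \<in> ?J" for p
    using that i C.dvA_incl[of i "snd p" "fst p"]
    by (auto simp: case_prod_unfold mor_split C.dvc_def C.tokc_def)
  have hI: "?h p \<in> I" if "p \<in> ?J" for p using that i k by auto
  have H: "UA (?h p) \<cdot> C.dvA (?h p) \<in> Hom \<C> UD UD" if "p \<in> ?J" for p
    using UA_Hom(1)[OF k hI[OF that]] C.dv_Hom[OF hI[OF that]] by (simp add: in_Hom_iff)
  have "column_inv (C.E i i) (C.tc i i) C.dvA (?h ` ?J) (T \<cdot> C.G i i) UA (C.G i i)"
    using coloured_column[OF k i i] by (simp only: I_colour[OF i] J)
  then have inv: "column_inv (C.E i i) (C.tc i i) (\<lambda>p. C.dvA (?h p)) ?J (T \<cdot> C.G i i) (\<lambda>p. UA (?h p)) (C.G i i)"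
    by (subst (asm) inverse_pair_reindex[OF incl_inj_on[OF i]]) (use H in auto)
  have "column_inv (C.E i i) (C.tc i i) (\<lambda>p. mor (msubst split (?d p))) ?J (T \<cdot> C.G i i)
      (\<lambda>p. mor (msubst split (?u p))) (C.G i i)"
    by (rule iffD2[OF inverse_pair_cong inv]) (simp_all only: d u H)
  moreover have "C.E i i \<cdot> UA (?h p) = UA (?h p)" if "p \<in> ?J" for p
    using E_U[OF k hI[OF that] i i] col_incl[OF i, of "snd p"] that by (simp add: mem_Times_iff)
  ultimately have "\<forall>(a, b) \<in> column_inverse UD (msubst split ?E) DU (msubst split ?G)
      (msubst split (t_col i i)) (\<lambda>p. msubst split (?d p)) ?J (msubst split (Gen (TInv' i i))) (\<lambda>p. msubst split (?u p)). mor a = mor b"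
    by (subst mor_column_inverse) (use J(2) i E d u H T_G_idem[OF i i] in \<open>simp_all add: mor_split\<close>)
  from this[THEN bspec, OF msubst_column_inverse[OF inversion_nonneg(3)]] show ?thesis by simp
next
  case (inversion_neg i)
  let ?J = "{..<nat (- k)} \<times> B i" and ?E = "up_col F i \<boxtimes> down_col i" and ?G = "down_col i \<boxtimes> up_col F i"
  let ?c = "\<lambda>(r, b). (\<one>\<^sub>- \<boxtimes> (mpow (up_col F i) (Gen (XGen' i)) r \<bullet> Gen (BetaGen' (dual i b) i))) \<bullet> Gen (CGen' i)"
  let ?u = "\<lambda>(r, b). Gen (UInv' i r b)"
  let ?h = "\<lambda>p. (fst p, \<iota> i (snd p))"
  have i: "i \<in> N" and k: "k < 0" and J: "{..<nat \<bar>k\<bar>} \<times> B i = ?J" "finite ?J" using inversion_neg finite_B by simp_all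
  have E: "mor (msubst split ?E) = C.E i i" "mor (msubst split ?G) = C.G i i"
    using i by (simp_all add: C.E_def C.G_def)
  have c: "mor (msubst split (?c p)) = C.cvA (?h p)" and u: "mor (msubst split (?u p)) = UA (?h p)" if "p \<in> ?J" for p
    using that i C.cvA_incl[of i "snd p" "fst p"]
    by (auto simp: case_prod_unfold mor_split C.cvc_def C.tokc_def)
  have hI: "?h p \<in> I" if "p \<in> ?J" for p using that i k by auto
  have H: "C.cvA (?h p) \<cdot> UA (?h p) \<in> Hom \<C> DU DU" if "p \<in> ?J" for p
    using UA_Hom(2)[OF k hI[OF that]] C.cv_Hom[OF hI[OF that]] by (simp add: in_Hom_iff)
  have "row_inv (C.E i i) (C.tc i i) C.cvA (?h ` ?J) (T \<cdot> C.G i i) UA (C.G i i)"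
    using coloured_row[OF k i i] by (simp only: I_colour[OF i] J)
  then have inv: "row_inv (C.E i i) (C.tc i i) (\<lambda>p. C.cvA (?h p)) ?J (T \<cdot> C.G i i) (\<lambda>p. UA (?h p)) (C.G i i)"
    by (subst (asm) inverse_pair_reindex[OF incl_inj_on[OF i]]) (use H in auto)
  have "row_inv (C.E i i) (C.tc i i) (\<lambda>p. mor (msubst split (?c p))) ?J (T \<cdot> C.G i i)
      (\<lambda>p. mor (msubst split (?u p))) (C.G i i)"
    by (rule iffD2[OF inverse_pair_cong inv]) (simp_all only: c u H)
  moreover have "UA (?h p) \<cdot> C.G i i = UA (?h p)" if "p \<in> ?J" for p
    using U_G[OF k hI[OF that] i i] col_incl[OF i, of "snd p"] that by (simp add: mem_Times_iff)
  ultimately have "\<forall>(a, b) \<in> row_inverse UD (msubst split ?E) DU (msubst split ?G)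
      (msubst split (t_col i i)) (\<lambda>p. msubst split (?c p)) ?J (msubst split (Gen (TInv' i i))) (\<lambda>p. msubst split (?u p)). mor a = mor b"
    by (subst mor_row_inverse) (use J(2) i E c u H T_G_idem[OF i i] in \<open>simp_all add: mor_split\<close>)
  from this[THEN bspec, OF msubst_row_inverse[OF inversion_neg(3)]] show ?thesis by simp
qed


text \<open>
  An uncoloured generator is the sum of its components, because the idempotents sum to \<open>1\<close>.
\<close>

lemma sum_colours_T: "hsum DU UD (\<lambda>p. T \<cdot> C.G (fst p) (snd p)) (N \<times> N) = T"
proof (rule C.G_faithful[where Y = "UD"])
  fix i j assume ij: "i \<in> N" "j \<in> N"
  have "hsum DU UD (\<lambda>p. T \<cdot> C.G (fst p) (snd p)) (N \<times> N) \<cdot> C.G i j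
    = hsum DU UD (\<lambda>p. T \<cdot> C.G (fst p) (snd p) \<cdot> C.G i j) (N \<times> N)"
    using ij by (subst hsum_comp) auto
  also have "\<dots> = T \<cdot> C.G (fst (i, j)) (snd (i, j)) \<cdot> C.G i j"
    by (rule hsum_single) (use ij in \<open>auto simp: C.EG_orth in_Hom_iff split: if_splits\<close>)
  also have "\<dots> = T \<cdot> C.G i j" using ij by (simp add: C.EG_orth)
  finally show "hsum DU UD (\<lambda>p. T \<cdot> C.G (fst p) (snd p)) (N \<times> N) \<cdot> C.G i j = T \<cdot> C.G i j" .
qed (rule hsum_Hom, auto simp: in_Hom_iff)

lemma sum_colours_s: "hsum UU UU (\<lambda>p. sc (fst p) (snd p)) (N \<times> N) = s"
proof (rule C.EE_faithful[where Y = "UU"])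
  fix i j assume ij: "i \<in> N" "j \<in> N"
  let ?p = "C.e2 i j"
  have p: "(e i' \<star> e j') \<cdot> ?p = (if i' = i \<and> j' = j then ?p else zerom UU UU)"
    if "i' \<in> N" "j' \<in> N" for i' j'
  proof -
    have "(e i' \<star> e j') \<cdot> ?p = (e i' \<star> e j') \<cdot> (e i \<star> e j)" using ij by (simp add: tens_lay)
    also have "\<dots> = (e i' \<cdot> e i) \<star> (e j' \<cdot> e j)" using ij that by (simp add: interchange')
    also have "\<dots> = (if i' = i \<and> j' = j then e i \<star> e j else zerom UU UU)"
      using ij that by (simp add: e_mult)
    finally show ?thesis using ij by (simp add: tens_lay)
  qed
  have sc: "sc i' j' = s \<cdot> (e i' \<star> e j')" if "i' \<in> N" "j' \<in> N" for i' j'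
    using that by (simp add: sc_def tens_lay)
  have scp: "sc i' j' \<cdot> ?p = (if i' = i \<and> j' = j then s \<cdot> ?p else zerom UU UU)"
    if "i' \<in> N" "j' \<in> N" for i' j' using p[OF that] that ij by (simp add: sc)
  have "hsum UU UU (\<lambda>p. sc (fst p) (snd p)) (N \<times> N) \<cdot> ?p
    = hsum UU UU (\<lambda>p. sc (fst p) (snd p) \<cdot> ?p) (N \<times> N)"
    using ij by (subst hsum_comp) auto
  also have "\<dots> = sc (fst (i, j)) (snd (i, j)) \<cdot> ?p"
    by (rule hsum_single) (use ij scp in \<open>auto simp: in_Hom_iff split: if_splits\<close>)
  also have "\<dots> = s \<cdot> ?p" using ij scp by simp
  finally show "hsum UU UU (\<lambda>p. sc (fst p) (snd p)) (N \<times> N) \<cdot> ?p = s \<cdot> ?p" .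
qed (rule hsum_Hom, auto simp: in_Hom_iff)

lemma split_merge:
  assumes g: "g \<in> heis_gens A BA k"
  shows "mor (msubst split (merge g)) = mor (Gen g)"
proof (cases g)
  case XGen
  have "x = x \<cdot> hsum [Up] [Up] e N" by (simp add: e_sum')
  also have "\<dots> = hsum [Up] [Up] xc N" by (simp add: comp_hsum xc_def[abs_def])
  finally have x: "hsum [Up] [Up] xc N = x" by simp
  show ?thesis unfolding XGen x[symmetric] merge.simps msubst_msum msubst.simps
    by (rule mor_msum_eq) (auto simp: mor_split in_Hom_iff)
next
  case SGen
  show ?thesis unfolding SGen sum_colours_s[symmetric] merge.simps msubst_msum msubst.simps
    by (rule mor_msum_eq) (auto simp: mor_split in_Hom_iff)
next
  case TInv
  show ?thesis unfolding TInv merge.simps msubst_msum msubst.simps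
    by (subst sum_colours_T[symmetric], rule mor_msum_eq) (auto simp: mor_split in_Hom_iff)
next
  case CGen
  have "c = lay [Down] (hsum [Up] [Up] e N) [] \<cdot> c" by (simp add: e_sum')
  also have "\<dots> = hsum [] DU cc N" by (simp add: lay_hsum hsum_comp cc_def[abs_def])
  finally have c: "hsum [] DU cc N = c" by simp
  show ?thesis unfolding CGen c[symmetric] merge.simps msubst_msum msubst.simps
    by (rule mor_msum_eq) (auto simp: mor_split in_Hom_iff)
next
  case DGen
  have "d = d \<cdot> lay [] (hsum [Up] [Up] e N) [Down]" by (simp add: e_sum')
  also have "\<dots> = hsum UD [] dc N" by (simp add: lay_hsum comp_hsum dc_def[abs_def])
  finally have d: "hsum UD [] dc N = d" by simp
  show ?thesis unfolding DGen d[symmetric] merge.simps msubst_msum msubst.simps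
    by (rule mor_msum_eq) (auto simp: mor_split in_Hom_iff)
next
  case (BetaGen a)
  then have a: "a \<in> carrier A" using g by (auto simp: heis_gens_def)
  show ?thesis unfolding BetaGen \<beta>_sum[OF a, symmetric] merge.simps msubst_msum msubst.simps
    by (rule mor_msum_eq) (use a in \<open>auto simp: mor_split \<beta>c_def in_Hom_iff\<close>)
next
  case (UInv r b)
  then obtain i b' where "i \<in> N" "b' \<in> B i" "b = \<iota> i b'" using g by (auto simp: heis_gens_def BA_iff)
  then show ?thesis by (simp add: UInv split.simps)
qed

end

section \<open>Merging the colours of the coloured presentation\<close>

text \<open>
  The coloured presentation.  Here the idempotents are given by the colour conventions, and the
  uncoloured generators are defined as sums over the colours.
\<close>

locale coloured = frobenius_sum R n F tr B k + strands R P
  for R :: "'k ring" and n :: nat and F :: "nat \<Rightarrow> ('k, 'a) module"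
    and tr :: "nat \<Rightarrow> 'a \<Rightarrow> 'k" and B :: "nat \<Rightarrow> 'a set" and k :: int
    and P :: "('k, strand, 'a cgen) presentation" +
  assumes P: "P = col_presentation R n F tr B k"
begin

abbreviation "xc i \<equiv> mor (Gen (XGen' i))"
abbreviation "sc i j \<equiv> mor (Gen (SGen' i j))"
abbreviation "cc i \<equiv> mor (Gen (CGen' i))"
abbreviation "dc i \<equiv> mor (Gen (DGen' i))"
abbreviation "\<beta>c b i \<equiv> mor (Gen (BetaGen' b i))"
abbreviation "Tc i j \<equiv> mor (Gen (TInv' i j))"
abbreviation "Uc i r b \<equiv> mor (Gen (UInv' i r b))"
abbreviation "e i \<equiv> mor (Gen (BetaGen' \<one>\<^bsub>F i\<^esub> i))"
abbreviation "f i \<equiv> zz (cc i) (dc i)"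

lemma gen_Hom: "g \<in> col_heis_gens n F B k \<Longrightarrow> mor (Gen g) \<in> Hom \<C> (col_heis_source k g) (col_heis_target k g)"
  using typed.gen[of g P R] unfolding mor_in_Hom by (simp add: P)

lemma ty_gen [simp]:
  "i \<in> N \<Longrightarrow> arr (xc i)" "i \<in> N \<Longrightarrow> src (xc i) = [Up]" "i \<in> N \<Longrightarrow> tgt (xc i) = [Up]"
  "i \<in> N \<Longrightarrow> j \<in> N \<Longrightarrow> arr (sc i j)" "i \<in> N \<Longrightarrow> j \<in> N \<Longrightarrow> src (sc i j) = UU"
  "i \<in> N \<Longrightarrow> j \<in> N \<Longrightarrow> tgt (sc i j) = UU"
  "i \<in> N \<Longrightarrow> arr (cc i)" "i \<in> N \<Longrightarrow> src (cc i) = []" "i \<in> N \<Longrightarrow> tgt (cc i) = DU"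
  "i \<in> N \<Longrightarrow> arr (dc i)" "i \<in> N \<Longrightarrow> src (dc i) = UD" "i \<in> N \<Longrightarrow> tgt (dc i) = []"
  "i \<in> N \<Longrightarrow> b \<in> carrier (F i) \<Longrightarrow> arr (\<beta>c b i)" "i \<in> N \<Longrightarrow> b \<in> carrier (F i) \<Longrightarrow> src (\<beta>c b i) = [Up]"
  "i \<in> N \<Longrightarrow> b \<in> carrier (F i) \<Longrightarrow> tgt (\<beta>c b i) = [Up]"
  "i \<in> N \<Longrightarrow> j \<in> N \<Longrightarrow> arr (Tc i j)" "i \<in> N \<Longrightarrow> j \<in> N \<Longrightarrow> src (Tc i j) = DU"
  "i \<in> N \<Longrightarrow> j \<in> N \<Longrightarrow> tgt (Tc i j) = UD"
  using gen_Hom[of "XGen' i"] gen_Hom[of "SGen' i j"] gen_Hom[of "CGen' i"] gen_Hom[of "DGen' i"]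
    gen_Hom[of "BetaGen' b i"] gen_Hom[of "TInv' i j"]
  by (simp_all add: col_heis_gens_def in_Hom_iff)

lemma ty_f [simp]: "i \<in> N \<Longrightarrow> arr (f i)" "i \<in> N \<Longrightarrow> src (f i) = [Down]" "i \<in> N \<Longrightarrow> tgt (f i) = [Down]"
  by (simp_all add: zz_def)

lemma mor_strands [simp]: "mor (up_col F i) = e i" "mor (down_col i) = f i"
  by (simp_all add: up_col_def down_col_def)

lemma Uc_Hom:
  assumes "i \<in> N" "r < nat \<bar>k\<bar>" "b \<in> B i"
  shows "k \<ge> 0 \<Longrightarrow> Uc i r b \<in> Hom \<C> [] UD" "k < 0 \<Longrightarrow> Uc i r b \<in> Hom \<C> DU []"
  using gen_Hom[of "UInv' i r b"] assms by (auto simp: col_heis_gens_def)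

lemma rel:
  assumes "(lhs, rhs) \<in> col_heis_rels R n F tr B k" "mor lhs \<in> Hom \<C> X Y" "mor rhs \<in> Hom \<C> X Y"
  shows "mor lhs = mor rhs"
  by (rule relation_holds) (use assms P in auto)

lemma \<beta>c_orth: "i \<in> N \<Longrightarrow> j \<in> N \<Longrightarrow> i \<noteq> j \<Longrightarrow> a \<in> carrier (F i) \<Longrightarrow> b \<in> carrier (F j) \<Longrightarrow> \<beta>c a i \<cdot> \<beta>c b j = zerom [Up] [Up]"
  using rel[OF col_heis_rels.col_beta_orth, of i j a b "[Up]" "[Up]"] by (simp add: in_Hom_iff)

lemma \<beta>c_mult: "i \<in> N \<Longrightarrow> a \<in> carrier (F i) \<Longrightarrow> b \<in> carrier (F i) \<Longrightarrow> \<beta>c a i \<cdot> \<beta>c b i = \<beta>c (a \<otimes>\<^bsub>F i\<^esub> b) i"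
  using rel[OF col_heis_rels.beta_mult, of i a b "[Up]" "[Up]"] by (simp add: in_Hom_iff)

lemma \<beta>c_add: "i \<in> N \<Longrightarrow> a \<in> carrier (F i) \<Longrightarrow> b \<in> carrier (F i) \<Longrightarrow> \<beta>c (a \<oplus>\<^bsub>F i\<^esub> b) i = \<beta>c a i \<oplus>\<oplus> \<beta>c b i"
  using rel[OF col_heis_rels.beta_add, of i a b "[Up]" "[Up]"] by (simp add: in_Hom_iff)

lemma \<beta>c_smult: "i \<in> N \<Longrightarrow> r \<in> carrier R \<Longrightarrow> a \<in> carrier (F i) \<Longrightarrow> \<beta>c (r \<odot>\<^bsub>F i\<^esub> a) i = HScale \<C> r (\<beta>c a i)"
  using rel[OF col_heis_rels.beta_smult, of i r a "[Up]" "[Up]"] by (simp add: in_Hom_iff)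

lemma \<beta>c_zero: "i \<in> N \<Longrightarrow> \<beta>c \<zero>\<^bsub>F i\<^esub> i = zerom [Up] [Up]"
  by (rule plus_idem_zerom) (simp_all add: in_Hom_iff \<beta>c_add[symmetric])

lemma e_mult: "i \<in> N \<Longrightarrow> j \<in> N \<Longrightarrow> e i \<cdot> e j = (if i = j then e i else zerom [Up] [Up])"
  by (simp add: \<beta>c_mult \<beta>c_orth)

lemma e_sum': "hsum [Up] [Up] e N = idm [Up]"
proof -
  have "mor (msum [Up] [Up] (up_col F) N) = hsum [Up] [Up] e N"
    by (rule mor_msum_eq) (simp_all add: in_Hom_iff)
  then show ?thesis using rel[OF col_heis_rels.col_up_sum, of "[Up]" "[Up]"] by (simp add: in_Hom_iff)
qed

lemma f_mult: "i \<in> N \<Longrightarrow> j \<in> N \<Longrightarrow> f i \<cdot> f j = (if i = j then f i else zerom [Down] [Down])"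
  using rel[OF col_heis_rels.col_down_orth, of i j "[Down]" "[Down]"] by (simp add: in_Hom_iff split: if_splits)

lemma f_sum': "hsum [Down] [Down] f N = idm [Down]"
proof -
  have "mor (msum [Down] [Down] down_col N) = hsum [Down] [Down] f N"
    by (rule mor_msum_eq) (simp_all add: in_Hom_iff)
  then show ?thesis using rel[OF col_heis_rels.col_down_sum, of "[Down]" "[Down]"] by (simp add: in_Hom_iff)
qed

lemma s_conv: "i \<in> N \<Longrightarrow> j \<in> N \<Longrightarrow> sc i j = (e j \<star> e i) \<cdot> sc i j \<cdot> (e i \<star> e j)"
  using rel[OF col_heis_rels.col_s, of i j "UU" "UU"] by (simp add: in_Hom_iff)

lemma x_conv: "i \<in> N \<Longrightarrow> xc i = e i \<cdot> xc i \<cdot> e i"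
  using rel[OF col_heis_rels.col_x, of i "[Up]" "[Up]"] by (simp add: in_Hom_iff)

lemma c_conv: "i \<in> N \<Longrightarrow> cc i = (f i \<star> e i) \<cdot> cc i"
  using rel[OF col_heis_rels.col_c, of i "[]" "DU"] by (simp add: in_Hom_iff)

lemma d_conv: "i \<in> N \<Longrightarrow> dc i = dc i \<cdot> (e i \<star> f i)"
  using rel[OF col_heis_rels.col_d, of i "UD" "[]"] by (simp add: in_Hom_iff)

text \<open>How the coloured generators absorb or kill the idempotents of a given colour.\<close>

lemma e_e:
  assumes "i \<in> N" "j \<in> N" "l \<in> N"
  shows "(e i \<star> e j) \<cdot> lay [] (e l) [Up] = (if i = l then e i \<star> e j else zerom UU UU)"
    "(e i \<star> e j) \<cdot> lay [Up] (e l) [] = (if j = l then e i \<star> e j else zerom UU UU)"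
    "lay [] (e l) [Up] \<cdot> (e i \<star> e j) = (if i = l then e i \<star> e j else zerom UU UU)"
    "lay [Up] (e l) [] \<cdot> (e i \<star> e j) = (if j = l then e i \<star> e j else zerom UU UU)"
  using assms by (simp_all add: lay_left lay_right interchange' e_mult)

lemma s_absorb:
  assumes "i \<in> N" "j \<in> N" "l \<in> N"
  shows "sc i j \<cdot> lay [] (e l) [Up] = (if i = l then sc i j else zerom UU UU)"
    "sc i j \<cdot> lay [Up] (e l) [] = (if j = l then sc i j else zerom UU UU)"
    "lay [] (e l) [Up] \<cdot> sc i j = (if j = l then sc i j else zerom UU UU)"
    "lay [Up] (e l) [] \<cdot> sc i j = (if i = l then sc i j else zerom UU UU)"
proof -
  note [simp] = assms
  have "sc i j \<cdot> lay [] (e l) [Up] = (e j \<star> e i) \<cdot> sc i j \<cdot> (e i \<star> e j) \<cdot> lay [] (e l) [Up]"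
    using arg_cong[OF s_conv[of i j], of "\<lambda>u. u \<cdot> lay [] (e l) [Up]"] by simp
  then show "sc i j \<cdot> lay [] (e l) [Up] = (if i = l then sc i j else zerom UU UU)"
    by (simp add: e_e s_conv[symmetric])
  have "sc i j \<cdot> lay [Up] (e l) [] = (e j \<star> e i) \<cdot> sc i j \<cdot> (e i \<star> e j) \<cdot> lay [Up] (e l) []"
    using arg_cong[OF s_conv[of i j], of "\<lambda>u. u \<cdot> lay [Up] (e l) []"] by simp
  then show "sc i j \<cdot> lay [Up] (e l) [] = (if j = l then sc i j else zerom UU UU)"
    by (simp add: e_e s_conv[symmetric])
  have "lay [] (e l) [Up] \<cdot> sc i j = (lay [] (e l) [Up] \<cdot> (e j \<star> e i)) \<cdot> sc i j \<cdot> (e i \<star> e j)"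
    using arg_cong[OF s_conv[of i j], of "\<lambda>u. lay [] (e l) [Up] \<cdot> u"] by simp
  then show "lay [] (e l) [Up] \<cdot> sc i j = (if j = l then sc i j else zerom UU UU)"
    by (simp only: e_e assms) (simp add: s_conv[symmetric])
  have "lay [Up] (e l) [] \<cdot> sc i j = (lay [Up] (e l) [] \<cdot> (e j \<star> e i)) \<cdot> sc i j \<cdot> (e i \<star> e j)"
    using arg_cong[OF s_conv[of i j], of "\<lambda>u. lay [Up] (e l) [] \<cdot> u"] by simp
  then show "lay [Up] (e l) [] \<cdot> sc i j = (if i = l then sc i j else zerom UU UU)"
    by (simp only: e_e assms) (simp add: s_conv[symmetric])
qed

lemma x_absorb:
  assumes "i \<in> N" "l \<in> N"
  shows "xc i \<cdot> e l = (if i = l then xc i else zerom [Up] [Up])"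
    "e l \<cdot> xc i = (if i = l then xc i else zerom [Up] [Up])"
proof -
  note [simp] = assms
  have "xc i \<cdot> e l = e i \<cdot> xc i \<cdot> e i \<cdot> e l"
    using arg_cong[OF x_conv[of i], of "\<lambda>u. u \<cdot> e l"] by simp
  then show "xc i \<cdot> e l = (if i = l then xc i else zerom [Up] [Up])"
    by (simp add: e_mult x_conv[symmetric] split: if_splits)
  have "e l \<cdot> xc i = (e l \<cdot> e i) \<cdot> xc i \<cdot> e i"
    using arg_cong[OF x_conv[of i], of "\<lambda>u. e l \<cdot> u"] by simp
  then show "e l \<cdot> xc i = (if i = l then xc i else zerom [Up] [Up])"
    by (simp only: e_mult assms) (simp add: x_conv[symmetric])
qed

lemma c_absorb:
  assumes "i \<in> N" "l \<in> N"
  shows "lay [Down] (e l) [] \<cdot> cc i = (if i = l then cc i else zerom [] DU)"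
    "lay [] (f l) [Up] \<cdot> cc i = (if i = l then cc i else zerom [] DU)"
proof -
  note [simp] = assms
  have 1: "lay [Down] (e l) [] \<cdot> (f i \<star> e i) = (if i = l then f i \<star> e i else zerom DU DU)"
    "lay [] (f l) [Up] \<cdot> (f i \<star> e i) = (if i = l then f i \<star> e i else zerom DU DU)"
    by (simp_all add: lay_left lay_right interchange' e_mult f_mult)
  have "lay [Down] (e l) [] \<cdot> cc i = (lay [Down] (e l) [] \<cdot> (f i \<star> e i)) \<cdot> cc i"
    using arg_cong[OF c_conv[of i], of "\<lambda>u. lay [Down] (e l) [] \<cdot> u"] by simp
  then show "lay [Down] (e l) [] \<cdot> cc i = (if i = l then cc i else zerom [] DU)"
    by (simp only: 1) (simp add: c_conv[symmetric])
  have "lay [] (f l) [Up] \<cdot> cc i = (lay [] (f l) [Up] \<cdot> (f i \<star> e i)) \<cdot> cc i"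
    using arg_cong[OF c_conv[of i], of "\<lambda>u. lay [] (f l) [Up] \<cdot> u"] by simp
  then show "lay [] (f l) [Up] \<cdot> cc i = (if i = l then cc i else zerom [] DU)"
    by (simp only: 1) (simp add: c_conv[symmetric])
qed

lemma d_absorb:
  assumes "i \<in> N" "l \<in> N"
  shows "dc i \<cdot> lay [] (e l) [Down] = (if i = l then dc i else zerom UD [])"
    "dc i \<cdot> lay [Up] (f l) [] = (if i = l then dc i else zerom UD [])"
proof -
  note [simp] = assms
  have 1: "(e i \<star> f i) \<cdot> lay [] (e l) [Down] = (if i = l then e i \<star> f i else zerom UD UD)"
    "(e i \<star> f i) \<cdot> lay [Up] (f l) [] = (if i = l then e i \<star> f i else zerom UD UD)"
    by (simp_all add: lay_left lay_right interchange' e_mult f_mult)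
  have "dc i \<cdot> lay [] (e l) [Down] = dc i \<cdot> (e i \<star> f i) \<cdot> lay [] (e l) [Down]"
    using arg_cong[OF d_conv[of i], of "\<lambda>u. u \<cdot> lay [] (e l) [Down]"] by simp
  then show "dc i \<cdot> lay [] (e l) [Down] = (if i = l then dc i else zerom UD [])"
    by (simp only: 1) (simp add: d_conv[symmetric])
  have "dc i \<cdot> lay [Up] (f l) [] = dc i \<cdot> (e i \<star> f i) \<cdot> lay [Up] (f l) []"
    using arg_cong[OF d_conv[of i], of "\<lambda>u. u \<cdot> lay [Up] (f l) []"] by simp
  then show "dc i \<cdot> lay [Up] (f l) [] = (if i = l then dc i else zerom UD [])"
    by (simp only: 1) (simp add: d_conv[symmetric])
qed

definition x where "x = hsum [Up] [Up] xc N"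
definition s where "s = hsum UU UU (\<lambda>p. sc (fst p) (snd p)) (N \<times> N)"
definition c where "c = hsum [] DU cc N"
definition d where "d = hsum UD [] dc N"
definition \<beta> where "\<beta> a = hsum [Up] [Up] (\<lambda>i. \<beta>c (a i) i) N"
definition T where "T = hsum DU UD (\<lambda>p. Tc (fst p) (snd p)) (N \<times> N)"

lemma ty_pairs [simp]:
  assumes "p \<in> N \<times> N"
  shows "arr (sc (fst p) (snd p))" "src (sc (fst p) (snd p)) = UU" "tgt (sc (fst p) (snd p)) = UU"
    "arr (Tc (fst p) (snd p))" "src (Tc (fst p) (snd p)) = DU" "tgt (Tc (fst p) (snd p)) = UD"
  using assms by auto

lemma ty_sums [simp]:
  "arr x" "src x = [Up]" "tgt x = [Up]" "arr s" "src s = UU" "tgt s = UU"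
  "arr c" "src c = []" "tgt c = DU" "arr d" "src d = UD" "tgt d = []"
  "a \<in> carrier A \<Longrightarrow> arr (\<beta> a)" "a \<in> carrier A \<Longrightarrow> src (\<beta> a) = [Up]" "a \<in> carrier A \<Longrightarrow> tgt (\<beta> a) = [Up]"
  "arr T" "src T = DU" "tgt T = UD"
  unfolding x_def s_def c_def d_def \<beta>_def T_def by simp_all

lemma s_slide':
  assumes l: "l \<in> N"
  shows "lay [] (e l) [Up] \<cdot> s = s \<cdot> lay [Up] (e l) []" "lay [Up] (e l) [] \<cdot> s = s \<cdot> lay [] (e l) [Up]"
proof -
  have c: "lay [] (e l) [Up] \<cdot> s = hsum UU UU (\<lambda>p. lay [] (e l) [Up] \<cdot> sc (fst p) (snd p)) (N \<times> N)"
    "lay [Up] (e l) [] \<cdot> s = hsum UU UU (\<lambda>p. lay [Up] (e l) [] \<cdot> sc (fst p) (snd p)) (N \<times> N)"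
    using l by (simp_all add: s_def comp_hsum)
  have d: "s \<cdot> lay [] (e l) [Up] = hsum UU UU (\<lambda>p. sc (fst p) (snd p) \<cdot> lay [] (e l) [Up]) (N \<times> N)"
    "s \<cdot> lay [Up] (e l) [] = hsum UU UU (\<lambda>p. sc (fst p) (snd p) \<cdot> lay [Up] (e l) []) (N \<times> N)"
    using l by (simp_all add: s_def hsum_comp)
  show "lay [] (e l) [Up] \<cdot> s = s \<cdot> lay [Up] (e l) []" "lay [Up] (e l) [] \<cdot> s = s \<cdot> lay [] (e l) [Up]"
    unfolding c d by (rule hsum_cong; use l in \<open>simp add: mem_Times_iff s_absorb in_Hom_iff\<close>)+
qed

lemma s_col: assumes ij: "i \<in> N" "j \<in> N" shows "sc i j = s \<cdot> lay [] (e i) [Up] \<cdot> lay [Up] (e j) []"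
proof -
  have "s \<cdot> lay [] (e i) [Up] \<cdot> lay [Up] (e j) []
    = hsum UU UU (\<lambda>p. sc (fst p) (snd p) \<cdot> lay [] (e i) [Up] \<cdot> lay [Up] (e j) []) (N \<times> N)"
    using ij by (simp add: s_def hsum_comp)
  also have "\<dots> = hsum UU UU (\<lambda>p. if p = (i, j) then sc i j else zerom UU UU) (N \<times> N)"
    by (rule hsum_cong) (use ij s_absorb(1)[THEN comp_trail] in \<open>auto simp: s_absorb in_Hom_iff split: if_splits\<close>)
  also have "\<dots> = sc i j" by (subst hsum_single[of _ "(i, j)"]) (use ij in \<open>auto simp: in_Hom_iff\<close>)
  finally show ?thesis by simp
qed

lemma x_col': assumes i: "i \<in> N" shows "x \<cdot> e i = xc i" "e i \<cdot> x = xc i"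
proof -
  have "x \<cdot> e i = hsum [Up] [Up] (\<lambda>j. xc j \<cdot> e i) N" using i by (simp add: x_def hsum_comp)
  also have "\<dots> = xc i \<cdot> e i" by (rule hsum_single) (use i in \<open>auto simp: x_absorb in_Hom_iff\<close>)
  finally show "x \<cdot> e i = xc i" using i by (simp add: x_absorb)
  have "e i \<cdot> x = hsum [Up] [Up] (\<lambda>j. e i \<cdot> xc j) N" using i by (simp add: x_def comp_hsum)
  also have "\<dots> = e i \<cdot> xc i" by (rule hsum_single) (use i in \<open>auto simp: x_absorb in_Hom_iff\<close>)
  finally show "e i \<cdot> x = xc i" using i by (simp add: x_absorb)
qed

lemma c_col: assumes i: "i \<in> N" shows "lay [Down] (e i) [] \<cdot> c = cc i" "lay [] (f i) [Up] \<cdot> c = cc i"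
proof -
  have "lay [Down] (e i) [] \<cdot> c = hsum [] DU (\<lambda>j. lay [Down] (e i) [] \<cdot> cc j) N"
    using i by (simp add: c_def comp_hsum)
  also have "\<dots> = lay [Down] (e i) [] \<cdot> cc i" by (rule hsum_single) (use i in \<open>auto simp: c_absorb in_Hom_iff\<close>)
  finally show "lay [Down] (e i) [] \<cdot> c = cc i" using i by (simp add: c_absorb)
  have "lay [] (f i) [Up] \<cdot> c = hsum [] DU (\<lambda>j. lay [] (f i) [Up] \<cdot> cc j) N"
    using i by (simp add: c_def comp_hsum)
  also have "\<dots> = lay [] (f i) [Up] \<cdot> cc i" by (rule hsum_single) (use i in \<open>auto simp: c_absorb in_Hom_iff\<close>)
  finally show "lay [] (f i) [Up] \<cdot> c = cc i" using i by (simp add: c_absorb)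
qed

lemma d_col: assumes i: "i \<in> N" shows "d \<cdot> lay [] (e i) [Down] = dc i" "d \<cdot> lay [Up] (f i) [] = dc i"
proof -
  have "d \<cdot> lay [] (e i) [Down] = hsum UD [] (\<lambda>j. dc j \<cdot> lay [] (e i) [Down]) N"
    using i by (simp add: d_def hsum_comp)
  also have "\<dots> = dc i \<cdot> lay [] (e i) [Down]" by (rule hsum_single) (use i in \<open>auto simp: d_absorb in_Hom_iff\<close>)
  finally show "d \<cdot> lay [] (e i) [Down] = dc i" using i by (simp add: d_absorb)
  have "d \<cdot> lay [Up] (f i) [] = hsum UD [] (\<lambda>j. dc j \<cdot> lay [Up] (f i) []) N"
    using i by (simp add: d_def hsum_comp)
  also have "\<dots> = dc i \<cdot> lay [Up] (f i) []" by (rule hsum_single) (use i in \<open>auto simp: d_absorb in_Hom_iff\<close>)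
  finally show "d \<cdot> lay [Up] (f i) [] = dc i" using i by (simp add: d_absorb)
qed

lemma \<beta>_col':
  assumes a: "a \<in> carrier A" and i: "i \<in> N"
  shows "\<beta> a \<cdot> e i = \<beta>c (a i) i" "e i \<cdot> \<beta> a = \<beta>c (a i) i"
proof -
  have "\<beta> a \<cdot> e i = hsum [Up] [Up] (\<lambda>j. \<beta>c (a j) j \<cdot> e i) N" using i a by (simp add: \<beta>_def hsum_comp)
  also have "\<dots> = \<beta>c (a i) i \<cdot> e i" by (rule hsum_single) (use i a in \<open>auto simp: \<beta>c_orth in_Hom_iff\<close>)
  finally show "\<beta> a \<cdot> e i = \<beta>c (a i) i" using i a by (simp add: \<beta>c_mult)
  have "e i \<cdot> \<beta> a = hsum [Up] [Up] (\<lambda>j. e i \<cdot> \<beta>c (a j) j) N" using i a by (simp add: \<beta>_def comp_hsum)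
  also have "\<dots> = e i \<cdot> \<beta>c (a i) i" by (rule hsum_single) (use i a in \<open>auto simp: \<beta>c_orth in_Hom_iff\<close>)
  finally show "e i \<cdot> \<beta> a = \<beta>c (a i) i" using i a by (simp add: \<beta>c_mult)
qed

end

sublocale coloured \<subseteq> C: coloured_frobenius R n F tr B k P x s c d e f xc cc dc sc \<beta> \<beta>c
  by unfold_locales
    (simp_all add: in_Hom_iff e_mult f_mult e_sum' f_sum' s_slide' s_col[symmetric] x_col' c_col d_col \<beta>_col' \<beta>c_zero)

context coloured
begin

lemma mor_merge [simp]:
  "mor (merge XGen) = x" "mor (merge SGen) = s" "mor (merge CGen) = c" "mor (merge DGen) = d"
  "a \<in> carrier A \<Longrightarrow> mor (merge (BetaGen a)) = \<beta> a" "mor (merge TInv) = T"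
  unfolding merge.simps x_def s_def c_def d_def \<beta>_def T_def
  by (rule mor_msum_eq; simp add: in_Hom_iff)+

text \<open>
  The evaluation at \<open>col\<close> recovers \<open>b\<close> from its image in the direct sum.
\<close>

definition UA where "UA p = Uc (col (snd p)) (fst p) (snd p (col (snd p)))"

lemma mor_merge_U: "mor (merge (UInv r b)) = UA (r, b)"
  by (simp add: UA_def)

lemma UA_incl: "i \<in> N \<Longrightarrow> b \<in> B i \<Longrightarrow> UA (r, \<iota> i b) = Uc i r b"
  by (simp add: UA_def)

lemma UA_Hom:
  assumes "p \<in> I"
  shows "k \<ge> 0 \<Longrightarrow> UA p \<in> Hom \<C> [] UD" "k < 0 \<Longrightarrow> UA p \<in> Hom \<C> DU []"
proof -
  obtain r i b where "p = (r, \<iota> i b)" "i \<in> N" "b \<in> B i" "r < nat \<bar>k\<bar>"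
    using assms by (cases p) (auto simp: BA_iff)
  then show "k \<ge> 0 \<Longrightarrow> UA p \<in> Hom \<C> [] UD" "k < 0 \<Longrightarrow> UA p \<in> Hom \<C> DU []"
    using Uc_Hom[of i r b] by (simp_all add: UA_incl)
qed

lemma merge_typed:
  assumes "g \<in> heis_gens A BA k"
  shows "mor (merge g) \<in> Hom \<C> (heis_source k g) (heis_target k g)"
proof (cases g)
  case (UInv r b)
  then have "(r, b) \<in> I" using assms by (auto simp: heis_gens_def)
  then show ?thesis using UA_Hom[of "(r, b)"] by (auto simp: UInv mor_merge_U simp del: merge.simps)
qed (use assms in \<open>auto simp: heis_gens_def in_Hom_iff simp del: merge.simps\<close>)

lemma T_Hom: "T \<in> Hom \<C> DU UD"
  by (simp add: in_Hom_iff)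

abbreviation "dterm i \<equiv> \<lambda>(r, b). Gen (DGen' i) \<bullet> ((mpow (up_col F i) (Gen (XGen' i)) r \<bullet> Gen (BetaGen' (dual i b) i)) \<boxtimes> \<one>\<^sub>-)"
abbreviation "cterm i \<equiv> \<lambda>(r, b). (\<one>\<^sub>- \<boxtimes> (mpow (up_col F i) (Gen (XGen' i)) r \<bullet> Gen (BetaGen' (dual i b) i))) \<bullet> Gen (CGen' i)"
abbreviation "uterm i \<equiv> \<lambda>(r, b). Gen (UInv' i r b)"
abbreviation "hh i \<equiv> \<lambda>p. (fst p, \<iota> i (snd p))"
abbreviation "J i \<equiv> {..<nat \<bar>k\<bar>} \<times> B i"

lemma mor_dterm:
  assumes "i \<in> N" "p \<in> J i"
  shows "mor (dterm i p) = C.dvA (hh i p)" "mor (cterm i p) = C.cvA (hh i p)" "mor (uterm i p) = UA (hh i p)"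
    "hh i p \<in> I"
  using assms C.dvA_incl[of i "snd p" "fst p"] C.cvA_incl[of i "snd p" "fst p"]
  by (auto simp: case_prod_unfold C.dvc_def C.cvc_def C.tokc_def UA_incl)

lemma mor_EG: "mor (up_col F i \<boxtimes> down_col j) = C.E i j" "mor (down_col j \<boxtimes> up_col F i) = C.G i j"
  by (simp_all add: C.E_def C.G_def)

lemma tc: "i \<in> N \<Longrightarrow> j \<in> N \<Longrightarrow> mor (t_col i j) = C.tc i j"
  by (simp add: t_col_def mor_rotated C.tc_def)

text \<open>
  The inversion relation of a single colour, with the index set \<open>J i\<close> replaced by the part of colour
  \<open>i\<close> of the index set of the direct sum.
\<close>

lemma column_colour:
  assumes k: "k \<ge> 0" and i: "i \<in> N"
  shows "C.E i i \<cdot> Tc i i \<cdot> C.G i i = Tc i i" "\<And>p. p \<in> J i \<Longrightarrow> C.E i i \<cdot> UA (hh i p) = UA (hh i p)"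
    "column_inv (C.E i i) (C.tc i i) C.dvA {p \<in> I. col (snd p) = i \<and> col (snd p) = i} (Tc i i) UA (C.G i i)"
proof -
  have J: "{..<nat k} \<times> B i = J i" and fin: "finite (J i)" using k i finite_B by simp_all
  have H: "UA (hh i p) \<cdot> C.dvA (hh i p) \<in> Hom \<C> UD UD" if "p \<in> J i" for p
    using UA_Hom(1)[OF mor_dterm(4)[OF i that] k] C.dv_Hom[OF mor_dterm(4)[OF i that]] by (simp add: in_Hom_iff)
  have "\<forall>(a, b) \<in> column_inverse UD (up_col F i \<boxtimes> down_col i) DU (down_col i \<boxtimes> up_col F i)
      (t_col i i) (dterm i) (J i) (Gen (TInv' i i)) (uterm i). mor a = mor b"
  proof clarify
    fix a b :: "('k, strand, 'a cgen) mterm"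
    assume ab: "(a, b) \<in> column_inverse UD (up_col F i \<boxtimes> down_col i) DU (down_col i \<boxtimes> up_col F i)
      (t_col i i) (dterm i) (J i) (Gen (TInv' i i)) (uterm i)"
    have "\<exists>X Y. mor a \<in> Hom \<C> X Y \<and> mor b \<in> Hom \<C> X Y"
      by (rule column_inverse_Hom[OF fin _ _ _ _ _ _ ab], unfold mor_EG tc[OF i i])
        (use i in \<open>simp_all only: mor_dterm UA_Hom(1)[OF mor_dterm(4) k] C.dv_Hom, simp_all add: in_Hom_iff\<close>)
    then show "mor a = mor b"
      using col_heis_rels.inversion_nonneg[where R = R and F = F and tr = tr and B = B, OF k i ab[folded J]] rel by blast
  qed
  moreover have "mor (uterm i p) \<cdot> mor (dterm i p) \<in> Hom \<C> UD UD" if "p \<in> J i" for p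
    unfolding mor_dterm[OF i that] by (rule H[OF that])
  ultimately have *: "C.E i i \<cdot> Tc i i \<cdot> C.G i i = Tc i i \<and> (\<forall>p\<in>J i. C.E i i \<cdot> mor (uterm i p) = mor (uterm i p)) \<and>
      column_inv (C.E i i) (C.tc i i) (\<lambda>p. mor (dterm i p)) (J i) (Tc i i) (\<lambda>p. mor (uterm i p)) (C.G i i)"
    unfolding mor_EG[symmetric] tc[OF i i, symmetric] by (subst (asm) mor_column_inverse[OF fin])
  then show "C.E i i \<cdot> Tc i i \<cdot> C.G i i = Tc i i" by blast
  show "C.E i i \<cdot> UA (hh i p) = UA (hh i p)" if "p \<in> J i" for p
    using conjunct1[OF conjunct2[OF *], THEN bspec, OF that] unfolding mor_dterm(3)[OF i that] .
  have "column_inv (C.E i i) (C.tc i i) (\<lambda>p. C.dvA (hh i p)) (J i) (Tc i i) (\<lambda>p. UA (hh i p)) (C.G i i)"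
    by (rule iffD1[OF inverse_pair_cong conjunct2[OF conjunct2[OF *]]]) (simp_all only: mor_dterm i H)
  then show "column_inv (C.E i i) (C.tc i i) C.dvA {p \<in> I. col (snd p) = i \<and> col (snd p) = i} (Tc i i) UA (C.G i i)"
    unfolding I_colour[OF i] by (subst inverse_pair_reindex[OF incl_inj_on[OF i]]) (use H in auto)
qed

lemma row_colour:
  assumes k: "k < 0" and i: "i \<in> N"
  shows "C.E i i \<cdot> Tc i i \<cdot> C.G i i = Tc i i" "\<And>p. p \<in> J i \<Longrightarrow> UA (hh i p) \<cdot> C.G i i = UA (hh i p)"
    "row_inv (C.E i i) (C.tc i i) C.cvA {p \<in> I. col (snd p) = i \<and> col (snd p) = i} (Tc i i) UA (C.G i i)"
proof -
  have J: "{..<nat (- k)} \<times> B i = J i" and fin: "finite (J i)" using k i finite_B by simp_all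
  have H: "C.cvA (hh i p) \<cdot> UA (hh i p) \<in> Hom \<C> DU DU" if "p \<in> J i" for p
    using UA_Hom(2)[OF mor_dterm(4)[OF i that] k] C.cv_Hom[OF mor_dterm(4)[OF i that]] by (simp add: in_Hom_iff)
  have "\<forall>(a, b) \<in> row_inverse UD (up_col F i \<boxtimes> down_col i) DU (down_col i \<boxtimes> up_col F i)
      (t_col i i) (cterm i) (J i) (Gen (TInv' i i)) (uterm i). mor a = mor b"
  proof clarify
    fix a b :: "('k, strand, 'a cgen) mterm"
    assume ab: "(a, b) \<in> row_inverse UD (up_col F i \<boxtimes> down_col i) DU (down_col i \<boxtimes> up_col F i)
      (t_col i i) (cterm i) (J i) (Gen (TInv' i i)) (uterm i)"
    have "\<exists>X Y. mor a \<in> Hom \<C> X Y \<and> mor b \<in> Hom \<C> X Y"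
      by (rule row_inverse_Hom[OF fin _ _ _ _ _ _ ab], unfold mor_EG tc[OF i i])
        (use i in \<open>simp_all only: mor_dterm UA_Hom(2)[OF mor_dterm(4) k] C.cv_Hom, simp_all add: in_Hom_iff\<close>)
    then show "mor a = mor b"
      using col_heis_rels.inversion_neg[where R = R and F = F and tr = tr and B = B, OF k i ab[folded J]] rel by blast
  qed
  moreover have "mor (cterm i p) \<cdot> mor (uterm i p) \<in> Hom \<C> DU DU" if "p \<in> J i" for p
    unfolding mor_dterm[OF i that] by (rule H[OF that])
  ultimately have *: "C.E i i \<cdot> Tc i i \<cdot> C.G i i = Tc i i \<and> (\<forall>p\<in>J i. mor (uterm i p) \<cdot> C.G i i = mor (uterm i p)) \<and>
      row_inv (C.E i i) (C.tc i i) (\<lambda>p. mor (cterm i p)) (J i) (Tc i i) (\<lambda>p. mor (uterm i p)) (C.G i i)"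
    unfolding mor_EG[symmetric] tc[OF i i, symmetric] by (subst (asm) mor_row_inverse[OF fin])
  then show "C.E i i \<cdot> Tc i i \<cdot> C.G i i = Tc i i" by blast
  show "UA (hh i p) \<cdot> C.G i i = UA (hh i p)" if "p \<in> J i" for p
    using conjunct1[OF conjunct2[OF *], THEN bspec, OF that] unfolding mor_dterm(3)[OF i that] .
  have "row_inv (C.E i i) (C.tc i i) (\<lambda>p. C.cvA (hh i p)) (J i) (Tc i i) (\<lambda>p. UA (hh i p)) (C.G i i)"
    by (rule iffD1[OF inverse_pair_cong conjunct2[OF conjunct2[OF *]]]) (simp_all only: mor_dterm i H)
  then show "row_inv (C.E i i) (C.tc i i) C.cvA {p \<in> I. col (snd p) = i \<and> col (snd p) = i} (Tc i i) UA (C.G i i)"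
    unfolding I_colour[OF i] by (subst inverse_pair_reindex[OF incl_inj_on[OF i]]) (use H in auto)
qed

lemma distinct_colours:
  assumes "i \<in> N" "j \<in> N" "i \<noteq> j"
  shows "C.E i j \<cdot> Tc i j \<cdot> C.G i j = Tc i j" "Tc i j \<cdot> C.tc i j = C.E i j" "C.tc i j \<cdot> Tc i j = C.G i j"
proof -
  note r = col_heis_rels.inversion_distinct[OF assms]
  show "C.E i j \<cdot> Tc i j \<cdot> C.G i j = Tc i j"
    using rel[OF r[OF insertI1], of "DU" "UD"] assms
    by (simp add: mor_EG[simplified] in_Hom_iff)
  show "Tc i j \<cdot> C.tc i j = C.E i j"
    using rel[OF r[OF insertI2[OF insertI1]], of "UD" "UD"] assms
    by (simp add: mor_EG[simplified] tc in_Hom_iff)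
  show "C.tc i j \<cdot> Tc i j = C.G i j"
    using rel[OF r[OF insertI2[OF insertI2[OF insertI1]]], of "DU" "DU"] assms
    by (simp add: mor_EG[simplified] tc in_Hom_iff)
qed

lemma Tc_conv: "i \<in> N \<Longrightarrow> j \<in> N \<Longrightarrow> C.E i j \<cdot> Tc i j \<cdot> C.G i j = Tc i j"
  using distinct_colours(1) column_colour(1) row_colour(1) by (cases "i = j"; cases "k \<ge> 0") auto

lemma T_absorb:
  assumes ij: "i \<in> N" "j \<in> N" and ij': "i' \<in> N" "j' \<in> N"
  shows "Tc i j \<cdot> C.G i' j' = (if i = i' \<and> j = j' then Tc i j else zerom DU UD)"
    "C.E i' j' \<cdot> Tc i j = (if i = i' \<and> j = j' then Tc i j else zerom DU UD)"
proof -
  note [simp] = assms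
  have "Tc i j \<cdot> C.G i' j' = C.E i j \<cdot> Tc i j \<cdot> C.G i j \<cdot> C.G i' j'"
    using arg_cong[OF Tc_conv[OF ij, symmetric], of "\<lambda>u. u \<cdot> C.G i' j'"] by simp
  then show "Tc i j \<cdot> C.G i' j' = (if i = i' \<and> j = j' then Tc i j else zerom DU UD)"
    by (simp only: C.EG_orth assms) (simp add: Tc_conv)
  have "C.E i' j' \<cdot> Tc i j = (C.E i' j' \<cdot> C.E i j) \<cdot> Tc i j \<cdot> C.G i j"
    using arg_cong[OF Tc_conv[OF ij, symmetric], of "\<lambda>u. C.E i' j' \<cdot> u"] by simp
  then show "C.E i' j' \<cdot> Tc i j = (if i = i' \<and> j = j' then Tc i j else zerom DU UD)"
    by (simp only: C.EG_orth assms) (auto simp add: Tc_conv)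
qed

lemma T_col:
  assumes ij: "i \<in> N" "j \<in> N"
  shows "T \<cdot> C.G i j = Tc i j" "C.E i j \<cdot> T = Tc i j"
proof -
  have "T \<cdot> C.G i j = hsum DU UD (\<lambda>p. Tc (fst p) (snd p) \<cdot> C.G i j) (N \<times> N)"
    using ij by (simp add: T_def hsum_comp)
  also have "\<dots> = Tc (fst (i, j)) (snd (i, j)) \<cdot> C.G i j"
    by (rule hsum_single) (use ij in \<open>auto simp: T_absorb in_Hom_iff split: if_splits\<close>)
  finally show "T \<cdot> C.G i j = Tc i j" using ij by (simp add: T_absorb)
  have "C.E i j \<cdot> T = hsum DU UD (\<lambda>p. C.E i j \<cdot> Tc (fst p) (snd p)) (N \<times> N)"
    using ij by (simp add: T_def comp_hsum)
  also have "\<dots> = C.E i j \<cdot> Tc (fst (i, j)) (snd (i, j))"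
    by (rule hsum_single) (use ij in \<open>auto simp: T_absorb in_Hom_iff split: if_splits\<close>)
  finally show "C.E i j \<cdot> T = Tc i j" using ij by (simp add: T_absorb)
qed

lemma E_U:
  assumes k: "k \<ge> 0" and p: "p \<in> I" and ij: "i \<in> N" "j \<in> N"
  shows "C.E i j \<cdot> UA p = (if col (snd p) = i \<and> col (snd p) = j then UA p else zerom [] UD)"
proof -
  obtain q l where q: "l \<in> N" "q \<in> J l" "p = hh l q" using p by (auto simp: BA_iff)
  have c: "col (snd p) = l" using q by auto
  have e: "C.E l l \<cdot> UA p = UA p" using column_colour(2)[OF k q(1,2)] q(3) by simp
  have "C.E i j \<cdot> UA p = (C.E i j \<cdot> C.E l l) \<cdot> UA p" using e by simp
  then show ?thesis unfolding c C.EG_orth(1)[OF ij q(1) q(1)]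
    using e UA_Hom(1)[OF p k] by (cases "i = l"; cases "j = l") (simp_all add: in_Hom_iff)
qed

lemma U_G:
  assumes k: "k < 0" and p: "p \<in> I" and ij: "i \<in> N" "j \<in> N"
  shows "UA p \<cdot> C.G i j = (if col (snd p) = i \<and> col (snd p) = j then UA p else zerom DU [])"
proof -
  obtain q l where q: "l \<in> N" "q \<in> J l" "p = hh l q" using p by (auto simp: BA_iff)
  have c: "col (snd p) = l" using q by auto
  have e: "UA p \<cdot> C.G l l = UA p" using row_colour(2)[OF k q(1,2)] q(3) by simp
  have "UA p \<cdot> C.G i j = UA p \<cdot> C.G l l \<cdot> C.G i j" using arg_cong[OF e, of "\<lambda>u. u \<cdot> C.G i j"] by simp
  then show ?thesis unfolding c C.EG_orth(2)[OF q(1) q(1) ij]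
    using e UA_Hom(2)[OF p k] by (cases "i = l"; cases "j = l") (simp_all add: in_Hom_iff)
qed

text \<open>
  The blocks of the merged matrix are the coloured matrices on the diagonal and the crossings
  \<open>t\<^sub>i\<^sub>,\<^sub>j\<close> with \<open>i \<noteq> j\<close> elsewhere; all of them are invertible.
\<close>

lemma merged_column:
  assumes k: "k \<ge> 0"
  shows "column_inv (idm UD) C.t C.dvA I T UA (idm DU)"
proof (rule iffD2[OF C.column_inv_col[where col = "\<lambda>p. col (snd p)"]])
  show "\<forall>i\<in>N. \<forall>j\<in>N. column_inv (C.E i j) (C.tc i j) C.dvA {p \<in> I. col (snd p) = i \<and> col (snd p) = j}
      (T \<cdot> C.G i j) UA (C.G i j)"
  proof (intro ballI)
    fix i j assume ij: "i \<in> N" "j \<in> N"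
    show "column_inv (C.E i j) (C.tc i j) C.dvA {p \<in> I. col (snd p) = i \<and> col (snd p) = j} (T \<cdot> C.G i j) UA (C.G i j)"
    proof (cases "i = j")
      case True
      then show ?thesis using column_colour(3)[OF k ij(1)] T_col(1)[OF ij(1,1)] by simp
    next
      case False
      then have empty: "{p \<in> I. col (snd p) = i \<and> col (snd p) = j} = {}" by auto
      show ?thesis unfolding empty using distinct_colours(2,3)[OF ij False] T_col(1)[OF ij] ij by (simp add: inverse_pair_def)
    qed
  qed
qed (use finite_I T_Hom UA_Hom(1)[OF _ k] C.dv_Hom col_I C.dv_E E_U[OF k] T_col in \<open>simp_all only:\<close>)

lemma merged_row:
  assumes k: "k < 0"
  shows "row_inv (idm UD) C.t C.cvA I T UA (idm DU)"
proof (rule iffD2[OF C.row_inv_col[where col = "\<lambda>p. col (snd p)"]])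
  show "\<forall>i\<in>N. \<forall>j\<in>N. row_inv (C.E i j) (C.tc i j) C.cvA {p \<in> I. col (snd p) = i \<and> col (snd p) = j}
      (T \<cdot> C.G i j) UA (C.G i j)"
  proof (intro ballI)
    fix i j assume ij: "i \<in> N" "j \<in> N"
    show "row_inv (C.E i j) (C.tc i j) C.cvA {p \<in> I. col (snd p) = i \<and> col (snd p) = j} (T \<cdot> C.G i j) UA (C.G i j)"
    proof (cases "i = j")
      case True
      then show ?thesis using row_colour(3)[OF k ij(1)] T_col(1)[OF ij(1,1)] by simp
    next
      case False
      then have empty: "{p \<in> I. col (snd p) = i \<and> col (snd p) = j} = {}" by auto
      show ?thesis unfolding empty using distinct_colours(2,3)[OF ij False] T_col(1)[OF ij] ij by (simp add: inverse_pair_def)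
    qed
  qed
qed (use finite_I T_Hom UA_Hom(2)[OF _ k] C.cv_Hom col_I C.cv_G U_G[OF k] T_col in \<open>simp_all only:\<close>)

end

section \<open>The functor to the coloured presentation\<close>

context coloured
begin

declare merge.simps [simp del]

lemma \<beta>_incl: "i \<in> N \<Longrightarrow> b \<in> carrier (F i) \<Longrightarrow> \<beta> (\<iota> i b) = \<beta>c b i"
proof -
  assume ib: "i \<in> N" "b \<in> carrier (F i)"
  have "\<beta> (\<iota> i b) = \<beta>c (\<iota> i b i) i"
    unfolding \<beta>_def by (rule hsum_single) (use ib in \<open>auto simp: \<beta>c_zero in_Hom_iff\<close>)
  then show ?thesis using ib by simp
qed

lemma e_ext:
  assumes "u \<in> Hom \<C> [Up] Y" "v \<in> Hom \<C> [Up] Y" "\<And>i. i \<in> N \<Longrightarrow> u \<cdot> e i = v \<cdot> e i"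
  shows "u = v"
  by (rule C.e_faithful[where W = "[]" and Z = "[]" and Y = Y]) (use assms in \<open>simp_all add: in_Hom_iff\<close>)

lemma f_ext:
  assumes "u \<in> Hom \<C> [Down] Y" "v \<in> Hom \<C> [Down] Y" "\<And>i. i \<in> N \<Longrightarrow> u \<cdot> f i = v \<cdot> f i"
  shows "u = v"
  by (rule C.f_faithful[where W = "[]" and Z = "[]" and Y = Y]) (use assms in \<open>simp_all add: in_Hom_iff\<close>)

lemma merged_braid: "(s \<star> idm [Up]) \<cdot> (idm [Up] \<star> s) \<cdot> (s \<star> idm [Up]) = (idm [Up] \<star> s) \<cdot> (s \<star> idm [Up]) \<cdot> (idm [Up] \<star> s)"
proof (rule C.EEE_faithful[where Y = "[Up, Up, Up]"])
  fix i j l assume ijl: "i \<in> N" "j \<in> N" "l \<in> N"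
  have "(sc j l \<star> e i) \<cdot> (e j \<star> sc i l) \<cdot> (sc i j \<star> e l) = (e l \<star> sc i j) \<cdot> (sc i l \<star> e j) \<cdot> (e i \<star> sc j l)"
    using rel[OF col_heis_rels.braid, of i j l "[Up, Up, Up]" "[Up, Up, Up]"] ijl by (simp add: in_Hom_iff)
  then show "((s \<star> idm [Up]) \<cdot> (idm [Up] \<star> s) \<cdot> (s \<star> idm [Up])) \<cdot> C.e3 i j l
    = ((idm [Up] \<star> s) \<cdot> (s \<star> idm [Up]) \<cdot> (idm [Up] \<star> s)) \<cdot> C.e3 i j l"
    by (simp only: C.braid_col[OF ijl])
qed (simp_all add: in_Hom_iff)

lemma merged_square: "s \<cdot> s = idm UU"
proof (rule C.EE_faithful[where Y = "UU"])
  fix i j assume ij: "i \<in> N" "j \<in> N"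
  have "sc j i \<cdot> sc i j = e i \<star> e j"
    using rel[OF col_heis_rels.s_inverse, of i j "UU" "UU"] ij by (simp add: in_Hom_iff)
  then show "(s \<cdot> s) \<cdot> C.e2 i j = idm UU \<cdot> C.e2 i j"
    by (simp only: C.square_col[OF ij])
qed (simp_all add: in_Hom_iff)

lemma merged_x_\<beta>:
  assumes a: "a \<in> carrier A" shows "x \<cdot> \<beta> a = \<beta> a \<cdot> x"
proof (rule e_ext[where Y = "[Up]"])
  fix i assume i: "i \<in> N"
  have "xc i \<cdot> \<beta>c (a i) i = \<beta>c (a i) i \<cdot> xc i"
    using rel[OF col_heis_rels.x_beta, of i "a i" "[Up]" "[Up]"] i a by (simp add: in_Hom_iff)
  then show "(x \<cdot> \<beta> a) \<cdot> e i = (\<beta> a \<cdot> x) \<cdot> e i" by (simp only: C.x_\<beta>_col[OF a i])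
qed (use a in \<open>simp_all add: in_Hom_iff\<close>)

lemma merged_s_\<beta>:
  assumes a: "a \<in> carrier A" shows "s \<cdot> (\<beta> a \<star> idm [Up]) = (idm [Up] \<star> \<beta> a) \<cdot> s"
proof (rule C.EE_faithful[where Y = "UU"])
  fix i j assume ij: "i \<in> N" "j \<in> N"
  have "sc i j \<cdot> (\<beta>c (a i) i \<star> e j) = (e j \<star> \<beta>c (a i) i) \<cdot> sc i j"
    using rel[OF col_heis_rels.s_beta, of i j "a i" "UU" "UU"] ij a by (simp add: in_Hom_iff)
  then show "(s \<cdot> (\<beta> a \<star> idm [Up])) \<cdot> C.e2 i j
    = ((idm [Up] \<star> \<beta> a) \<cdot> s) \<cdot> C.e2 i j"
    by (simp only: C.s_\<beta>_col[OF a ij])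
qed (use a in \<open>simp_all add: in_Hom_iff\<close>)

lemma merged_x_s: "(x \<star> idm [Up]) \<cdot> s \<oplus>\<oplus> HScale \<C> (\<ominus>\<^bsub>R\<^esub> \<one>\<^bsub>R\<^esub>) (s \<cdot> (idm [Up] \<star> x))
    = hsum UU UU (\<lambda>b. \<beta> (dualA b) \<star> \<beta> b) BA" (is "?l = ?r")
proof (rule C.EE_faithful[where Y = "UU"])
  have H: "?r \<in> Hom \<C> UU UU"
    by (rule hsum_Hom) (simp add: in_Hom_iff dualA_closed BA_carrier)
  then show "?r \<in> Hom \<C> UU UU" .
  show "?l \<in> Hom \<C> UU UU" using minus_one by (simp add: in_Hom_iff)
  fix i j assume ij: "i \<in> N" "j \<in> N"
  let ?p = "C.e2 i j"
  let ?m = "if i = j then hsum UU UU (\<lambda>b. \<beta>c (dual i b) i \<star> \<beta>c b i) (B i) else zerom UU UU"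
  have m: "mor (if i = j then msum UU UU (\<lambda>b. Gen (BetaGen' (dual i b) i) \<boxtimes> Gen (BetaGen' b i)) (B i)
      else Zer UU UU) = ?m"
  proof (cases "i = j")
    case True
    then show ?thesis using ij by (simp, intro mor_msum_eq) (simp_all add: finite_B in_Hom_iff dual_closed B_F)
  qed simp
  have H': "?m \<in> Hom \<C> UU UU"
    using ij by (auto intro!: hsum_Hom zerom_Hom) (auto simp: in_Hom_iff dual_closed B_F)
  have "?l \<cdot> ?p = ((x \<star> idm [Up]) \<cdot> s) \<cdot> ?p \<oplus>\<oplus> HScale \<C> (\<ominus>\<^bsub>R\<^esub> \<one>\<^bsub>R\<^esub>) ((s \<cdot> (idm [Up] \<star> x)) \<cdot> ?p)"
    using ij minus_one by (simp del: comp_assoc_total)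
  also have "\<dots> = (xc j \<star> e i) \<cdot> sc i j \<oplus>\<oplus> HScale \<C> (\<ominus>\<^bsub>R\<^esub> \<one>\<^bsub>R\<^esub>) (sc i j \<cdot> (e i \<star> xc j))"
    by (simp only: C.x_s_col[OF ij])
  also have "\<dots> = ?m"
    unfolding m[symmetric]
    using rel[OF col_heis_rels.x_s[where B = B and R = R and tr = tr and F = F], OF ij, of "UU" "UU"] ij minus_one H' m
    by (simp add: in_Hom_iff mor_Sub del: mor_Add)
  also have "\<dots> = ?r \<cdot> ?p" by (simp only: C.casimir_col[OF ij])
  finally show "?l \<cdot> ?p = ?r \<cdot> ?p" .
qed

lemma merged_zigzag_up: "(d \<star> idm [Up]) \<cdot> (idm [Up] \<star> c) = idm [Up]"
proof (rule e_ext[where Y = "[Up]"])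
  fix i assume i: "i \<in> N"
  have "(dc i \<star> idm [Up]) \<cdot> (idm [Up] \<star> cc i) = e i"
    using rel[OF col_heis_rels.zigzag_up, of i "[Up]" "[Up]"] i by (simp add: in_Hom_iff)
  then show "((d \<star> idm [Up]) \<cdot> (idm [Up] \<star> c)) \<cdot> e i = idm [Up] \<cdot> e i"
    using i by (simp add: C.zigzag_up_col del: comp_assoc_total)
qed (simp_all add: in_Hom_iff)

lemma merged_zigzag_down: "zz c d = idm [Down]"
proof (rule f_ext[where Y = "[Down]"])
  fix i assume i: "i \<in> N"
  then show "zz c d \<cdot> f i = idm [Down] \<cdot> f i" using C.zigzag_down_col[OF i] by simp
qed (simp_all add: in_Hom_iff zz_def)

text \<open>
  By joint faithfulness each uncoloured relation can be checked on components, and its components are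
  coloured relations.
\<close>

lemma merge_respects:
  assumes "(lhs, rhs) \<in> heis_rels R A trA BA k"
  shows "mor (msubst merge lhs) = mor (msubst merge rhs)"
  using assms
proof (cases rule: heis_rels.cases)
  case beta_one
  have "\<beta> \<one>\<^bsub>A\<^esub> = hsum [Up] [Up] e N"
    unfolding \<beta>_def by (rule hsum_cong) (simp_all add: in_Hom_iff)
  then show ?thesis using beta_one by (simp add: e_sum')
next
  case (beta_mult a b)
  have "\<beta> (a \<otimes>\<^bsub>A\<^esub> b) = \<beta> a \<cdot> \<beta> b"
    by (rule e_ext[where Y = "[Up]"])
      (use beta_mult in \<open>simp_all add: in_Hom_iff C.\<beta>_mult_col \<beta>_col' \<beta>c_mult del: comp_assoc_total\<close>)
  then show ?thesis using beta_mult by simp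
next
  case (beta_add a b)
  have "\<beta> (a \<oplus>\<^bsub>A\<^esub> b) = \<beta> a \<oplus>\<oplus> \<beta> b"
    by (rule e_ext[where Y = "[Up]"]) (use beta_add in \<open>simp_all add: in_Hom_iff \<beta>_col' \<beta>c_add\<close>)
  then show ?thesis using beta_add by simp
next
  case (beta_smult r a)
  have "\<beta> (r \<odot>\<^bsub>A\<^esub> a) = HScale \<C> r (\<beta> a)"
    by (rule e_ext[where Y = "[Up]"]) (use beta_smult in \<open>simp_all add: in_Hom_iff \<beta>_col' \<beta>c_smult\<close>)
  then show ?thesis using beta_smult by simp
next
  case braid
  then show ?thesis using merged_braid by simp
next
  case s_square
  then show ?thesis using merged_square by simp
next
  case (x_beta a)
  then show ?thesis using merged_x_\<beta> by simp
next
  case (s_beta a)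
  then show ?thesis using merged_s_\<beta> by simp
next
  case x_s
  have "mor (msubst merge rhs) = hsum UU UU (\<lambda>b. \<beta> (dualA b) \<star> \<beta> b) BA"
    unfolding x_s(2) msubst_msum
    by (rule mor_msum_eq) (simp_all add: finite_BA in_Hom_iff dualA_closed BA_carrier)
  then show ?thesis using merged_x_s x_s(1) by (simp add: mor_Sub)
next
  case zigzag_up
  then show ?thesis using merged_zigzag_up by simp
next
  case zigzag_down
  then show ?thesis using merged_zigzag_down by simp
next
  case inversion_nonneg
  then have k: "k \<ge> 0" by simp
  let ?t = "rotated_crossing (Gen SGen) (Gen CGen) (Gen DGen)"
  let ?d = "\<lambda>(r, b). Gen DGen \<bullet> ((mpow \<one>\<^sub>+ (Gen XGen) r \<bullet> Gen (BetaGen (dualA b))) \<boxtimes> \<one>\<^sub>-)"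
  let ?u = "\<lambda>(r, b). Gen (UInv r b)"
  have I: "{..<nat k} \<times> BA = I" using k by simp
  have d: "mor (msubst merge (?d p)) = C.dvA p" if "p \<in> I" for p
    using that dualA_closed by (auto simp: case_prod_unfold C.dv_def C.tok_def)
  have u: "mor (msubst merge (?u p)) = UA p" for p by (simp add: case_prod_unfold mor_merge_U)
  have t: "mor (msubst merge ?t) = C.t" by (simp add: mor_rotated C.t_def)
  have H: "UA p \<cdot> C.dvA p \<in> Hom \<C> UD UD" if "p \<in> I" for p
    using UA_Hom(1)[OF that k] C.dv_Hom[OF that] by (simp add: in_Hom_iff)
  have inv: "column_inv (idm UD) C.t (\<lambda>p. mor (msubst merge (?d p))) I T (\<lambda>p. mor (msubst merge (?u p))) (idm DU)"
    by (rule iffD2[OF inverse_pair_cong merged_column[OF k]]) (simp_all only: d u H)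
  have "\<forall>(a, b) \<in> column_inverse UD (Idt UD) DU (Idt DU) (msubst merge ?t)
      (\<lambda>p. msubst merge (?d p)) I (msubst merge (Gen TInv)) (\<lambda>p. msubst merge (?u p)). mor a = mor b"
    by (rule iffD2[OF mor_column_inverse])
      (use inv UA_Hom(1)[OF _ k] in \<open>simp_all only: finite_I d u H t mor_Idt mor_merge msubst.simps, auto simp: in_Hom_iff\<close>)
  from this[THEN bspec, OF msubst_column_inverse[OF inversion_nonneg(2)[unfolded I], of merge, unfolded msubst.simps(2)]]
  show ?thesis by simp
next
  case inversion_neg
  then have k: "k < 0" by simp
  let ?t = "rotated_crossing (Gen SGen) (Gen CGen) (Gen DGen)"
  let ?c = "\<lambda>(r, b). (\<one>\<^sub>- \<boxtimes> (mpow \<one>\<^sub>+ (Gen XGen) r \<bullet> Gen (BetaGen (dualA b)))) \<bullet> Gen CGen"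
  let ?u = "\<lambda>(r, b). Gen (UInv r b)"
  have I: "{..<nat (- k)} \<times> BA = I" using k by simp
  have c: "mor (msubst merge (?c p)) = C.cvA p" if "p \<in> I" for p
    using that dualA_closed by (auto simp: case_prod_unfold C.cv_def C.tok_def)
  have u: "mor (msubst merge (?u p)) = UA p" for p by (simp add: case_prod_unfold mor_merge_U)
  have t: "mor (msubst merge ?t) = C.t" by (simp add: mor_rotated C.t_def)
  have H: "C.cvA p \<cdot> UA p \<in> Hom \<C> DU DU" if "p \<in> I" for p
    using UA_Hom(2)[OF that k] C.cv_Hom[OF that] by (simp add: in_Hom_iff)
  have inv: "row_inv (idm UD) C.t (\<lambda>p. mor (msubst merge (?c p))) I T (\<lambda>p. mor (msubst merge (?u p))) (idm DU)"
    by (rule iffD2[OF inverse_pair_cong merged_row[OF k]]) (simp_all only: c u H)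
  have "\<forall>(a, b) \<in> row_inverse UD (Idt UD) DU (Idt DU) (msubst merge ?t)
      (\<lambda>p. msubst merge (?c p)) I (msubst merge (Gen TInv)) (\<lambda>p. msubst merge (?u p)). mor a = mor b"
    by (rule iffD2[OF mor_row_inverse])
      (use inv UA_Hom(2)[OF _ k] in \<open>simp_all only: finite_I c u H t mor_Idt mor_merge msubst.simps, auto simp: in_Hom_iff\<close>)
  from this[THEN bspec, OF msubst_row_inverse[OF inversion_neg(2)[unfolded I], of merge, unfolded msubst.simps(2)]]
  show ?thesis by simp
qed

lemma mor_merge_strand [simp]: "i \<in> N \<Longrightarrow> mor (msubst merge (up_strand i)) = e i"
  by (simp add: up_strand_def \<beta>_incl)

lemma mor_merge_cup_cap [simp]:
  "i \<in> N \<Longrightarrow> mor (msubst merge (cup i)) = cc i" "i \<in> N \<Longrightarrow> mor (msubst merge (cap i)) = dc i"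
  by (simp_all add: cup_def cap_def tens_lay c_col d_col)

lemma merge_split:
  assumes g: "g \<in> col_heis_gens n F B k"
  shows "mor (msubst merge (split g)) = mor (Gen g)"
proof (cases g)
  case (UInv' i r b)
  then show ?thesis using g by (auto simp: col_heis_gens_def mor_merge_U UA_incl)
next
  case (TInv' i j)
  then show ?thesis using g T_col(1) by (auto simp: col_heis_gens_def C.G_def)
next
  case (SGen' i j)
  then show ?thesis using g s_col by (auto simp: col_heis_gens_def tens_lay)
qed (use g in \<open>auto simp: col_heis_gens_def x_col' \<beta>_incl\<close>)

end

section \<open>The isomorphism\<close>

theorem theorem3p2:
  fixes R :: "'k ring" and n :: nat and F :: "nat \<Rightarrow> ('k, 'a) module"
    and tr :: "nat \<Rightarrow> 'a \<Rightarrow> 'k" and B :: "nat \<Rightarrow> 'a set" and k :: int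
  assumes "cring R"
    and "\<And>i. i \<in> {1..n} \<Longrightarrow> frobenius_algebra R (F i) (tr i)"
    and "\<And>i. i \<in> {1..n} \<Longrightarrow> is_basis R (F i) (B i)"
  shows "lin_mon_cat_isomorphic R
    (Heis R (direct_sum n F) (sum_trace R n tr) (sum_basis n F B) k)
    (Heis' R n F tr B k)"
proof (cases "\<one>\<^bsub>R\<^esub> = \<zero>\<^bsub>R\<^esub>")
  case True
  then show ?thesis unfolding Heis_def Heis'_def by (rule zero_ring_isomorphic[OF assms(1)])
next
  case False
  interpret frobenius_sum R n F tr B k by (rule frobenius_sum.intro) (fact assms False)+
  interpret H: uncoloured R n F tr B k "heis_presentation R n F tr B k"
    by (intro uncoloured.intro strands.intro presented.intro uncoloured_axioms.intro frobenius_sum_axioms assms(1)) (rule HOL.refl)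
  interpret K: coloured R n F tr B k "col_presentation R n F tr B k"
    by (intro coloured.intro strands.intro presented.intro coloured_axioms.intro frobenius_sum_axioms assms(1)) (rule HOL.refl)
  show ?thesis unfolding Heis_def Heis'_def
  proof (rule presentations_isomorphic)
    show "presentation_map R (heis_presentation R n F tr B k) (col_presentation R n F tr B k) merge"
      by unfold_locales (use K.merge_typed K.merge_respects in \<open>simp_all add: K.mor_in_Hom\<close>)
    show "presentation_map R (col_presentation R n F tr B k) (heis_presentation R n F tr B k) split"
      by unfold_locales (use H.split_typed H.split_respects in \<open>simp_all add: H.mor_in_Hom\<close>)
  qed (simp_all add: H.split_merge K.merge_split)
qed

end
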